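(* Let $\Theta\subset\mathbb{R}$ be compact with $|\beta|<1$ for all $\beta\in\Theta$, let $\theta_0=\beta_0$ lie in the interior $\mathring\Theta$ of $\Theta$, let $\{\varepsilon_t\}_{t\in\mathbb{Z}}$ be i.i.d. real random variables with a Lebesgue density that is strictly positive on $\mathbb{R}$, $\mathbb{E}[\varepsilon_t]=0$ and $\mathbb{E}[\varepsilon_t^4]<\infty$, and let $\{X_t\}_{t\in\mathbb{Z}}$ be the causal stationary solution of the AR(1) equation $X_t=\beta_0X_{t-1}+\varepsilon_t$, $t\in\mathbb{Z}$. Consider the conditional mean of $X_{T+1}$, i.e. the prediction function $$\psi(X_T,X_{T-1},\dots;\theta)=\beta X_T,\qquad \theta=\beta,$$ the OLS estimator $\hat\theta(\mathbf{X}_{1:T})=\hat\beta(\mathbf{X}_{1:T})=\sum_{t=2}^TX_tX_{t-1}/\sum_{t=2}^TX_{t-1}^2$, the variance estimator $\hat\Upsilon(\mathbf{X}_{1:T})=1-\hat\beta(\mathbf{X}_{1:T})^2$, and $\Upsilon_0=1-\beta_0^2$. Let $\{s_t\},\{c_t\}$ be any real sequences. Let $0<a<b<1$ and let $T_E,T_P:\mathbb{N}\to\mathbb{N}$ satisfy $T_E(T)<T_P(T)$ for all $T$, with $T_E(T)=T-\lfloor T^b\rfloor$ and $T_P(T)=T-\lfloor T^a\rfloor$ for all sufficiently large $T$. Then, as $T\to\infty$: 1. (Estimator) $\sqrt T(\hat\theta(\mathbf{X}_{1:T})-\theta_0)\overset{d}{\to}N(0,\Upsilon_0)$. 2. (Differentiability)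 $\theta\mapsto\psi(X_T,X_{T-1},\dots;\theta)$ is continuous on $\Theta$ and twice differentiable on $\mathring\Theta$. 3. (Gradient) $\big\|\frac{\partial\psi(X_T,X_{T-1},\dots;\theta_0)}{\partial\theta}\big\|=O_p(1)$. 4. (Hessian) For some open neighborhood $\mathscr V(\theta_0)$ of $\theta_0$, $\sup_{\theta\in\mathscr V(\theta_0)}\big\|\frac{\partial^2\psi(X_T,X_{T-1},\dots;\theta)}{\partial\theta\,\partial\theta'}\big\|=O_p(1)$. 5. (Initial condition) For every sequence of integers $t_1=t_1(T)$ with $1\le t_1\le T$ and $(T-t_1)/\log T\to\infty$, $$\sqrt T\big(\psi^s_{T+1}(\mathbf{X}^c_{t_1:T};\theta_0)-\psi(X_T,X_{T-1},\dots;\theta_0)\big)=o_p(1),$$ $$\Big\|\tfrac{\partial\psi^s_{T+1}(\mathbf{X}^c_{t_1:T};\theta_0)}{\partial\theta}-\tfrac{\partial\psi(X_T,X_{T-1},\dots;\theta_0)}{\partial\theta}\Big\|=o_p(1),$$ $$\sup_{\theta\in\mathscr V(\theta_0)}\Big\|\tfrac{\partial^2\psi^s_{T+1}(\mathbf{X}^c_{t_1:T};\theta)}{\partial\theta\,\partial\theta'}-\tfrac{\partial^2\psi(X_T,X_{T-1},\dots;\theta)}{\partial\theta\,\partial\theta'}\Big\|=o_p(1).$$ 6. (Rates) $(T-T_P(T))/\log T\to\infty$ and $\sqrt{T_E(T)}/\sqrt T\to1$. 7. (Strict stationarity) $\{X_t\}$ is strictly stationary. 8. (Weak dependence) For each bounded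 Lipschitz $h:\mathbb{R}\to\mathbb{R}$, writing $Z_T=\sqrt{T_E(T)}\,(\hat\theta(\mathbf{X}_{1:T_E(T)})-\theta_0)$, $$\mathbb{E}\big[h(Z_T)\,\big|\,\sigma(X_t:T_P(T)\le t\le T)\big]-\mathbb{E}[h(Z_T)]\overset{p}{\to}0.$$ 9. (Variance and cdf estimators) $\hat\Upsilon(\mathbf{X}_{1:T})\overset{p}{\to}\Upsilon_0$, and for $\widehat G_T$ the cdf of $N(0,\hat\Upsilon(\mathbf{X}_{1:T}))$ and $G_\infty$ the cdf of $N(0,\Upsilon_0)$, $\int h\,d\widehat G_T\overset{p}{\to}\int h\,dG_\infty$ for each bounded Lipschitz $h:\mathbb{R}\to\mathbb{R}$.
   Context: All random variables live on a probability space $(\Omega,\mathcal F,\mathbb{P})$. $\|\cdot\|$ is the Euclidean norm, $\lfloor x\rfloor$ the largest integer not exceeding $x$, and $\mathbf{X}_{t_1:t_2}=(X_{t_1},\dots,X_{t_2})'$. For deterministic sequences $\{s_t\}$ (replacing presample values) and $\{c_t\}$ (replacing the first $t_1-1$ observations), $$\psi^s_{T+1}(\mathbf{X}^c_{t_1:T};\theta)=\psi(X_T,X_{T-1},\dots,X_{t_1},c_{t_1-1},\dots,c_1,s_0,s_{-1},\dots;\theta),$$ i.e. $\psi$ evaluated with $X_t$ replaced by $c_t$ for $1\le t\le t_1-1$ and by $s_t$ for $t\le0$. $O_p$, $o_p$, $\overset{d}{\to}$, $\overset{p}{\to}$ refer to $T\to\infty$. Convention: on the event that $\hat\Upsilon(\mathbf{X}_{1:T})$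 is not well defined or is negative, $\widehat G_T$ is an arbitrary fixed cdf. *)

theory Defs
  imports "HOL-Probability.Probability"
begin

section \<open>Stochastic orders and modes of convergence\<close>

text \<open>
  Magnitudes are \<open>ennreal\<close>-valued so that suprema over a parameter set are genuine (possibly
  infinite) suprema.  Measurability is part of the definitions, because \<open>measure\<close> returns \<open>0\<close> on
  non-measurable sets.
\<close>

definition Op_one :: "'a measure \<Rightarrow> (nat \<Rightarrow> 'a \<Rightarrow> ennreal) \<Rightarrow> bool" where
  "Op_one M Y \<longleftrightarrow> (\<forall>T. Y T \<in> borel_measurable M) \<and>
     (\<forall>e>0. \<exists>K::real. \<forall>\<^sub>F T in sequentially. measure M {\<omega> \<in> space M. Y T \<omega> > ennreal K} < e)"

definition op_one :: "'a measure \<Rightarrow> (nat \<Rightarrow> 'a \<Rightarrow> ennreal) \<Rightarrow> bool" where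
  "op_one M Y \<longleftrightarrow> (\<forall>T. Y T \<in> borel_measurable M) \<and>
     (\<forall>e>0. (\<lambda>T. measure M {\<omega> \<in> space M. Y T \<omega> > ennreal e}) \<longlonglongrightarrow> 0)"

definition tendsto_in_prob :: "'a measure \<Rightarrow> (nat \<Rightarrow> 'a \<Rightarrow> real) \<Rightarrow> real \<Rightarrow> bool" where
  "tendsto_in_prob M Y y \<longleftrightarrow> op_one M (\<lambda>T \<omega>. ennreal (dist (Y T \<omega>) y))"

definition tendsto_in_distr :: "'a measure \<Rightarrow> (nat \<Rightarrow> 'a \<Rightarrow> real) \<Rightarrow> real measure \<Rightarrow> bool" where
  "tendsto_in_distr M Y N \<longleftrightarrow>
     (\<forall>T. Y T \<in> borel_measurable M) \<and> weak_conv_m (\<lambda>T. distr M borel (Y T)) N"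

definition bounded_lipschitz :: "(real \<Rightarrow> real) \<Rightarrow> bool" where
  "bounded_lipschitz h \<longleftrightarrow> bounded (range h) \<and> (\<exists>L. L-lipschitz_on UNIV h)"

section \<open>Distributions and distribution functions\<close>

text \<open>
  \<open>normal_density\<close> is identically zero for standard deviation \<open>0\<close>; variance \<open>0\<close> has to be
  the point mass.
\<close>

definition normal_law :: "real \<Rightarrow> real \<Rightarrow> real measure" where
  "normal_law m v =
     (if v = 0 then return borel m else density lborel (\<lambda>x. ennreal (normal_density m (sqrt v) x)))"

definition is_cdf :: "(real \<Rightarrow> real) \<Rightarrow> bool" where
  "is_cdf G \<longleftrightarrow> (\<exists>N. real_distribution N \<and> G = cdf N)"

definition stieltjes_integral :: "(real \<Rightarrow> real) \<Rightarrow> (real \<Rightarrow> real) \<Rightarrow> real" where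
  "stieltjes_integral G h = (\<integral>x. h x \<partial>interval_measure G)"

section \<open>Processes indexed by the integers\<close>

definition iid :: "'a measure \<Rightarrow> (int \<Rightarrow> 'a \<Rightarrow> real) \<Rightarrow> bool" where
  "iid M Y \<longleftrightarrow> prob_space.indep_vars M (\<lambda>_. borel) Y UNIV \<and>
     (\<forall>s t. distr M borel (Y s) = distr M borel (Y t))"

definition weakly_stationary :: "'a measure \<Rightarrow> (int \<Rightarrow> 'a \<Rightarrow> real) \<Rightarrow> bool" where
  "weakly_stationary M X \<longleftrightarrow>
     (\<forall>t. X t \<in> borel_measurable M \<and> integrable M (\<lambda>\<omega>. (X t \<omega>)\<^sup>2)) \<and>
     (\<forall>t h. (\<integral>\<omega>. X (t + h) \<omega> \<partial>M) = (\<integral>\<omega>. X t \<omega> \<partial>M)) \<and>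
     (\<forall>s t h.
        (\<integral>\<omega>. (X (s + h) \<omega> - (\<integral>\<omega>'. X (s + h) \<omega>' \<partial>M)) * (X (t + h) \<omega> - (\<integral>\<omega>'. X (t + h) \<omega>' \<partial>M)) \<partial>M) =
        (\<integral>\<omega>. (X s \<omega> - (\<integral>\<omega>'. X s \<omega>' \<partial>M)) * (X t \<omega> - (\<integral>\<omega>'. X t \<omega>' \<partial>M)) \<partial>M))"

definition strictly_stationary :: "'a measure \<Rightarrow> (int \<Rightarrow> 'a \<Rightarrow> real) \<Rightarrow> bool" where
  "strictly_stationary M X \<longleftrightarrow>
     (\<forall>t. X t \<in> borel_measurable M) \<and>
     (\<forall>J h. finite J \<longrightarrow>
        distr M (Pi\<^sub>M J (\<lambda>_. borel)) (\<lambda>\<omega>. \<lambda>t\<in>J. X (t + h) \<omega>) =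
        distr M (Pi\<^sub>M J (\<lambda>_. borel)) (\<lambda>\<omega>. \<lambda>t\<in>J. X t \<omega>))"

text \<open>
  Stationarity is meant in the second-order sense and causality as the existence of an
  absolutely summable one-sided moving-average representation, as is usual for ARMA equations
  (Brockwell and Davis).
\<close>

definition causal_in :: "'a measure \<Rightarrow> (int \<Rightarrow> 'a \<Rightarrow> real) \<Rightarrow> (int \<Rightarrow> 'a \<Rightarrow> real) \<Rightarrow> bool" where
  "causal_in M eps X \<longleftrightarrow> (\<exists>a :: nat \<Rightarrow> real. summable (\<lambda>j. \<bar>a j\<bar>) \<and>
     (\<forall>t. AE \<omega> in M. (\<lambda>j. a j * eps (t - int j) \<omega>) sums X t \<omega>))"

definition causal_stationary_AR1 ::
    "'a measure \<Rightarrow> real \<Rightarrow> (int \<Rightarrow> 'a \<Rightarrow> real) \<Rightarrow> (int \<Rightarrow> 'a \<Rightarrow> real) \<Rightarrow> bool" where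
  "causal_stationary_AR1 M \<beta> eps X \<longleftrightarrow>
     (\<forall>t. AE \<omega> in M. X t \<omega> = \<beta> * X (t - 1) \<omega> + eps t \<omega>) \<and>
     weakly_stationary M X \<and> causal_in M eps X"

definition gen_sigma :: "'a measure \<Rightarrow> (int \<Rightarrow> 'a \<Rightarrow> real) \<Rightarrow> int set \<Rightarrow> 'a measure" where
  "gen_sigma M X I = sigma (space M) {X t -` A \<inter> space M | t A. t \<in> I \<and> A \<in> sets borel}"

section \<open>Prediction function and estimators\<close>

text \<open>
  A prediction function takes the sequence of values in reverse time order (argument \<open>k\<close> is the
  value \<open>k\<close> steps back) and the parameter.
\<close>

definition psi :: "(nat \<Rightarrow> real) \<Rightarrow> real \<Rightarrow> real" where
  "psi x \<theta> = \<theta> * x 0"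

definition past :: "(int \<Rightarrow> real) \<Rightarrow> nat \<Rightarrow> nat \<Rightarrow> real" where
  "past x T k = x (int T - int k)"

definition truncate_path ::
    "(int \<Rightarrow> real) \<Rightarrow> (int \<Rightarrow> real) \<Rightarrow> int \<Rightarrow> (int \<Rightarrow> real) \<Rightarrow> int \<Rightarrow> real" where
  "truncate_path s c t\<^sub>1 x t = (if t \<le> 0 then s t else if t < t\<^sub>1 then c t else x t)"

definition psi_full :: "(int \<Rightarrow> 'a \<Rightarrow> real) \<Rightarrow> nat \<Rightarrow> 'a \<Rightarrow> real \<Rightarrow> real" where
  "psi_full X T \<omega> \<theta> = psi (past (\<lambda>t. X t \<omega>) T) \<theta>"

definition psi_trunc ::
    "(int \<Rightarrow> real) \<Rightarrow> (int \<Rightarrow> real) \<Rightarrow> int \<Rightarrow> (int \<Rightarrow> 'a \<Rightarrow> real) \<Rightarrow> nat \<Rightarrow> 'a \<Rightarrow> real \<Rightarrow> real" where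
  "psi_trunc s c t\<^sub>1 X T \<omega> \<theta> = psi (past (truncate_path s c t\<^sub>1 (\<lambda>t. X t \<omega>)) T) \<theta>"

text \<open>
  If the denominator vanishes (a null event for \<open>T \<ge> 2\<close> in the AR(1) model), the estimator
  takes the value \<open>0\<close> by the convention \<open>x / 0 = 0\<close>.
\<close>

definition ols_denom :: "nat \<Rightarrow> (int \<Rightarrow> 'a \<Rightarrow> real) \<Rightarrow> 'a \<Rightarrow> real" where
  "ols_denom T X \<omega> = (\<Sum>t = 2..int T. (X (t - 1) \<omega>)\<^sup>2)"

definition beta_hat :: "nat \<Rightarrow> (int \<Rightarrow> 'a \<Rightarrow> real) \<Rightarrow> 'a \<Rightarrow> real" where
  "beta_hat T X \<omega> = (\<Sum>t = 2..int T. X t \<omega> * X (t - 1) \<omega>) / ols_denom T X \<omega>"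

definition Upsilon_hat :: "nat \<Rightarrow> (int \<Rightarrow> 'a \<Rightarrow> real) \<Rightarrow> 'a \<Rightarrow> real" where
  "Upsilon_hat T X \<omega> = 1 - (beta_hat T X \<omega>)\<^sup>2"

text \<open>\<open>G\<^sub>0\<close> is the fixed fallback cdf on the event where the variance estimator is undefined or
  negative.\<close>

definition G_hat :: "(real \<Rightarrow> real) \<Rightarrow> nat \<Rightarrow> (int \<Rightarrow> 'a \<Rightarrow> real) \<Rightarrow> 'a \<Rightarrow> real \<Rightarrow> real" where
  "G_hat G\<^sub>0 T X \<omega> =
     (if ols_denom T X \<omega> = 0 \<or> Upsilon_hat T X \<omega> < 0 then G\<^sub>0
      else cdf (normal_law 0 (Upsilon_hat T X \<omega>)))"

end

(* Write X_t = beta X_{t-1} + eps_t. The OLS error is S / D with S the martingale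
   sum of X_{t-1} eps_t and D the sum of X_{t-1}^2. Squaring the AR equation and
   summing expresses D through martingales and boundary terms, which gives the law
   of large numbers for D in L1. The central limit theorem for S follows by
   comparing conditional characteristic functions of successive increments with
   Gaussian ones, since the conditional variances of the increments are
   proportional to X_{t-1}^2 and sum to a multiple of D.

   For the weak dependence, X_p = beta^(p-e) X_e + eps_p + (terms independent of
   both), so conditionally on everything but eps_p a change of the past up to time e
   acts on the block X_p, ..., X_T as a translation of the innovation density by
   beta^(p-e) X_e. Continuity of translation in L1 makes its effect vanish. *)
theory Submission
  imports Defs "HOL-Real_Asymp.Real_Asymp"
begin

section \<open>Convergence in probability\<close>

text \<open>The causal representation determines \<open>X\<close> from the innovations only almost
  surely, and the generated sigma-algebras are not completed, so \<open>X t\<close> itself may fail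
  to be measurable for the innovations up to \<open>t\<close>. The proof therefore works with an
  everywhere defined version \<open>Y\<close> for which this measurability is exact;
  \<open>X\<close> re-enters through almost-sure identities. Independence of disjoint blocks of
  innovations is used as a product law with Fubini (all but one innovation frozen), which does the
  work of conditional expectations in the limit theorems. Only second-order stationarity is given
  for \<open>X\<close>, so the fourth-moment bounds that control the Taylor errors come from the
  absolute summability of the causal weights. The translation estimate is uniform over all events of
  the block \<open>X_p, ..., X_T\<close>; testing it on the two sign events of the centred
  conditional expectation turns it into L1 convergence. Since the prediction function reads only
  \<open>X_T\<close> and is linear in the parameter, its truncation errors vanish exactly from
  \<open>T = 1\<close> on.\<close>

lemma tendsto_zero_squeeze:
  fixes f g :: "nat \<Rightarrow> real"
  assumes "\<And>n. 0 \<le> f n" "\<And>n. f n \<le> g n" "g \<longlonglongrightarrow> 0"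
  shows "f \<longlonglongrightarrow> 0"
  by (rule tendsto_sandwich[OF _ _ tendsto_const assms(3)]) (use assms in auto)

lemma (in prob_space) tendsto_in_prob_iff:
  assumes [measurable]: "\<And>T. Y T \<in> borel_measurable M"
  shows "tendsto_in_prob M Y y \<longleftrightarrow>
    (\<forall>e>0. (\<lambda>T. prob {\<omega> \<in> space M. \<bar>Y T \<omega> - y\<bar> > e}) \<longlonglongrightarrow> 0)"
proof -
  have "ennreal e < ennreal (dist (Y T \<omega>) y) \<longleftrightarrow> \<bar>Y T \<omega> - y\<bar> > e" if "e > 0" for e T \<omega>
    using that by (simp add: dist_real_def ennreal_less_iff)
  then show ?thesis
    unfolding tendsto_in_prob_def op_one_def by (auto simp: dist_real_def)
qed

text \<open>A deviation of \<open>W\<close> forces, up to a null set, a deviation of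
  \<open>Y\<close> or \<open>Z\<close>, with a margin \<open>d\<close> that does not depend on
  \<open>T\<close>. The condition is almost sure because the estimators match their closed formulas
  only outside null sets, and two controlling sequences are allowed so that one of them can keep a
  denominator away from zero.\<close>

lemma (in prob_space) tendsto_in_prob_squeeze:
  assumes W: "\<And>T. W T \<in> borel_measurable M"
    and Y: "\<And>T. Y T \<in> borel_measurable M" "tendsto_in_prob M Y y"
    and Z: "\<And>T. Z T \<in> borel_measurable M" "tendsto_in_prob M Z z"
    and close: "\<And>e. e > 0 \<Longrightarrow> \<exists>d>0. \<forall>T. AE \<omega> in M. \<bar>Y T \<omega> - y\<bar> \<le> d \<longrightarrow> \<bar>Z T \<omega> - z\<bar> \<le> d \<longrightarrow> \<bar>W T \<omega> - w\<bar> \<le> e"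
  shows "tendsto_in_prob M W w"
  unfolding tendsto_in_prob_iff[OF W]
proof (intro allI impI)
  note [measurable] = W Y(1) Z(1)
  fix e :: real assume "e > 0"
  then obtain d where d: "d > 0" and
    AE: "\<And>T. AE \<omega> in M. \<bar>Y T \<omega> - y\<bar> \<le> d \<longrightarrow> \<bar>Z T \<omega> - z\<bar> \<le> d \<longrightarrow> \<bar>W T \<omega> - w\<bar> \<le> e"
    using close by blast
  let ?p = "\<lambda>T. prob {\<omega> \<in> space M. \<bar>Y T \<omega> - y\<bar> > d} + prob {\<omega> \<in> space M. \<bar>Z T \<omega> - z\<bar> > d}"
  have le: "prob {\<omega> \<in> space M. \<bar>W T \<omega> - w\<bar> > e} \<le> ?p T" for T
  proof -
    have "prob {\<omega> \<in> space M. \<bar>W T \<omega> - w\<bar> > e} \<le>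
        prob ({\<omega> \<in> space M. \<bar>Y T \<omega> - y\<bar> > d} \<union> {\<omega> \<in> space M. \<bar>Z T \<omega> - z\<bar> > d})"
      using AE[of T] by (intro finite_measure_mono_AE) auto
    also have "\<dots> \<le> ?p T" by (intro measure_Un_le) auto
    finally show ?thesis .
  qed
  have "?p \<longlonglongrightarrow> 0 + 0"
    using Y Z d by (intro tendsto_add) (auto simp: tendsto_in_prob_iff)
  then show "(\<lambda>T. prob {\<omega> \<in> space M. \<bar>W T \<omega> - w\<bar> > e}) \<longlonglongrightarrow> 0"
    by (intro tendsto_zero_squeeze[OF measure_nonneg le]) simp
qed

text \<open>A continuous mapping theorem with continuity at the limit point only, since the maps
  applied later are quotients that break down where a denominator is zero.\<close>

lemma (in prob_space) tendsto_in_prob_isCont2: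
  fixes g :: "real \<times> real \<Rightarrow> real"
  assumes W: "\<And>T. W T \<in> borel_measurable M"
    and Y: "\<And>T. Y T \<in> borel_measurable M" "tendsto_in_prob M Y y"
    and Z: "\<And>T. Z T \<in> borel_measurable M" "tendsto_in_prob M Z z"
    and g: "isCont g (y, z)"
    and eq: "\<And>T. AE \<omega> in M. W T \<omega> = g (Y T \<omega>, Z T \<omega>)"
  shows "tendsto_in_prob M W (g (y, z))"
proof (rule tendsto_in_prob_squeeze[OF W Y Z])
  fix e :: real assume "e > 0"
  then obtain d where d: "d > 0" "\<And>p. dist p (y, z) < d \<Longrightarrow> dist (g p) (g (y, z)) < e"
    using g unfolding continuous_at_eps_delta by blast
  \<comment> \<open>The Euclidean distance is at most the sum of the coordinate distances, so thirds
    stay strictly inside the radius \<open>d\<close>.\<close>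
  have "dist (u, v) (y, z) < d" if "\<bar>u - y\<bar> \<le> d / 3" "\<bar>v - z\<bar> \<le> d / 3" for u v
  proof -
    have "dist (u, v) (y, z) \<le> \<bar>u - y\<bar> + \<bar>v - z\<bar>"
      unfolding dist_Pair_Pair dist_real_def by (rule sqrt_sum_squares_le_sum_abs[THEN order_trans]) auto
    then show ?thesis using that d by linarith
  qed
  then have bnd: "\<bar>g (u, v) - g (y, z)\<bar> \<le> e" if "\<bar>u - y\<bar> \<le> d / 3" "\<bar>v - z\<bar> \<le> d / 3" for u v
    using d(2)[of "(u, v)"] that by (simp add: dist_real_def less_imp_le)
  have "AE \<omega> in M. \<bar>Y T \<omega> - y\<bar> \<le> d / 3 \<longrightarrow> \<bar>Z T \<omega> - z\<bar> \<le> d / 3 \<longrightarrow> \<bar>W T \<omega> - g (y, z)\<bar> \<le> e" for T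
    using eq[of T] by eventually_elim (intro impI, simp only: bnd)
  then show "\<exists>d>0. \<forall>T. AE \<omega> in M. \<bar>Y T \<omega> - y\<bar> \<le> d \<longrightarrow> \<bar>Z T \<omega> - z\<bar> \<le> d \<longrightarrow> \<bar>W T \<omega> - g (y, z)\<bar> \<le> e"
    using d(1) by (intro exI[of _ "d / 3"]) auto
qed

lemma (in prob_space) tendsto_in_prob_L1:
  assumes int: "\<And>T. integrable M (Y T)"
    and lim: "(\<lambda>T. \<integral>\<omega>. \<bar>Y T \<omega> - y\<bar> \<partial>M) \<longlonglongrightarrow> 0"
  shows "tendsto_in_prob M Y y"
proof -
  have [measurable]: "\<And>T. Y T \<in> borel_measurable M" using int by blast
  show ?thesis
    unfolding tendsto_in_prob_iff[OF borel_measurable_integrable[OF int]]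
  proof (intro allI impI)
    fix e :: real assume e: "e > 0"
    have le: "prob {\<omega> \<in> space M. \<bar>Y T \<omega> - y\<bar> > e} \<le> (\<integral>\<omega>. \<bar>Y T \<omega> - y\<bar> \<partial>M) / e" for T
    proof -
      have "prob {\<omega> \<in> space M. \<bar>Y T \<omega> - y\<bar> > e} \<le> prob {\<omega> \<in> space M. e \<le> \<bar>Y T \<omega> - y\<bar>}"
        by (intro finite_measure_mono) auto
      also have "\<dots> \<le> (\<integral>\<omega>. \<bar>Y T \<omega> - y\<bar> \<partial>M) / e"
        using int e by (intro integral_Markov_inequality_measure[where A="{}"]) auto
      finally show ?thesis .
    qed
    have "(\<lambda>T. (\<integral>\<omega>. \<bar>Y T \<omega> - y\<bar> \<partial>M) / e) \<longlonglongrightarrow> 0"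
      using tendsto_divide[OF lim tendsto_const, of e] e by simp
    then show "(\<lambda>T. prob {\<omega> \<in> space M. \<bar>Y T \<omega> - y\<bar> > e}) \<longlonglongrightarrow> 0"
      by (rule tendsto_zero_squeeze[OF measure_nonneg le])
  qed
qed

lemma (in prob_space) second_moment_tail:
  assumes [measurable]: "U \<in> borel_measurable M" and U2: "integrable M (\<lambda>\<omega>. (U \<omega>)\<^sup>2)"
    and le: "(\<integral>\<omega>. (U \<omega>)\<^sup>2 \<partial>M) \<le> C" and K: "K > 0"
  shows "prob {\<omega> \<in> space M. \<bar>U \<omega>\<bar> > K} \<le> C / K\<^sup>2"
proof -
  have "prob {\<omega> \<in> space M. \<bar>U \<omega>\<bar> > K} \<le> prob {\<omega> \<in> space M. K\<^sup>2 \<le> (U \<omega>)\<^sup>2}"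
    using K by (intro finite_measure_mono) (auto simp: abs_le_square_iff[symmetric])
  also have "\<dots> \<le> (\<integral>\<omega>. (U \<omega>)\<^sup>2 \<partial>M) / K\<^sup>2"
    using U2 K by (intro integral_Markov_inequality_measure[where A="{}"]) auto
  also have "\<dots> \<le> C / K\<^sup>2" using le by (intro divide_right_mono) auto
  finally show ?thesis .
qed

text \<open>A stochastically bounded factor times a vanishing one. Boundedness enters as a uniform
  second moment: Chebyshev makes \<open>\<bar>U\<bar> > K\<close> rare, and elsewhere only
  \<open>V\<close> has to be small.\<close>

lemma (in prob_space) tendsto_in_prob_bounded_times_small:
  assumes U[measurable]: "\<And>T. U T \<in> borel_measurable M"
    and U2: "\<And>T. integrable M (\<lambda>\<omega>. (U T \<omega>)\<^sup>2)" "\<And>T. (\<integral>\<omega>. (U T \<omega>)\<^sup>2 \<partial>M) \<le> C"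
    and V[measurable]: "\<And>T. V T \<in> borel_measurable M" and Vlim: "tendsto_in_prob M V 0"
  shows "tendsto_in_prob M (\<lambda>T \<omega>. U T \<omega> * V T \<omega>) 0"
proof -
  have UV: "\<And>T. (\<lambda>\<omega>. U T \<omega> * V T \<omega>) \<in> borel_measurable M" by measurable
  have C: "C \<ge> 0" using order_trans[OF integral_nonneg_AE U2(2)] by auto
  show ?thesis
    unfolding tendsto_in_prob_iff[OF UV]
  proof (intro allI impI tendstoI)
    fix e r :: real assume e: "e > 0" and r: "r > 0"
    \<comment> \<open>Chosen so that the Chebyshev bound \<open>C / K\<^sup>2\<close> is below
      \<open>r / 2\<close>; the added 1 makes this strict and keeps \<open>K\<close> positive when
      \<open>C = 0\<close>.\<close>
    define K where "K = sqrt (2 * C / r) + 1"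
    have K: "K > 0" unfolding K_def using C r by (simp add: add_nonneg_pos)
    have "2 * C / r < K\<^sup>2"
    proof -
      have "2 * C / r = (sqrt (2 * C / r))\<^sup>2" using C r by simp
      also have "\<dots> < K\<^sup>2" unfolding K_def using C r by (intro power_strict_mono) auto
      finally show ?thesis .
    qed
    then have CK: "C / K\<^sup>2 < r / 2" using K r by (simp add: field_simps)
    have le: "prob {\<omega> \<in> space M. \<bar>U T \<omega> * V T \<omega> - 0\<bar> > e} \<le> C / K\<^sup>2 + prob {\<omega> \<in> space M. \<bar>V T \<omega> - 0\<bar> > e / K}" for T
    proof -
      have "prob {\<omega> \<in> space M. \<bar>U T \<omega> * V T \<omega> - 0\<bar> > e} \<le>
        prob ({\<omega> \<in> space M. \<bar>U T \<omega>\<bar> > K} \<union> {\<omega> \<in> space M. \<bar>V T \<omega> - 0\<bar> > e / K})"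
      proof (intro finite_measure_mono subsetI)
        fix \<omega> assume *: "\<omega> \<in> {\<omega> \<in> space M. \<bar>U T \<omega> * V T \<omega> - 0\<bar> > e}"
        show "\<omega> \<in> {\<omega> \<in> space M. \<bar>U T \<omega>\<bar> > K} \<union> {\<omega> \<in> space M. \<bar>V T \<omega> - 0\<bar> > e / K}"
        proof (rule ccontr)
          assume "\<not> ?thesis"
          then have "\<bar>U T \<omega>\<bar> * \<bar>V T \<omega>\<bar> \<le> K * (e / K)" using * K e by (intro mult_mono) auto
          then show False using * K by (simp add: abs_mult)
        qed
      qed auto
      also have "\<dots> \<le> prob {\<omega> \<in> space M. \<bar>U T \<omega>\<bar> > K} + prob {\<omega> \<in> space M. \<bar>V T \<omega> - 0\<bar> > e / K}"
        by (intro measure_Un_le) auto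
      also have "\<dots> \<le> C / K\<^sup>2 + prob {\<omega> \<in> space M. \<bar>V T \<omega> - 0\<bar> > e / K}"
        using second_moment_tail[OF U U2(1) U2(2) K] by simp
      finally show ?thesis .
    qed
    have "\<forall>\<^sub>F T in sequentially. prob {\<omega> \<in> space M. \<bar>V T \<omega> - 0\<bar> > e / K} < r / 2"
      using Vlim e K r unfolding tendsto_in_prob_iff[OF V] by (intro order_tendstoD(2)[where y=0]) auto
    then show "\<forall>\<^sub>F T in sequentially. dist (prob {\<omega> \<in> space M. \<bar>U T \<omega> * V T \<omega> - 0\<bar> > e}) 0 < r"
    proof eventually_elim
      case (elim T)
      then have "prob {\<omega> \<in> space M. \<bar>U T \<omega> * V T \<omega> - 0\<bar> > e} < r"
        using le[of T] CK by linarith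
      then show ?case by (simp only: dist_real_def diff_0_right abs_of_nonneg measure_nonneg)
    qed
  qed
qed

section \<open>Characteristic functions under small perturbations\<close>

lemma norm_integral_le:
  fixes f :: "'a \<Rightarrow> 'b::{banach, second_countable_topology}"
  assumes "integrable M f" "integrable M g" "\<And>x. x \<in> space M \<Longrightarrow> norm (f x) \<le> g x"
  shows "norm (\<integral>x. f x \<partial>M) \<le> (\<integral>x. g x \<partial>M)"
proof -
  have "norm (\<integral>x. f x \<partial>M) \<le> (\<integral>x. norm (f x) \<partial>M)" by (rule integral_norm_bound)
  also have "\<dots> \<le> (\<integral>x. g x \<partial>M)" using assms by (intro integral_mono) auto
  finally show ?thesis .
qed

lemma norm_iexp_diff_le: "cmod (iexp x - iexp y) \<le> \<bar>x - y\<bar>"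
proof -
  have "cmod (iexp x - iexp y) = cmod (iexp y * (iexp (x - y) - 1))"
    by (simp add: algebra_simps exp_add[symmetric])
  also have "\<dots> = cmod (iexp (x - y) - 1)" by (simp add: norm_mult)
  also have "\<dots> \<le> \<bar>x - y\<bar>" using iexp_approx1[of "x - y" 0] by simp
  finally show ?thesis .
qed

text \<open>Slutsky's lemma on the level of characteristic functions.\<close>
lemma (in prob_space) char_tendsto_perturb:
  assumes Y[measurable]: "\<And>T. Y T \<in> borel_measurable M" and Z[measurable]: "\<And>T. Z T \<in> borel_measurable M"
    and diff: "tendsto_in_prob M (\<lambda>T \<omega>. Z T \<omega> - Y T \<omega>) 0"
    and lim: "(\<lambda>T. \<integral>\<omega>. iexp (u * Y T \<omega>) \<partial>M) \<longlonglongrightarrow> l"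
  shows "(\<lambda>T. \<integral>\<omega>. iexp (u * Z T \<omega>) \<partial>M) \<longlonglongrightarrow> l"
proof -
  have ZY: "\<And>T. (\<lambda>\<omega>. Z T \<omega> - Y T \<omega>) \<in> borel_measurable M" by measurable
  have int: "integrable M (\<lambda>\<omega>. iexp (u * W \<omega>))" if [measurable]: "W \<in> borel_measurable M" for W
    by (rule integrable_const_bound[where B=1]) auto
  have "(\<lambda>T. (\<integral>\<omega>. iexp (u * Z T \<omega>) \<partial>M) - (\<integral>\<omega>. iexp (u * Y T \<omega>) \<partial>M)) \<longlonglongrightarrow> 0"
  proof (rule tendstoI)
    fix r :: real assume r: "r > 0"
    \<comment> \<open>\<open>\<bar>u\<bar> + 1\<close> instead of \<open>\<bar>u\<bar>\<close>
      covers \<open>u = 0\<close>. The bound below uses the Lipschitz estimate where the difference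
      is at most \<open>e\<close> and the trivial bound 2 elsewhere.\<close>
    define e where "e = r / (2 * (\<bar>u\<bar> + 1))"
    have e: "e > 0" "\<bar>u\<bar> * e < r / 2" using r unfolding e_def by (auto simp: field_simps)
    have le: "cmod ((\<integral>\<omega>. iexp (u * Z T \<omega>) \<partial>M) - (\<integral>\<omega>. iexp (u * Y T \<omega>) \<partial>M)) \<le>
       \<bar>u\<bar> * e + 2 * prob {\<omega> \<in> space M. \<bar>Z T \<omega> - Y T \<omega> - 0\<bar> > e}" for T
    proof -
      let ?A = "{\<omega> \<in> space M. \<bar>Z T \<omega> - Y T \<omega> - 0\<bar> > e}"
      have "cmod ((\<integral>\<omega>. iexp (u * Z T \<omega>) \<partial>M) - (\<integral>\<omega>. iexp (u * Y T \<omega>) \<partial>M)) =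
        cmod (\<integral>\<omega>. iexp (u * Z T \<omega>) - iexp (u * Y T \<omega>) \<partial>M)"
        by (subst Bochner_Integration.integral_diff[OF int int]) auto
      also have "\<dots> \<le> (\<integral>\<omega>. \<bar>u\<bar> * e + 2 * indicator ?A \<omega> \<partial>M)"
      proof (rule norm_integral_le)
        fix \<omega> assume w: "\<omega> \<in> space M"
        have 1: "cmod (iexp (u * Z T \<omega>) - iexp (u * Y T \<omega>)) \<le> \<bar>u\<bar> * \<bar>Z T \<omega> - Y T \<omega>\<bar>"
          using norm_iexp_diff_le[of "u * Z T \<omega>" "u * Y T \<omega>"] by (simp add: abs_mult flip: right_diff_distrib)
        have 2: "cmod (iexp (u * Z T \<omega>) - iexp (u * Y T \<omega>)) \<le> 2"
          using norm_triangle_ineq4[of "iexp (u * Z T \<omega>)" "iexp (u * Y T \<omega>)"] by simp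
        show "cmod (iexp (u * Z T \<omega>) - iexp (u * Y T \<omega>)) \<le> \<bar>u\<bar> * e + 2 * indicator ?A \<omega>"
        proof (cases "\<omega> \<in> ?A")
          case True
          have "0 \<le> \<bar>u\<bar> * e" using e by simp
          with 2 True show ?thesis by simp
        next
          case False
          then have "\<bar>u\<bar> * \<bar>Z T \<omega> - Y T \<omega>\<bar> \<le> \<bar>u\<bar> * e" using w by (intro mult_left_mono) auto
          with 1 False show ?thesis by simp
        qed
      qed (auto intro!: Bochner_Integration.integrable_diff[OF int int] simp: integrable_real_indicator emeasure_eq_measure simp del: of_real_mult)
      also have "\<dots> = \<bar>u\<bar> * e + 2 * prob ?A"
        by (subst Bochner_Integration.integral_add) (auto simp: emeasure_eq_measure prob_space)
      finally show ?thesis .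
    qed
    have "\<forall>\<^sub>F T in sequentially. prob {\<omega> \<in> space M. \<bar>Z T \<omega> - Y T \<omega> - 0\<bar> > e} < r / 4"
      using diff e r unfolding tendsto_in_prob_iff[OF ZY] by (intro order_tendstoD(2)[where y=0]) auto
    then show "\<forall>\<^sub>F T in sequentially. dist ((\<integral>\<omega>. iexp (u * Z T \<omega>) \<partial>M) - (\<integral>\<omega>. iexp (u * Y T \<omega>) \<partial>M)) 0 < r"
    proof eventually_elim
      case (elim T)
      then have "cmod ((\<integral>\<omega>. iexp (u * Z T \<omega>) \<partial>M) - (\<integral>\<omega>. iexp (u * Y T \<omega>) \<partial>M)) < r"
        using le[of T] e(2) by linarith
      then show ?case by (simp only: dist_norm diff_0_right)
    qed
  qed
  from tendsto_add[OF this lim] show ?thesis by simp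
qed

section \<open>Continuity of translation in L1\<close>

text \<open>Lebesgue measure is translation invariant, so replacing \<open>f\<close> by an
  approximant \<open>g\<close> costs the same error for the shifted and the unshifted function,
  whatever the shift. Both the indicator case and the limit case of the later induction go through
  this.\<close>

lemma L1_translation_approx:
  fixes f :: "real \<Rightarrow> real"
  assumes f: "integrable lborel f" and x: "x \<longlonglongrightarrow> (0::real)"
    and g: "\<And>e. e > 0 \<Longrightarrow> \<exists>g. integrable lborel g \<and> (\<integral>y. \<bar>f y - g y\<bar> \<partial>lborel) \<le> e \<and>
      (\<lambda>n. \<integral>y. \<bar>g (x n + y) - g y\<bar> \<partial>lborel) \<longlonglongrightarrow> 0"
  shows "(\<lambda>n. \<integral>y. \<bar>f (x n + y) - f y\<bar> \<partial>lborel) \<longlonglongrightarrow> 0"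
proof (rule tendstoI)
  fix e :: real assume "e > 0"
  then obtain g where g: "integrable lborel g" and fg: "(\<integral>y. \<bar>f y - g y\<bar> \<partial>lborel) \<le> e / 4"
    and lim: "(\<lambda>n. \<integral>y. \<bar>g (x n + y) - g y\<bar> \<partial>lborel) \<longlonglongrightarrow> 0"
    using g[of "e / 4"] by auto
  have tr: "integrable lborel (\<lambda>y. h (t + y))" if "integrable lborel h" for h :: "real \<Rightarrow> real" and t
    using lborel_integrable_real_affine[OF that, of 1 t] by simp
  have le: "(\<integral>y. \<bar>f (t + y) - f y\<bar> \<partial>lborel) \<le> e / 2 + (\<integral>y. \<bar>g (t + y) - g y\<bar> \<partial>lborel)" for t
  proof -
    have "(\<integral>y. \<bar>f (t + y) - f y\<bar> \<partial>lborel) \<le>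
      (\<integral>y. (\<bar>f (t + y) - g (t + y)\<bar> + \<bar>f y - g y\<bar>) + \<bar>g (t + y) - g y\<bar> \<partial>lborel)"
      using f g tr[OF f, of t] tr[OF g, of t] by (intro integral_mono) auto
    also have "\<dots> = (\<integral>y. \<bar>f (t + y) - g (t + y)\<bar> \<partial>lborel) + (\<integral>y. \<bar>f y - g y\<bar> \<partial>lborel)
       + (\<integral>y. \<bar>g (t + y) - g y\<bar> \<partial>lborel)"
      using f g tr[OF f, of t] tr[OF g, of t] by simp
    also have "(\<integral>y. \<bar>f (t + y) - g (t + y)\<bar> \<partial>lborel) = (\<integral>y. \<bar>f y - g y\<bar> \<partial>lborel)"
      using lborel_integral_real_affine[of 1 "\<lambda>y. \<bar>f y - g y\<bar>" t] by simp
    finally show ?thesis using fg by simp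
  qed
  have "\<forall>\<^sub>F n in sequentially. (\<integral>y. \<bar>g (x n + y) - g y\<bar> \<partial>lborel) < e / 2"
    using lim \<open>e > 0\<close> by (intro order_tendstoD(2)[where y=0]) auto
  then show "\<forall>\<^sub>F n in sequentially. dist (\<integral>y. \<bar>f (x n + y) - f y\<bar> \<partial>lborel) 0 < e"
  proof eventually_elim
    case (elim n)
    then have "(\<integral>y. \<bar>f (x n + y) - f y\<bar> \<partial>lborel) < e" using le[of "x n"] by linarith
    moreover have "0 \<le> (\<integral>y. \<bar>f (x n + y) - f y\<bar> \<partial>lborel)" by simp
    ultimately show ?case by (simp add: dist_real_def)
  qed
qed

text \<open>Pointwise convergence may fail on the boundary of \<open>U\<close>, but a point of the
  open set \<open>U\<close> stays in \<open>U\<close> under small shifts. So dominated convergence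
  applies to the positive part of \<open>1_U(y) - 1_U(x_n + y)\<close>, and since both indicators
  have the same integral, the L1 distance is twice the integral of that part (Scheffe's
  argument).\<close>

lemma L1_translation_open:
  fixes U :: "real set"
  assumes U: "open U" "emeasure lborel U < \<infinity>" and x: "x \<longlonglongrightarrow> (0::real)"
  shows "(\<lambda>n. \<integral>y. \<bar>indicator U (x n + y) - indicator U y :: real\<bar> \<partial>lborel) \<longlonglongrightarrow> 0"
proof -
  have [measurable]: "U \<in> sets borel" using U by simp
  have iU: "integrable lborel (indicator U :: real \<Rightarrow> real)"
    using U by (intro integrable_real_indicator) auto
  have iUt: "integrable lborel (\<lambda>y. indicator U (t + y) :: real)" for t
    using lborel_integrable_real_affine[OF iU, of 1 t] by simp
  let ?a = "\<lambda>n y. max 0 (indicator U y - indicator U (x n + y) :: real)"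
  have ai: "integrable lborel (?a n)" for n
    by (rule Bochner_Integration.integrable_bound[OF iU]) (auto split: split_indicator)
  have "(\<lambda>n. \<integral>y. ?a n y \<partial>lborel) \<longlonglongrightarrow> (\<integral>y. 0 \<partial>(lborel :: real measure))"
  proof (rule integral_dominated_convergence[where w="indicator U"])
    show "AE y in lborel. (\<lambda>n. ?a n y) \<longlonglongrightarrow> 0"
    proof (rule AE_I2)
      fix y :: real
      show "(\<lambda>n. ?a n y) \<longlonglongrightarrow> 0"
      proof (cases "y \<in> U")
        case True
        have "(\<lambda>n. x n + y) \<longlonglongrightarrow> 0 + y" by (intro tendsto_intros x)
        then have "\<forall>\<^sub>F n in sequentially. x n + y \<in> U"
          using U(1) True by (auto dest: topological_tendstoD)
        then have "\<forall>\<^sub>F n in sequentially. ?a n y = 0" by eventually_elim (use True in auto)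
        then show ?thesis by (rule tendsto_eventually)
      next
        case False
        then have "?a n y = 0" for n by (auto split: split_indicator)
        then show ?thesis by simp
      qed
    qed
    show "AE y in lborel. norm (?a n y) \<le> indicator U y" for n
      by (rule AE_I2) (auto split: split_indicator)
  qed (use iU in auto)
  then have "(\<lambda>n. 2 * (\<integral>y. ?a n y \<partial>lborel)) \<longlonglongrightarrow> 2 * 0" by (intro tendsto_mult tendsto_const) simp
  moreover have "(\<integral>y. \<bar>indicator U (x n + y) - indicator U y :: real\<bar> \<partial>lborel) = 2 * (\<integral>y. ?a n y \<partial>lborel)" for n
  proof -
    have "(\<integral>y. \<bar>indicator U (x n + y) - indicator U y :: real\<bar> \<partial>lborel) =
      (\<integral>y. 2 * ?a n y + (indicator U (x n + y) - indicator U y) \<partial>lborel)"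
      by (intro Bochner_Integration.integral_cong) (auto split: split_indicator)
    also have "\<dots> = 2 * (\<integral>y. ?a n y \<partial>lborel) + ((\<integral>y. indicator U (x n + y) \<partial>lborel) - (\<integral>y. indicator U y \<partial>lborel))"
      using iU iUt ai by (simp del: integral_indicator Bochner_Integration.integral_indicator)
    also have "(\<integral>y. indicator U (x n + y) \<partial>lborel) = (\<integral>y. (indicator U y :: real) \<partial>lborel)"
      using lborel_integral_real_affine[of 1 "indicator U :: real \<Rightarrow> real" "x n"] by simp
    finally show ?thesis by simp
  qed
  ultimately show ?thesis by simp
qed

text \<open>Induction over integrable functions; indicators of measurable sets are reached from open
  sets by outer regularity of Lebesgue measure.\<close>

lemma L1_translation_continuous:
  fixes f :: "real \<Rightarrow> real"
  assumes f: "integrable lborel f" and x: "x \<longlonglongrightarrow> (0::real)"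
  shows "(\<lambda>n. \<integral>y. \<bar>f (x n + y) - f y\<bar> \<partial>lborel) \<longlonglongrightarrow> 0"
  using f
proof induction
  case (base A c)
  then have iA: "integrable lborel (indicator A :: real \<Rightarrow> real)" by (intro integrable_real_indicator) auto
  have "(\<lambda>n. \<integral>y. \<bar>indicator A (x n + y) - indicator A y :: real\<bar> \<partial>lborel) \<longlonglongrightarrow> 0"
  proof (rule L1_translation_approx[OF iA x])
    fix e :: real assume e: "e > 0"
    have "A \<in> sets lebesgue" using base(1) by (rule sets_completionI_sets)
    then obtain U where U: "open U" "A \<subseteq> U" "emeasure lebesgue (U - A) < ennreal e"
      using sets_lebesgue_outer_open[OF _ e] by metis
    have UA: "emeasure lborel (U - A) < ennreal e"
      using U base by (auto simp: main_part_sets)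
    have U_eq: "U = A \<union> (U - A)" using U by auto
    have Ufin: "emeasure lborel U < \<infinity>"
    proof -
      have "emeasure lborel U \<le> emeasure lborel A + emeasure lborel (U - A)"
        using base U by (subst U_eq) (intro emeasure_subadditive, auto)
      also have "\<dots> < \<infinity>" using base UA by (simp add: ennreal_add_less_top order_less_trans)
      finally show ?thesis .
    qed
    then have iU: "integrable lborel (indicator U :: real \<Rightarrow> real)"
      using U by (intro integrable_real_indicator) auto
    have "(\<integral>y. \<bar>indicator A y - indicator U y :: real\<bar> \<partial>lborel) = (\<integral>y. indicator (U - A) y \<partial>lborel)"
      using U by (intro Bochner_Integration.integral_cong) (auto split: split_indicator)
    also have "\<dots> = measure lborel (U - A)" by simp
    also have "\<dots> \<le> e" using UA e
      by (metis enn2real_ennreal enn2real_mono ennreal_less_top less_imp_le measure_def)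
    finally show "\<exists>g. integrable lborel g \<and> (\<integral>y. \<bar>indicator A y - g y\<bar> \<partial>lborel) \<le> e \<and>
      (\<lambda>n. \<integral>y. \<bar>g (x n + y) - g y\<bar> \<partial>lborel) \<longlonglongrightarrow> 0"
      using iU L1_translation_open[OF U(1) Ufin x] by blast
  qed
  from tendsto_mult[OF this tendsto_const[of "\<bar>c\<bar>"]]
  show ?case by (simp add: abs_mult flip: left_diff_distrib)
next
  case (add f g)
  have tr: "integrable lborel (\<lambda>y. h (t + y))" if "integrable lborel h" for h :: "real \<Rightarrow> real" and t
    using lborel_integrable_real_affine[OF that, of 1 t] by simp
  have le: "(\<integral>y. \<bar>f (x n + y) + g (x n + y) - (f y + g y)\<bar> \<partial>lborel) \<le>
     (\<integral>y. \<bar>f (x n + y) - f y\<bar> \<partial>lborel) + (\<integral>y. \<bar>g (x n + y) - g y\<bar> \<partial>lborel)" for n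
  proof -
    note int = add.hyps(1,2) tr[OF add.hyps(1), of "x n"] tr[OF add.hyps(2), of "x n"]
    have "(\<integral>y. \<bar>f (x n + y) + g (x n + y) - (f y + g y)\<bar> \<partial>lborel) \<le>
      (\<integral>y. \<bar>f (x n + y) - f y\<bar> + \<bar>g (x n + y) - g y\<bar> \<partial>lborel)"
      using int by (intro integral_mono) auto
    also have "\<dots> = (\<integral>y. \<bar>f (x n + y) - f y\<bar> \<partial>lborel) + (\<integral>y. \<bar>g (x n + y) - g y\<bar> \<partial>lborel)"
      using int by simp
    finally show ?thesis .
  qed
  then show ?case
    using tendsto_add[OF add.IH] by (intro tendsto_zero_squeeze[OF Bochner_Integration.integral_nonneg le]) simp_all
next
  case (lim f s)
  show ?case
  proof (rule L1_translation_approx[OF lim.hyps(4) x])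
    fix e :: real assume e: "e > 0"
    have "(\<lambda>i. \<integral>y. \<bar>f y - s i y\<bar> \<partial>lborel) \<longlonglongrightarrow> (\<integral>y. 0 \<partial>(lborel :: real measure))"
    \<comment> \<open>The approximating sequence supplied by the induction satisfies
      \<open>\<bar>s i y\<bar> \<le> 2 * \<bar>f y\<bar>\<close>, which gives the majorant with
      factor 3.\<close>
    proof (rule integral_dominated_convergence[where w="\<lambda>y. 3 * \<bar>f y\<bar>"])
      show "AE y in lborel. (\<lambda>i. \<bar>f y - s i y\<bar>) \<longlonglongrightarrow> 0"
      proof (rule AE_I2)
        fix y :: real
        have "(\<lambda>i. \<bar>f y - s i y\<bar>) \<longlonglongrightarrow> \<bar>f y - f y\<bar>"
          using lim.hyps(2)[of y] by (intro tendsto_intros) simp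
        then show "(\<lambda>i. \<bar>f y - s i y\<bar>) \<longlonglongrightarrow> 0" by simp
      qed
      show "AE y in lborel. norm \<bar>f y - s i y\<bar> \<le> 3 * \<bar>f y\<bar>" for i
      proof (rule AE_I2)
        fix y :: real
        show "norm \<bar>f y - s i y\<bar> \<le> 3 * \<bar>f y\<bar>" using lim.hyps(3)[of y i] by simp
      qed
    qed (use lim.hyps in auto)
    then have "\<forall>\<^sub>F i in sequentially. (\<integral>y. \<bar>f y - s i y\<bar> \<partial>lborel) < e"
      using e by (intro order_tendstoD(2)[where y=0]) auto
    then obtain i where "(\<integral>y. \<bar>f y - s i y\<bar> \<partial>lborel) < e"
      using eventually_happens'[OF sequentially_bot] by blast
    then show "\<exists>g. integrable lborel g \<and> (\<integral>y. \<bar>f y - g y\<bar> \<partial>lborel) \<le> e \<and>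
      (\<lambda>n. \<integral>y. \<bar>g (x n + y) - g y\<bar> \<partial>lborel) \<longlonglongrightarrow> 0"
      using lim.hyps(1) lim.IH by (intro exI[of _ "s i"]) auto
  qed
qed

section \<open>Normal laws and rates\<close>

lemma bounded_lipschitzE:
  assumes "bounded_lipschitz h"
  obtains B where "\<And>x. \<bar>h x\<bar> \<le> B" "continuous_on UNIV h" "h \<in> borel_measurable borel"
proof -
  obtain B where "\<And>x. \<bar>h x\<bar> \<le> B"
    using assms unfolding bounded_lipschitz_def bounded_iff by auto
  moreover have "continuous_on UNIV h"
    using assms unfolding bounded_lipschitz_def by (auto intro: lipschitz_on_continuous_on)
  ultimately show ?thesis using that borel_measurable_continuous_onI by blast
qed

lemma real_distribution_distr_borel:
  assumes "real_distribution N" "g \<in> borel_measurable borel"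
  shows "real_distribution (distr N borel g)"
proof -
  interpret real_distribution N by fact
  show ?thesis using assms(2) by (intro real_distribution_distr) simp
qed

text \<open>Scaling a standard normal variable covers the point mass at variance 0 as well, and
  moves the dependence on \<open>v\<close> from the measure into the integrand.\<close>

lemma normal_law_eq_distr:
  assumes "v \<ge> 0"
  shows "normal_law 0 v = distr std_normal_distribution borel (\<lambda>z. sqrt v * z)"
proof (cases "v = 0")
  case True
  interpret N: real_distribution std_normal_distribution by (rule real_dist_normal_dist)
  show ?thesis using True by (simp add: normal_law_def N.distr_const)
next
  case False
  with assms have v: "v > 0" by simp
  interpret N: real_distribution std_normal_distribution by (rule real_dist_normal_dist)
  have "distributed std_normal_distribution lborel (\<lambda>x. x) (\<lambda>x. ennreal (normal_density 0 1 x))"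
    unfolding distributed_def by (auto simp: distr_id2)
  from N.normal_density_affine[OF this, of "sqrt v" 0] v
  have "distributed std_normal_distribution lborel (\<lambda>x. sqrt v * x) (\<lambda>x. ennreal (normal_density 0 (sqrt v) x))"
    by simp
  then have "distr std_normal_distribution lborel (\<lambda>x. sqrt v * x) = normal_law 0 v"
    using v by (simp add: normal_law_def distributed_distr_eq_density)
  moreover have "distr std_normal_distribution lborel (\<lambda>x. sqrt v * x) = distr std_normal_distribution borel (\<lambda>x. sqrt v * x)"
    by (intro distr_cong) auto
  ultimately show ?thesis by simp
qed

lemma real_distribution_normal_law: "v \<ge> 0 \<Longrightarrow> real_distribution (normal_law 0 v)"
  by (auto simp: normal_law_eq_distr intro!: real_distribution_distr_borel real_dist_normal_dist)

lemma integral_normal_law: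
  fixes g :: "real \<Rightarrow> 'b::{banach, second_countable_topology}"
  assumes "v \<ge> 0" "g \<in> borel_measurable borel"
  shows "(\<integral>x. g x \<partial>normal_law 0 v) = (\<integral>z. g (sqrt v * z) \<partial>std_normal_distribution)"
  using assms by (simp add: normal_law_eq_distr integral_distr)

lemma char_normal_law:
  assumes "v \<ge> 0"
  shows "char (normal_law 0 v) t = complex_of_real (exp (- (t\<^sup>2 * v) / 2))"
proof -
  have "char (normal_law 0 v) t = char std_normal_distribution (t * sqrt v)"
    unfolding char_def using assms by (subst integral_normal_law) (auto simp: mult.assoc)
  then show ?thesis
    using assms by (simp add: char_std_normal_distribution power_mult_distrib)
qed

section \<open>Integrals against normal distribution functions\<close>

lemma interval_measure_cdf:
  assumes "real_distribution N"
  shows "interval_measure (cdf N) = N"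
proof -
  interpret real_distribution N by fact
  show ?thesis
    using assms cdf_nondecreasing cdf_is_right_cont cdf_lim_at_bot cdf_lim_at_top_prob
    by (intro cdf_unique real_distribution_interval_measure cdf_interval_measure) auto
qed

lemma stieltjes_integral_cdf:
  "real_distribution N \<Longrightarrow> stieltjes_integral (cdf N) h = (\<integral>x. h x \<partial>N)"
  by (simp add: stieltjes_integral_def interval_measure_cdf)

text \<open>With the variance inside the integrand this is bounded convergence. The whole line is
  admissible because the odd extension of \<open>sqrt\<close> is continuous at negative arguments
  too; global continuity later gives Borel measurability at once.\<close>

lemma continuous_gaussian_mean:
  fixes h :: "real \<Rightarrow> real"
  assumes h: "continuous_on UNIV h" "\<And>x. \<bar>h x\<bar> \<le> B"
  shows "continuous_on UNIV (\<lambda>v. \<integral>z. h (sqrt v * z) \<partial>std_normal_distribution)"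
  unfolding continuous_on_sequentially
proof (intro allI ballI impI, unfold o_def)
  interpret N: real_distribution std_normal_distribution by (rule real_dist_normal_dist)
  fix x :: "nat \<Rightarrow> real" and v assume "(\<forall>n. x n \<in> UNIV) \<and> x \<longlonglongrightarrow> v"
  then have x: "x \<longlonglongrightarrow> v" by simp
  have [measurable]: "h \<in> borel_measurable borel" using h by (intro borel_measurable_continuous_onI)
  show "(\<lambda>n. \<integral>z. h (sqrt (x n) * z) \<partial>std_normal_distribution) \<longlonglongrightarrow> (\<integral>z. h (sqrt v * z) \<partial>std_normal_distribution)"
  proof (rule integral_dominated_convergence[where w="\<lambda>_. B"])
    show "AE z in std_normal_distribution. (\<lambda>n. h (sqrt (x n) * z)) \<longlonglongrightarrow> h (sqrt v * z)"
    proof (rule AE_I2)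
      fix z
      have "(\<lambda>n. sqrt (x n) * z) \<longlonglongrightarrow> sqrt v * z" by (intro tendsto_intros x)
      then show "(\<lambda>n. h (sqrt (x n) * z)) \<longlonglongrightarrow> h (sqrt v * z)"
        using h(1) by (intro isCont_tendsto_compose[where g=h]) (auto simp: continuous_on_eq_continuous_at)
    qed
  qed (use h in auto)
qed

text \<open>A change of variables transfers the shift from the test function, which is only
  measurable, to the density, where translation is continuous in L1.\<close>

lemma translated_density_integral_le:
  fixes f k :: "real \<Rightarrow> real"
  assumes f: "integrable lborel f" and k[measurable]: "k \<in> borel_measurable borel" and k1: "\<And>x. \<bar>k x\<bar> \<le> 1"
  shows "\<bar>(\<integral>y. k (x + y) * f y \<partial>lborel) - (\<integral>y. k y * f y \<partial>lborel)\<bar> \<le> (\<integral>y. \<bar>f (- x + y) - f y\<bar> \<partial>lborel)"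
proof -
  have tr: "integrable lborel (\<lambda>y. f (- x + y))"
    using lborel_integrable_real_affine[OF f, of 1 "- x"] by simp
  have [measurable]: "f \<in> borel_measurable borel" using f by auto
  have kf: "integrable lborel (\<lambda>y. k y * g y)" if "integrable lborel g" for g
  proof (rule Bochner_Integration.integrable_bound[OF that])
    show "AE y in lborel. norm (k y * g y) \<le> norm (g y)"
      using k1 by (intro AE_I2) (auto simp: abs_mult intro: mult_left_le_one_le)
  qed (use that in \<open>auto intro!: borel_measurable_times dest: borel_measurable_integrable\<close>)
  have "(\<integral>y. k (x + y) * f y \<partial>lborel) = (\<integral>y. k y * f (- x + y) \<partial>lborel)"
    using lborel_integral_real_affine[of 1 "\<lambda>y. k y * f (- x + y)" x] by simp
  then have "\<bar>(\<integral>y. k (x + y) * f y \<partial>lborel) - (\<integral>y. k y * f y \<partial>lborel)\<bar> =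
      \<bar>\<integral>y. k y * (f (- x + y) - f y) \<partial>lborel\<bar>"
    using kf[OF tr] kf[OF f] by (simp add: right_diff_distrib)
  also have "\<dots> \<le> (\<integral>y. \<bar>k y * (f (- x + y) - f y)\<bar> \<partial>lborel)" by (rule integral_abs_bound)
  also have "\<dots> \<le> (\<integral>y. \<bar>f (- x + y) - f y\<bar> \<partial>lborel)"
  proof (rule integral_mono)
    show "integrable lborel (\<lambda>y. \<bar>k y * (f (- x + y) - f y)\<bar>)"
      using tr f by (intro integrable_abs kf) auto
    show "\<bar>k y * (f (- x + y) - f y)\<bar> \<le> \<bar>f (- x + y) - f y\<bar>" for y
      using k1[of y] by (auto simp: abs_mult intro: mult_left_le_one_le)
  qed (use tr f in auto)
  finally show ?thesis .
qed

text \<open>The floor loses less than 1, which accounts for the \<open>- 1\<close> in the comparison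
  functions. The last conclusion, a diverging gap between the two windows, comes from
  \<open>a < b\<close> and feeds the weak dependence.\<close>

lemma powr_floor_rates:
  fixes T\<^sub>E T\<^sub>P :: "nat \<Rightarrow> nat"
  assumes ab: "0 < a" "a < b" "b < 1"
    and TE: "\<forall>\<^sub>F T in sequentially. int (T\<^sub>E T) = int T - \<lfloor>real T powr b\<rfloor>"
    and TP: "\<forall>\<^sub>F T in sequentially. int (T\<^sub>P T) = int T - \<lfloor>real T powr a\<rfloor>"
  shows "filterlim (\<lambda>T. (real T - real (T\<^sub>P T)) / ln (real T)) at_top sequentially"
    and "(\<lambda>T. sqrt (real (T\<^sub>E T)) / sqrt (real T)) \<longlonglongrightarrow> 1"
    and "filterlim (\<lambda>T. T\<^sub>P T - T\<^sub>E T) at_top sequentially"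
proof -
  have TP': "\<forall>\<^sub>F T in sequentially. real (T\<^sub>P T) = real T - of_int \<lfloor>real T powr a\<rfloor>"
    using TP by eventually_elim linarith
  have TE': "\<forall>\<^sub>F T in sequentially. real (T\<^sub>E T) = real T - of_int \<lfloor>real T powr b\<rfloor>"
    using TE by eventually_elim linarith
  show "filterlim (\<lambda>T. (real T - real (T\<^sub>P T)) / ln (real T)) at_top sequentially"
  proof (rule filterlim_at_top_mono)
    show "filterlim (\<lambda>T. (real T powr a - 1) / ln (real T)) at_top sequentially"
      using ab by real_asymp
    show "\<forall>\<^sub>F T in sequentially. (real T powr a - 1) / ln (real T) \<le> (real T - real (T\<^sub>P T)) / ln (real T)"
      using TP' eventually_gt_at_top[of 1]
    proof eventually_elim
      case (elim T)
      then have "real T powr a - 1 \<le> real T - real (T\<^sub>P T)" by linarith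
      then show ?case using elim by (intro divide_right_mono) auto
    qed
  qed
  have "(\<lambda>T. sqrt (1 - of_int \<lfloor>real T powr b\<rfloor> / real T)) \<longlonglongrightarrow> sqrt (1 - 0)"
  proof (intro tendsto_intros)
    have up: "(\<lambda>T. real T powr b / real T) \<longlonglongrightarrow> 0" using ab by real_asymp
    show "(\<lambda>T. of_int \<lfloor>real T powr b\<rfloor> / real T) \<longlonglongrightarrow> 0"
      by (rule tendsto_zero_squeeze[OF _ _ up]) (auto intro!: divide_right_mono)
  qed
  moreover have "\<forall>\<^sub>F T in sequentially. sqrt (1 - of_int \<lfloor>real T powr b\<rfloor> / real T) = sqrt (real (T\<^sub>E T)) / sqrt (real T)"
    using TE' eventually_gt_at_top[of 0]
    by eventually_elim (simp add: real_sqrt_divide[symmetric] diff_divide_distrib)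
  ultimately show "(\<lambda>T. sqrt (real (T\<^sub>E T)) / sqrt (real T)) \<longlonglongrightarrow> 1"
    by (simp add: tendsto_cong)
  have "filterlim (\<lambda>T. real (T\<^sub>P T - T\<^sub>E T)) at_top sequentially"
  proof (rule filterlim_at_top_mono)
    show "filterlim (\<lambda>T. real T powr b - real T powr a - 1) at_top sequentially"
      using ab by real_asymp
    show "\<forall>\<^sub>F T in sequentially. real T powr b - real T powr a - 1 \<le> real (T\<^sub>P T - T\<^sub>E T)"
      using TP' TE'
    proof eventually_elim
      case (elim T)
      have "real T powr b - real T powr a - 1 \<le> real (T\<^sub>P T) - real (T\<^sub>E T)" using elim by linarith
      then show ?case by linarith
    qed
  qed
  then show "filterlim (\<lambda>T. T\<^sub>P T - T\<^sub>E T) at_top sequentially"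
    by (simp add: filterlim_sequentially_iff_filterlim_real)
qed

section \<open>Independence and moment inequalities\<close>

lemma space_gen_sigma [simp]: "space (gen_sigma M X I) = space M"
  by (simp add: gen_sigma_def space_measure_of_conv)

lemma sets_gen_sigma:
  "sets (gen_sigma M X I) = sigma_sets (space M) {X t -` A \<inter> space M | t A. t \<in> I \<and> A \<in> sets borel}"
  unfolding gen_sigma_def by (intro sets_measure_of) auto

lemma measurable_gen_sigma:
  "t \<in> I \<Longrightarrow> X t \<in> borel_measurable (gen_sigma M X I)"
  by (rule measurableI) (auto simp: sets_gen_sigma intro!: sigma_sets.Basic)

lemma sets_gen_sigma_mono:
  "I \<subseteq> J \<Longrightarrow> sets (gen_sigma M X I) \<subseteq> sets (gen_sigma M X J)"
  unfolding sets_gen_sigma by (intro sigma_sets_mono') auto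

lemma measurable_gen_sigma_mono:
  assumes "g \<in> measurable (gen_sigma M X I) N" "I \<subseteq> J"
  shows "g \<in> measurable (gen_sigma M X J) N"
  using assms(1) sets_gen_sigma_mono[OF assms(2), of M X]
  by (auto simp: measurable_def)

lemma subalgebra_gen_sigma:
  assumes "\<And>t. X t \<in> borel_measurable M"
  shows "subalgebra M (gen_sigma M X I)"
  unfolding subalgebra_def sets_gen_sigma
  using assms by (auto intro!: sets.sigma_sets_subset measurable_sets)

lemma measurable_from_gen_sigma:
  assumes "\<And>t. X t \<in> borel_measurable M" "g \<in> measurable (gen_sigma M X I) N"
  shows "g \<in> measurable M N"
  using measurable_from_subalg[OF subalgebra_gen_sigma[OF assms(1)] assms(2)] .

text \<open>Preimages under a single variable form an intersection-stable family, so independence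
  passes to the sigma-algebras of disjoint index blocks. The conclusion is a product law, so that
  Fubini can be applied to the pair directly.\<close>

lemma (in prob_space) distr_Pair_gen_sigma:
  assumes ind: "indep_vars (\<lambda>_. borel) X UNIV" and disj: "I \<inter> J = {}"
    and U: "U \<in> measurable (gen_sigma M X I) S" and V: "V \<in> measurable (gen_sigma M X J) T"
  shows "distr M (S \<Otimes>\<^sub>M T) (\<lambda>\<omega>. (U \<omega>, V \<omega>)) = distr M S U \<Otimes>\<^sub>M distr M T V"
proof -
  have meas: "\<And>t. X t \<in> borel_measurable M" using ind unfolding indep_vars_def by auto
  let ?E = "\<lambda>i. {X i -` A \<inter> space M | A. A \<in> sets borel}"
  have "indep_sets ?E UNIV" using ind unfolding indep_vars_def2 by auto
  then have "indep_sets ?E (\<Union>j\<in>UNIV. case_bool I J j)" by (rule indep_sets_mono_index[rotated]) simp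
  then have "indep_sets (\<lambda>j. sigma_sets (space M) (\<Union>i\<in>case_bool I J j. ?E i)) UNIV"
  proof (rule indep_sets_collect_sigma)
    show "Int_stable (?E i)" for i
    proof (rule Int_stableI)
      fix a b assume "a \<in> ?E i" "b \<in> ?E i"
      then obtain A B where "a = X i -` A \<inter> space M" "b = X i -` B \<inter> space M" "A \<in> sets borel" "B \<in> sets borel" by auto
      then show "a \<inter> b \<in> ?E i" by (intro CollectI exI[of _ "A \<inter> B"]) auto
    qed
    show "disjoint_family_on (case_bool I J) UNIV"
      using disj by (auto simp: disjoint_family_on_def split: bool.splits)
  qed
  moreover have "sigma_sets (space M) (\<Union>i\<in>K. ?E i) = sets (gen_sigma M X K)" for K
    unfolding sets_gen_sigma by (intro arg_cong[where f="sigma_sets (space M)"]) blast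
  ultimately have *: "indep_sets (\<lambda>j. sets (gen_sigma M X (case_bool I J j))) UNIV" by simp
  have prob_Int: "prob (a \<inter> b) = prob a * prob b"
    if "a \<in> sets (gen_sigma M X I)" "b \<in> sets (gen_sigma M X J)" for a b
    using indep_setsD[OF *, of UNIV "case_bool a b"] that by (auto simp: UNIV_bool ac_simps)
  have [measurable]: "U \<in> measurable M S" "V \<in> measurable M T"
    using measurable_from_gen_sigma[OF meas U] measurable_from_gen_sigma[OF meas V] .
  interpret U: prob_space "distr M S U" by (rule prob_space_distr) measurable
  interpret V: prob_space "distr M T V" by (rule prob_space_distr) measurable
  have "distr M S U \<Otimes>\<^sub>M distr M T V = distr M (S \<Otimes>\<^sub>M T) (\<lambda>\<omega>. (U \<omega>, V \<omega>))"
  proof (rule pair_measure_eqI)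
    fix A B assume "A \<in> sets (distr M S U)" "B \<in> sets (distr M T V)"
    then have [measurable]: "A \<in> sets S" "B \<in> sets T" by auto
    have "(\<lambda>\<omega>. (U \<omega>, V \<omega>)) -` (A \<times> B) \<inter> space M = (U -` A \<inter> space M) \<inter> (V -` B \<inter> space M)" by auto
    moreover have "prob ((U -` A \<inter> space M) \<inter> (V -` B \<inter> space M)) = prob (U -` A \<inter> space M) * prob (V -` B \<inter> space M)"
      using measurable_sets[OF U, of A] measurable_sets[OF V, of B] by (intro prob_Int) auto
    ultimately show "emeasure (distr M S U) A * emeasure (distr M T V) B =
        emeasure (distr M (S \<Otimes>\<^sub>M T) (\<lambda>\<omega>. (U \<omega>, V \<omega>))) (A \<times> B)"
      by (simp add: emeasure_distr emeasure_eq_measure ennreal_mult)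
  qed (unfold_locales, simp)
  then show ?thesis by simp
qed

text \<open>The freezing lemma: with \<open>U\<close> held fixed, only \<open>V\<close> is averaged.
  Applied with a single innovation as \<open>V\<close>, it does the work of conditioning on the
  innovations behind \<open>U\<close>.\<close>

lemma (in prob_space) gen_sigma_integral_kernel:
  fixes G :: "'s \<times> 't \<Rightarrow> 'b::{banach, second_countable_topology}"
  assumes ind: "indep_vars (\<lambda>_. borel) X UNIV" and disj: "I \<inter> J = {}"
    and U: "U \<in> measurable (gen_sigma M X I) S" and V: "V \<in> measurable (gen_sigma M X J) T"
    and G[measurable]: "G \<in> borel_measurable (S \<Otimes>\<^sub>M T)"
    and bnd: "\<And>z. norm (G z) \<le> B"
  shows "(\<integral>\<omega>. G (U \<omega>, V \<omega>) \<partial>M) = (\<integral>\<omega>. (\<integral>\<omega>'. G (U \<omega>, V \<omega>') \<partial>M) \<partial>M)"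
proof -
  have meas: "\<And>t. X t \<in> borel_measurable M" using ind unfolding indep_vars_def by auto
  have UV[measurable]: "U \<in> measurable M S" "V \<in> measurable M T"
    using measurable_from_gen_sigma[OF meas U] measurable_from_gen_sigma[OF meas V] .
  note eq = distr_Pair_gen_sigma[OF ind disj U V, symmetric]
  interpret U: prob_space "distr M S U" by (rule prob_space_distr) measurable
  interpret V: prob_space "distr M T V" by (rule prob_space_distr) measurable
  interpret P: pair_prob_space "distr M S U" "distr M T V" ..
  have int: "integrable (distr M S U \<Otimes>\<^sub>M distr M T V) G"
    by (rule P.integrable_const_bound[where B=B]) (use bnd in auto)
  have "(\<integral>\<omega>. G (U \<omega>, V \<omega>) \<partial>M) = (\<integral>z. G z \<partial>(distr M S U \<Otimes>\<^sub>M distr M T V))"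
    unfolding eq by (subst integral_distr) auto
  also have "\<dots> = (\<integral>x. (\<integral>y. G (x, y) \<partial>distr M T V) \<partial>distr M S U)"
    using P.integral_fst'[OF int] by simp
  also have "\<dots> = (\<integral>\<omega>. (\<integral>y. G (U \<omega>, y) \<partial>distr M T V) \<partial>M)"
    by (subst integral_distr) auto
  also have "\<dots> = (\<integral>\<omega>. (\<integral>\<omega>'. G (U \<omega>, V \<omega>') \<partial>M) \<partial>M)"
    by (intro Bochner_Integration.integral_cong refl, subst integral_distr) (auto dest: measurable_space[OF UV(1)])
  finally show ?thesis .
qed

lemma (in prob_space) gen_sigma_integral_mult:
  fixes U V :: "'a \<Rightarrow> real"
  assumes ind: "indep_vars (\<lambda>_. borel) X UNIV" and disj: "I \<inter> J = {}"
    and U: "U \<in> borel_measurable (gen_sigma M X I)" "integrable M U"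
    and V: "V \<in> borel_measurable (gen_sigma M X J)" "integrable M V"
  shows "integrable M (\<lambda>\<omega>. U \<omega> * V \<omega>)" "(\<integral>\<omega>. U \<omega> * V \<omega> \<partial>M) = (\<integral>\<omega>. U \<omega> \<partial>M) * (\<integral>\<omega>. V \<omega> \<partial>M)"
proof -
  have "indep_var borel U borel V"
    using distr_Pair_gen_sigma[OF ind disj U(1) V(1)] U V by (simp add: indep_var_distribution_eq borel_measurable_integrable)
  then show "integrable M (\<lambda>\<omega>. U \<omega> * V \<omega>)" "(\<integral>\<omega>. U \<omega> * V \<omega> \<partial>M) = (\<integral>\<omega>. U \<omega> \<partial>M) * (\<integral>\<omega>. V \<omega> \<partial>M)"
    using U(2) V(2) by (rule indep_var_integrable, intro indep_var_lebesgue_integral)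
qed

section \<open>Moment inequalities\<close>

lemma (in prob_space) expectation_abs_le_sqrt:
  assumes [measurable]: "Z \<in> borel_measurable M" and Z: "integrable M (\<lambda>\<omega>. (Z \<omega>)\<^sup>2)"
  shows "integrable M Z" "(\<integral>\<omega>. \<bar>Z \<omega>\<bar> \<partial>M) \<le> sqrt (\<integral>\<omega>. (Z \<omega>)\<^sup>2 \<partial>M)"
proof -
  show Z1: "integrable M Z" by (rule square_integrable_imp_integrable[OF _ Z]) measurable
  have "0 \<le> variance (\<lambda>\<omega>. \<bar>Z \<omega>\<bar>)" by (rule variance_positive)
  also have "\<dots> = (\<integral>\<omega>. (Z \<omega>)\<^sup>2 \<partial>M) - (\<integral>\<omega>. \<bar>Z \<omega>\<bar> \<partial>M)\<^sup>2"
    using Z Z1 by (subst variance_eq) auto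
  finally show "(\<integral>\<omega>. \<bar>Z \<omega>\<bar> \<partial>M) \<le> sqrt (\<integral>\<omega>. (Z \<omega>)\<^sup>2 \<partial>M)"
    by (intro real_le_rsqrt) simp
qed

text \<open>Hoelder's inequality for the exponents 4 and 4/3 with weights \<open>p\<close>, by
  applying the weighted Cauchy-Schwarz inequality first to \<open>e\<close> and then to its
  square.\<close>

lemma sum_power4_le:
  fixes p e :: "'i \<Rightarrow> real"
  assumes "\<And>i. i \<in> I \<Longrightarrow> 0 \<le> p i"
  shows "(\<Sum>i\<in>I. p i * e i) ^ 4 \<le> (\<Sum>i\<in>I. p i) ^ 3 * (\<Sum>i\<in>I. p i * e i ^ 4)"
proof -
  have cs: "(\<Sum>i\<in>I. p i * g i)\<^sup>2 \<le> (\<Sum>i\<in>I. p i) * (\<Sum>i\<in>I. p i * (g i)\<^sup>2)" for g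
  proof -
    have "(\<Sum>i\<in>I. p i * g i)\<^sup>2 = (\<Sum>i\<in>I. sqrt (p i) * (sqrt (p i) * g i))\<^sup>2"
      using assms by (intro arg_cong[where f="\<lambda>x. x\<^sup>2"] sum.cong) (auto simp flip: mult.assoc)
    also have "\<dots> \<le> (\<Sum>i\<in>I. (sqrt (p i))\<^sup>2) * (\<Sum>i\<in>I. (sqrt (p i) * g i)\<^sup>2)"
      by (rule Cauchy_Schwarz_ineq_sum)
    also have "\<dots> = (\<Sum>i\<in>I. p i) * (\<Sum>i\<in>I. p i * (g i)\<^sup>2)"
      using assms by (simp add: power_mult_distrib cong: sum.cong)
    finally show ?thesis .
  qed
  have p: "0 \<le> (\<Sum>i\<in>I. p i)" using assms by (intro sum_nonneg)
  have "(\<Sum>i\<in>I. p i * e i) ^ 4 = ((\<Sum>i\<in>I. p i * e i)\<^sup>2)\<^sup>2" by simp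
  also have "\<dots> \<le> ((\<Sum>i\<in>I. p i) * (\<Sum>i\<in>I. p i * (e i)\<^sup>2))\<^sup>2"
    by (intro power_mono cs) simp
  also have "\<dots> = (\<Sum>i\<in>I. p i)\<^sup>2 * (\<Sum>i\<in>I. p i * (e i)\<^sup>2)\<^sup>2" by (rule power_mult_distrib)
  also have "\<dots> \<le> (\<Sum>i\<in>I. p i)\<^sup>2 * ((\<Sum>i\<in>I. p i) * (\<Sum>i\<in>I. p i * ((e i)\<^sup>2)\<^sup>2))"
    by (intro mult_left_mono cs) simp
  finally show ?thesis by (simp add: power2_eq_square power3_eq_cube power4_eq_xxxx mult.assoc)
qed

section \<open>The autoregressive process\<close>

lemma power_le_one_plus_power4:
  fixes x :: real
  assumes "k \<le> 4"
  shows "\<bar>x\<bar> ^ k \<le> 1 + x ^ 4"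
proof (cases "\<bar>x\<bar> \<le> 1")
  case True
  then have "\<bar>x\<bar> ^ k \<le> 1" by (simp add: power_le_one)
  moreover have "0 \<le> x ^ 4" by simp
  ultimately show ?thesis by linarith
next
  case False
  then have "\<bar>x\<bar> ^ k \<le> \<bar>x\<bar> ^ 4" using assms by (intro power_increasing) auto
  then show ?thesis by simp
qed

text \<open>The crude bound by 1 plus the fourth moment is uniform in \<open>k\<close>, so that
  later the single constant \<open>1 + K4\<close> serves for the first, second and third moments of
  the process.\<close>

lemma (in prob_space) integrable_abs_power_of_power4:
  fixes Z :: "'a \<Rightarrow> real"
  assumes [measurable]: "Z \<in> borel_measurable M" and Z: "integrable M (\<lambda>\<omega>. (Z \<omega>) ^ 4)" and k: "k \<le> 4"
  shows "integrable M (\<lambda>\<omega>. \<bar>Z \<omega>\<bar> ^ k)" "(\<integral>\<omega>. \<bar>Z \<omega>\<bar> ^ k \<partial>M) \<le> 1 + (\<integral>\<omega>. (Z \<omega>) ^ 4 \<partial>M)"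
proof -
  have 1: "integrable M (\<lambda>\<omega>. 1 + (Z \<omega>) ^ 4)" using Z by simp
  show 2: "integrable M (\<lambda>\<omega>. \<bar>Z \<omega>\<bar> ^ k)"
    by (rule Bochner_Integration.integrable_bound[OF 1]) (use power_le_one_plus_power4[OF k] in \<open>auto simp: power_abs\<close>)
  have "(\<integral>\<omega>. \<bar>Z \<omega>\<bar> ^ k \<partial>M) \<le> (\<integral>\<omega>. 1 + (Z \<omega>) ^ 4 \<partial>M)"
    by (intro integral_mono 1 2 power_le_one_plus_power4 k)
  then show "(\<integral>\<omega>. \<bar>Z \<omega>\<bar> ^ k \<partial>M) \<le> 1 + (\<integral>\<omega>. (Z \<omega>) ^ 4 \<partial>M)"
    using Z by (simp add: prob_space)
qed

text \<open>The setting of the theorem with the existentially given causal weights fixed as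
  \<open>w\<close>. They stay abstract and are not computed as powers of \<open>\<beta>\<close>: the
  series gives measurability and, by absolute summability, moments, while the AR equation gives the
  recursion.\<close>

locale AR1 = prob_space M for M :: "'a measure" +
  fixes eps X :: "int \<Rightarrow> 'a \<Rightarrow> real" and w :: "nat \<Rightarrow> real" and \<beta> :: real
  assumes eps_iid: "iid M eps"
    and eps_mean: "(\<integral>\<omega>. eps t \<omega> \<partial>M) = 0"
    and eps_moment: "integrable M (\<lambda>\<omega>. (eps t \<omega>) ^ 4)"
    and w_summable: "summable (\<lambda>j. \<bar>w j\<bar>)"
    and X_sums: "AE \<omega> in M. (\<lambda>j. w j * eps (t - int j) \<omega>) sums X t \<omega>"
    and X_AR: "AE \<omega> in M. X t \<omega> = \<beta> * X (t - 1) \<omega> + eps t \<omega>"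
    and X_meas [measurable]: "X t \<in> borel_measurable M"
    and \<beta>: "\<bar>\<beta>\<bar> < 1"
begin

lemma eps_indep: "indep_vars (\<lambda>_. borel) eps UNIV"
  using eps_iid by (simp add: iid_def)

lemma eps_meas [measurable]: "eps t \<in> borel_measurable M"
  using eps_indep by (auto simp: indep_vars_def)

text \<open>A version of \<open>X\<close> defined at every sample point and exactly measurable for
  the innovations up to \<open>t\<close>; where the series diverges, \<open>suminf\<close> supplies
  some value. Null sets are not added to the generated sigma-algebras, so \<open>X t\<close>, which
  agrees with it only almost surely, may lack that measurability.\<close>

definition Y :: "int \<Rightarrow> 'a \<Rightarrow> real" where
  "Y t \<omega> = (\<Sum>j. w j * eps (t - int j) \<omega>)"

abbreviation F :: "int set \<Rightarrow> 'a measure" where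
  "F I \<equiv> gen_sigma M eps I"

lemma F_meas: "g \<in> measurable (F I) N \<Longrightarrow> g \<in> measurable M N"
  by (rule measurable_from_gen_sigma[OF eps_meas])

lemma eps_F: "t \<in> I \<Longrightarrow> eps t \<in> borel_measurable (F I)"
  by (rule measurable_gen_sigma)

lemma Y_F: "{..t} \<subseteq> I \<Longrightarrow> Y t \<in> borel_measurable (F I)"
  unfolding Y_def[abs_def]
  by (intro borel_measurable_suminf borel_measurable_times borel_measurable_const eps_F) auto

lemma Y_meas [measurable]: "Y t \<in> borel_measurable M"
  using F_meas[OF Y_F[of t UNIV]] by simp

lemma AE_X_eq_Y: "AE \<omega> in M. \<forall>t. X t \<omega> = Y t \<omega>"
  unfolding AE_all_countable Y_def
proof
  fix t
  show "AE \<omega> in M. X t \<omega> = (\<Sum>j. w j * eps (t - int j) \<omega>)"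
    using X_sums[of t] by eventually_elim (rule sums_unique)
qed

lemma AE_Y_AR: "AE \<omega> in M. \<forall>t. Y t \<omega> = \<beta> * Y (t - 1) \<omega> + eps t \<omega>"
proof -
  have "AE \<omega> in M. \<forall>t. X t \<omega> = \<beta> * X (t - 1) \<omega> + eps t \<omega>"
    unfolding AE_all_countable using X_AR by blast
  with AE_X_eq_Y show ?thesis by eventually_elim metis
qed

lemma expectation_eps_cong:
  fixes g :: "real \<Rightarrow> 'b::{banach, second_countable_topology}"
  assumes [measurable]: "g \<in> borel_measurable borel"
  shows "(\<integral>\<omega>. g (eps t \<omega>) \<partial>M) = (\<integral>\<omega>. g (eps 0 \<omega>) \<partial>M)"
proof -
  have "(\<integral>x. g x \<partial>distr M borel (eps t)) = (\<integral>x. g x \<partial>distr M borel (eps 0))"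
    using eps_iid unfolding iid_def by metis
  then show ?thesis by (simp add: integral_distr)
qed

definition sig2 :: real where "sig2 = (\<integral>\<omega>. (eps 0 \<omega>)\<^sup>2 \<partial>M)"
definition m3 :: real where "m3 = (\<integral>\<omega>. \<bar>eps 0 \<omega>\<bar> ^ 3 \<partial>M)"
definition m4 :: real where "m4 = (\<integral>\<omega>. (eps 0 \<omega>) ^ 4 \<partial>M)"
text \<open>By Minkowski, the L4 norm of the moving average is at most
  \<open>\<Sum>j. \<bar>w j\<bar>\<close> times that of one innovation; this is the fourth power of
  that bound.\<close>

definition K4 :: real where "K4 = (\<Sum>j. \<bar>w j\<bar>) ^ 4 * m4"

lemma eps_power_integrable: "k \<le> 4 \<Longrightarrow> integrable M (\<lambda>\<omega>. \<bar>eps t \<omega>\<bar> ^ k)"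
  by (rule integrable_abs_power_of_power4[OF _ eps_moment]) auto

lemma eps_integrable: "integrable M (eps t)" "integrable M (\<lambda>\<omega>. (eps t \<omega>)\<^sup>2)"
  using eps_power_integrable[of 1 t] eps_power_integrable[of 2 t] by (auto intro: integrable_abs_cancel)

lemma eps_second_moment: "(\<integral>\<omega>. (eps t \<omega>)\<^sup>2 \<partial>M) = sig2"
  unfolding sig2_def by (rule expectation_eps_cong) measurable

lemma moments_nonneg: "0 \<le> sig2" "0 \<le> m3" "0 \<le> m4" "0 \<le> K4"
  unfolding sig2_def m3_def m4_def K4_def by (auto intro!: mult_nonneg_nonneg)

text \<open>The partial sums obey the bound by \<open>sum_power4_le\<close> with weights
  \<open>\<bar>w j\<bar>\<close>, the signs going into the innovations; Fatou's lemma carries it to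
  the almost sure limit \<open>Y t\<close>.\<close>

lemma Y_power4: "integrable M (\<lambda>\<omega>. (Y t \<omega>) ^ 4)" "(\<integral>\<omega>. (Y t \<omega>) ^ 4 \<partial>M) \<le> K4"
proof -
  define A where "A = (\<Sum>j. \<bar>w j\<bar>)"
  define S where "S n \<omega> = (\<Sum>j<n. w j * eps (t - int j) \<omega>)" for n \<omega>
  have A: "(\<Sum>j<n. \<bar>w j\<bar>) \<le> A" for n
    unfolding A_def by (intro sum_le_suminf w_summable) auto
  have A0: "0 \<le> A" using A[of 0] by simp
  have S[measurable]: "S n \<in> borel_measurable M" for n unfolding S_def[abs_def] by measurable
  have e4: "(\<integral>\<omega>. (eps s \<omega>) ^ 4 \<partial>M) = m4" for s
    unfolding m4_def by (rule expectation_eps_cong) measurable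
  have bnd: "(\<integral>\<^sup>+\<omega>. ennreal ((S n \<omega>) ^ 4) \<partial>M) \<le> ennreal K4" for n
  proof -
    let ?g = "\<lambda>\<omega>. A ^ 3 * (\<Sum>j<n. \<bar>w j\<bar> * (eps (t - int j) \<omega>) ^ 4)"
    have le: "(S n \<omega>) ^ 4 \<le> ?g \<omega>" for \<omega>
    proof -
      have "(S n \<omega>) ^ 4 = (\<Sum>j<n. \<bar>w j\<bar> * (sgn (w j) * eps (t - int j) \<omega>)) ^ 4"
        unfolding S_def by (simp add: mult.assoc[symmetric] abs_mult_sgn)
      also have "\<dots> \<le> (\<Sum>j<n. \<bar>w j\<bar>) ^ 3 * (\<Sum>j<n. \<bar>w j\<bar> * (sgn (w j) * eps (t - int j) \<omega>) ^ 4)"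
        by (rule sum_power4_le) simp
      also have "\<dots> = (\<Sum>j<n. \<bar>w j\<bar>) ^ 3 * (\<Sum>j<n. \<bar>w j\<bar> * (eps (t - int j) \<omega>) ^ 4)"
        by (rule arg_cong2[where f="(*)"], rule refl, rule sum.cong) (auto simp: sgn_if power_mult_distrib)
      also have "\<dots> \<le> ?g \<omega>"
        by (intro mult_right_mono power_mono A sum_nonneg) auto
      finally show ?thesis .
    qed
    have int: "integrable M ?g" using eps_moment by simp
    have "(\<integral>\<^sup>+\<omega>. ennreal ((S n \<omega>) ^ 4) \<partial>M) \<le> (\<integral>\<^sup>+\<omega>. ennreal (?g \<omega>) \<partial>M)"
      by (intro nn_integral_mono ennreal_leI le)
    also have "\<dots> = ennreal (\<integral>\<omega>. ?g \<omega> \<partial>M)"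
      using A0 by (intro nn_integral_eq_integral int AE_I2) (auto intro!: mult_nonneg_nonneg sum_nonneg)
    also have "(\<integral>\<omega>. ?g \<omega> \<partial>M) = A ^ 3 * ((\<Sum>j<n. \<bar>w j\<bar>) * m4)"
      using eps_moment by (simp add: e4 sum_distrib_right)
    also have "\<dots> \<le> A ^ 3 * (A * m4)"
      using A0 A moments_nonneg by (intro mult_left_mono mult_right_mono) auto
    also have "\<dots> = K4" by (simp add: K4_def A_def power4_eq_xxxx power3_eq_cube)
    finally show ?thesis by (simp add: ennreal_leI)
  qed
  have "AE \<omega> in M. ennreal ((Y t \<omega>) ^ 4) = liminf (\<lambda>n. ennreal ((S n \<omega>) ^ 4))"
    using X_sums[of t] AE_X_eq_Y
  proof eventually_elim
    case (elim \<omega>)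
    then have "(\<lambda>n. S n \<omega>) \<longlonglongrightarrow> Y t \<omega>" by (simp add: sums_def S_def)
    then have "(\<lambda>n. ennreal ((S n \<omega>) ^ 4)) \<longlonglongrightarrow> ennreal ((Y t \<omega>) ^ 4)" by (intro tendsto_intros)
    from lim_imp_Liminf[OF sequentially_bot this] show ?case by (rule sym)
  qed
  then have "(\<integral>\<^sup>+\<omega>. ennreal ((Y t \<omega>) ^ 4) \<partial>M) = (\<integral>\<^sup>+\<omega>. liminf (\<lambda>n. ennreal ((S n \<omega>) ^ 4)) \<partial>M)"
    by (rule nn_integral_cong_AE)
  also have "\<dots> \<le> liminf (\<lambda>n. \<integral>\<^sup>+\<omega>. ennreal ((S n \<omega>) ^ 4) \<partial>M)"
    by (intro nn_integral_liminf) measurable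
  also have "\<dots> \<le> limsup (\<lambda>n. \<integral>\<^sup>+\<omega>. ennreal ((S n \<omega>) ^ 4) \<partial>M)"
    by (rule Liminf_le_Limsup) simp
  also have "\<dots> \<le> ennreal K4"
    by (rule Limsup_bounded) (rule always_eventually, rule allI, rule bnd)
  finally have le: "(\<integral>\<^sup>+\<omega>. ennreal ((Y t \<omega>) ^ 4) \<partial>M) \<le> ennreal K4" .
  show int: "integrable M (\<lambda>\<omega>. (Y t \<omega>) ^ 4)"
  proof (rule integrableI_bounded)
    show "(\<integral>\<^sup>+ x. ennreal (norm (Y t x ^ 4)) \<partial>M) < \<infinity>"
      using le by (simp add: power_abs) (auto intro: order_le_less_trans)
  qed measurable
  then have "ennreal (\<integral>\<omega>. (Y t \<omega>) ^ 4 \<partial>M) = (\<integral>\<^sup>+\<omega>. ennreal ((Y t \<omega>) ^ 4) \<partial>M)"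
    by (intro nn_integral_eq_integral[symmetric]) auto
  with le have "ennreal (\<integral>\<omega>. (Y t \<omega>) ^ 4 \<partial>M) \<le> ennreal K4" by simp
  then show "(\<integral>\<omega>. (Y t \<omega>) ^ 4 \<partial>M) \<le> K4"
    using moments_nonneg(4) by (simp only: ennreal_le_iff)
qed

lemma Y_power:
  assumes "k \<le> 4"
  shows "integrable M (\<lambda>\<omega>. \<bar>Y t \<omega>\<bar> ^ k)" "(\<integral>\<omega>. \<bar>Y t \<omega>\<bar> ^ k \<partial>M) \<le> 1 + K4"
  using integrable_abs_power_of_power4[OF Y_meas Y_power4(1) assms, of t] Y_power4(2)[of t] by auto

lemma Y_square: "integrable M (\<lambda>\<omega>. (Y t \<omega>)\<^sup>2)" "(\<integral>\<omega>. (Y t \<omega>)\<^sup>2 \<partial>M) \<le> 1 + K4"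
  using Y_power[of 2 t] by auto

text \<open>The terms are orthogonal: \<open>A k\<close> uses only innovations before time
  \<open>k + 2\<close>, while \<open>B k\<close> uses only the one at that time and has mean zero.
  Independence also makes the second moment of \<open>A k * B k\<close> a product. The two-factor
  form serves both \<open>Y (k + 1) * eps (k + 2)\<close> and the centred squares of the
  innovations.\<close>

lemma martingale_second_moment:
  fixes A B :: "nat \<Rightarrow> 'a \<Rightarrow> real"
  assumes A: "\<And>k. A k \<in> borel_measurable (F {..<int k + 2})" "\<And>k. integrable M (\<lambda>\<omega>. (A k \<omega>)\<^sup>2)"
    and B: "\<And>k. B k \<in> borel_measurable (F {int k + 2})" "\<And>k. integrable M (\<lambda>\<omega>. (B k \<omega>)\<^sup>2)"
    and B0: "\<And>k. (\<integral>\<omega>. B k \<omega> \<partial>M) = 0"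
    and C: "\<And>k. (\<integral>\<omega>. (A k \<omega>)\<^sup>2 \<partial>M) * (\<integral>\<omega>. (B k \<omega>)\<^sup>2 \<partial>M) \<le> C"
  shows "integrable M (\<lambda>\<omega>. (\<Sum>k<n. A k \<omega> * B k \<omega>)\<^sup>2)"
    "(\<integral>\<omega>. (\<Sum>k<n. A k \<omega> * B k \<omega>)\<^sup>2 \<partial>M) \<le> real n * C"
proof (induction n)
  case (Suc n)
  define S where "S \<omega> = (\<Sum>k<n. A k \<omega> * B k \<omega>)" for \<omega>
  have SF: "S \<in> borel_measurable (F {..<int n + 2})"
    unfolding S_def[abs_def]
  proof (intro borel_measurable_sum borel_measurable_times)
    fix k assume "k \<in> {..<n}"
    then show "A k \<in> borel_measurable (F {..<int n + 2})" "B k \<in> borel_measurable (F {..<int n + 2})"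
      using measurable_gen_sigma_mono[OF A(1)[of k]] measurable_gen_sigma_mono[OF B(1)[of k]] by auto
  qed
  have [measurable]: "S \<in> borel_measurable M" "A n \<in> borel_measurable M" "B n \<in> borel_measurable M"
    using F_meas SF A(1) B(1) by blast+
  have S2: "integrable M (\<lambda>\<omega>. (S \<omega>)\<^sup>2)" "(\<integral>\<omega>. (S \<omega>)\<^sup>2 \<partial>M) \<le> real n * C"
    using Suc.IH by (auto simp: S_def)
  have disj: "{..<int n + 2} \<inter> {int n + 2} = {}" by auto
  \<comment> \<open>The product of the past sum with the next predictable factor is integrable, so
    the mixed term factorizes into its mean times the vanishing mean of \<open>B n\<close>.\<close>
  have SA: "integrable M (\<lambda>\<omega>. S \<omega> * A n \<omega>)"
  proof (rule Bochner_Integration.integrable_bound[OF Bochner_Integration.integrable_add[OF S2(1) A(2)[of n]]])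
    show "AE \<omega> in M. norm (S \<omega> * A n \<omega>) \<le> norm ((S \<omega>)\<^sup>2 + (A n \<omega>)\<^sup>2)"
    proof (rule AE_I2)
      fix \<omega>
      have "2 * (\<bar>S \<omega>\<bar> * \<bar>A n \<omega>\<bar>) \<le> (S \<omega>)\<^sup>2 + (A n \<omega>)\<^sup>2"
        using sum_squares_bound[of "\<bar>S \<omega>\<bar>" "\<bar>A n \<omega>\<bar>"] by (simp add: mult.assoc)
      moreover have "0 \<le> \<bar>S \<omega>\<bar> * \<bar>A n \<omega>\<bar>" by simp
      ultimately have "\<bar>S \<omega>\<bar> * \<bar>A n \<omega>\<bar> \<le> (S \<omega>)\<^sup>2 + (A n \<omega>)\<^sup>2" by linarith
      then show "norm (S \<omega> * A n \<omega>) \<le> norm ((S \<omega>)\<^sup>2 + (A n \<omega>)\<^sup>2)"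
        by (simp add: abs_mult)
    qed
  qed measurable
  have Bn: "integrable M (B n)" by (rule square_integrable_imp_integrable[OF _ B(2)]) measurable
  have SAF: "(\<lambda>\<omega>. S \<omega> * A n \<omega>) \<in> borel_measurable (F {..<int n + 2})"
    by (intro borel_measurable_times SF A(1))
  note cross = gen_sigma_integral_mult[OF eps_indep disj SAF SA B(1) Bn]
  have AF: "(\<lambda>\<omega>. (A n \<omega>)\<^sup>2) \<in> borel_measurable (F {..<int n + 2})" "(\<lambda>\<omega>. (B n \<omega>)\<^sup>2) \<in> borel_measurable (F {int n + 2})"
    by (intro borel_measurable_power A(1) B(1))+
  note sq = gen_sigma_integral_mult[OF eps_indep disj AF(1) A(2) AF(2) B(2)]
  have eq: "(\<Sum>k<Suc n. A k \<omega> * B k \<omega>)\<^sup>2 =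
      ((S \<omega>)\<^sup>2 + 2 * (S \<omega> * A n \<omega> * B n \<omega>)) + (A n \<omega>)\<^sup>2 * (B n \<omega>)\<^sup>2" for \<omega>
    by (simp add: S_def power2_sum power_mult_distrib)
  show "integrable M (\<lambda>\<omega>. (\<Sum>k<Suc n. A k \<omega> * B k \<omega>)\<^sup>2)"
    unfolding eq using S2 cross sq by auto
  have "(\<integral>\<omega>. (\<Sum>k<Suc n. A k \<omega> * B k \<omega>)\<^sup>2 \<partial>M) =
      (\<integral>\<omega>. (S \<omega>)\<^sup>2 \<partial>M) + 2 * (\<integral>\<omega>. S \<omega> * A n \<omega> * B n \<omega> \<partial>M) + (\<integral>\<omega>. (A n \<omega>)\<^sup>2 * (B n \<omega>)\<^sup>2 \<partial>M)"
    unfolding eq using S2(1) cross(1) sq(1) by simp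
  also have "\<dots> \<le> real n * C + C"
    using S2(2) C[of n] by (simp add: cross(2) sq(2) B0)
  finally show "(\<integral>\<omega>. (\<Sum>k<Suc n. A k \<omega> * B k \<omega>)\<^sup>2 \<partial>M) \<le> real (Suc n) * C" by (simp add: algebra_simps)
qed auto

end

section \<open>Law of large numbers\<close>

text \<open>The upper bound for \<open>exp (- p)\<close> is the reciprocal of the quadratic Taylor
  lower bound for \<open>exp p\<close>; it is at most \<open>1 - p + p\<^sup>2 / 2\<close> because
  the product of \<open>1 - p + p\<^sup>2 / 2\<close> and \<open>1 + p + p\<^sup>2 / 2\<close> is
  \<open>1 + p ^ 4 / 4\<close>. It serves the Gaussian side of the central limit theorem.\<close>

lemma exp_minus_quadratic:
  fixes p :: real
  assumes "0 \<le> p"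
  shows "\<bar>1 - p - exp (- p)\<bar> \<le> p\<^sup>2 / 2"
proof -
  have pos: "0 < 1 + p + p\<^sup>2 / 2" using assms by (simp add: add_pos_nonneg)
  have "exp (- p) \<le> inverse (1 + p + p\<^sup>2 / 2)"
    using exp_lower_Taylor_quadratic[OF assms] pos by (simp add: exp_minus le_imp_inverse_le)
  also have "\<dots> \<le> 1 - p + p\<^sup>2 / 2"
  proof -
    have "1 \<le> (1 - p + p\<^sup>2 / 2) * (1 + p + p\<^sup>2 / 2)"
    proof -
      have "(1 - p + p\<^sup>2 / 2) * (1 + p + p\<^sup>2 / 2) = 1 + (p\<^sup>2)\<^sup>2 / 4"
        by (simp add: power2_eq_square field_simps)
      then show ?thesis by simp
    qed
    then show ?thesis using pos by (simp add: inverse_eq_divide pos_divide_le_eq)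
  qed
  finally have "exp (- p) \<le> 1 - p + p\<^sup>2 / 2" .
  moreover have "1 - p \<le> exp (- p)" using exp_ge_add_one_self[of "- p"] by simp
  moreover have "0 \<le> p\<^sup>2 / 2" by simp
  ultimately show ?thesis by linarith
qed

lemma exp_minus_diff_le:
  fixes p q :: real
  assumes "0 \<le> q" "q \<le> p"
  shows "\<bar>exp (- p) - exp (- q)\<bar> \<le> p - q"
proof -
  have "exp (- q) - exp (- p) = exp (- q) * (1 - exp (- (p - q)))"
    by (simp add: right_diff_distrib flip: exp_add)
  also have "\<dots> \<le> 1 * (p - q)"
  proof (rule mult_mono)
    show "1 - exp (- (p - q)) \<le> p - q" using exp_ge_add_one_self[of "- (p - q)"] by linarith
  qed (use assms in auto)
  finally show ?thesis using assms by simp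
qed

text \<open>The shift \<open>t = k + 2\<close> starts the sums at 0. Natural subtraction makes the
  right side empty for \<open>T = 0\<close> too, as the left side is.\<close>

lemma sum_int_atLeast2:
  fixes g :: "int \<Rightarrow> 'b::comm_monoid_add"
  shows "(\<Sum>t = 2..int T. g t) = (\<Sum>k<T - 1. g (int k + 2))"
  by (rule sum.reindex_bij_witness[of _ "\<lambda>k. int k + 2" "\<lambda>t. nat (t - 2)"]) auto

context AR1 begin

text \<open>The index \<open>k\<close> stands for time \<open>k + 2\<close>, and
  \<open>n = T - 1\<close> gives the OLS denominator. \<open>D n\<close> involves innovations up to
  time \<open>n\<close> only, one step less than \<open>S n\<close>; this is why
  \<open>D (Suc k)\<close> is still known before \<open>eps (k + 2)\<close> is drawn.\<close>

definition D :: "nat \<Rightarrow> 'a \<Rightarrow> real" where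
  "D n \<omega> = (\<Sum>k<n. (Y (int k + 1) \<omega>)\<^sup>2)"

definition S :: "nat \<Rightarrow> 'a \<Rightarrow> real" where
  "S n \<omega> = (\<Sum>k<n. Y (int k + 1) \<omega> * eps (int k + 2) \<omega>)"

text \<open>The stationary variance of the process, the limit of
  \<open>D (T - 1) / T\<close>.\<close>

definition \<gamma> :: real where "\<gamma> = sig2 / (1 - \<beta>\<^sup>2)"

lemma beta_square: "0 < 1 - \<beta>\<^sup>2"
  using \<beta> by (simp add: abs_square_less_1)

lemma D_F: "{..int n} \<subseteq> I \<Longrightarrow> D n \<in> borel_measurable (F I)"
  unfolding D_def[abs_def] by (intro borel_measurable_sum borel_measurable_power Y_F) auto

lemma S_F: "{..int n + 1} \<subseteq> I \<Longrightarrow> S n \<in> borel_measurable (F I)"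
  unfolding S_def[abs_def] by (intro borel_measurable_sum borel_measurable_times Y_F eps_F) auto

lemma D_S_meas [measurable]: "D n \<in> borel_measurable M" "S n \<in> borel_measurable M"
  unfolding D_def[abs_def] S_def[abs_def] by measurable

lemma D_integrable: "integrable M (D n)"
  unfolding D_def[abs_def] by (intro Bochner_Integration.integrable_sum Y_square)

lemma S_square: "integrable M (\<lambda>\<omega>. (S n \<omega>)\<^sup>2)" "(\<integral>\<omega>. (S n \<omega>)\<^sup>2 \<partial>M) \<le> real n * ((1 + K4) * sig2)"
proof -
  note * = martingale_second_moment[where A="\<lambda>k. Y (int k + 1)" and B="\<lambda>k. eps (int k + 2)"
      and C="(1 + K4) * sig2" and n=n, folded S_def]
  have "(\<integral>\<omega>. (Y (int k + 1) \<omega>)\<^sup>2 \<partial>M) * (\<integral>\<omega>. (eps (int k + 2) \<omega>)\<^sup>2 \<partial>M) \<le> (1 + K4) * sig2" for k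
    unfolding eps_second_moment using Y_square(2) moments_nonneg by (intro mult_right_mono) auto
  then show "integrable M (\<lambda>\<omega>. (S n \<omega>)\<^sup>2)" "(\<integral>\<omega>. (S n \<omega>)\<^sup>2 \<partial>M) \<le> real n * ((1 + K4) * sig2)"
    by (intro *; auto intro!: Y_F eps_F Y_square eps_integrable eps_mean)+
qed

text \<open>The factor 1 gives the sum the literal shape \<open>A k * B k\<close> of
  \<open>martingale_second_moment\<close>.\<close>

definition Q :: "nat \<Rightarrow> 'a \<Rightarrow> real" where
  "Q n \<omega> = (\<Sum>k<n. 1 * ((eps (int k + 2) \<omega>)\<^sup>2 - sig2))"

lemma Q_square: "integrable M (\<lambda>\<omega>. (Q n \<omega>)\<^sup>2)"
  "(\<integral>\<omega>. (Q n \<omega>)\<^sup>2 \<partial>M) \<le> real n * (\<integral>\<omega>. ((eps 0 \<omega>)\<^sup>2 - sig2)\<^sup>2 \<partial>M)"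
proof -
  note * = martingale_second_moment[where A="\<lambda>k \<omega>. 1" and B="\<lambda>k \<omega>. (eps (int k + 2) \<omega>)\<^sup>2 - sig2"
      and C="\<integral>\<omega>. ((eps 0 \<omega>)\<^sup>2 - sig2)\<^sup>2 \<partial>M" and n=n, folded Q_def]
  have sq: "((eps t \<omega>)\<^sup>2 - sig2)\<^sup>2 = (eps t \<omega>) ^ 4 - 2 * sig2 * (eps t \<omega>)\<^sup>2 + sig2\<^sup>2" for t \<omega>
    by (simp add: power2_eq_square power4_eq_xxxx algebra_simps)
  have i: "integrable M (\<lambda>\<omega>. ((eps t \<omega>)\<^sup>2 - sig2)\<^sup>2)" for t
    unfolding sq using eps_moment eps_integrable by auto
  have one: "(\<integral>\<omega>. (1::real)\<^sup>2 \<partial>M) = 1" by (simp add: prob_space)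
  have "(\<integral>\<omega>. (1::real)\<^sup>2 \<partial>M) * (\<integral>\<omega>. ((eps (int k + 2) \<omega>)\<^sup>2 - sig2)\<^sup>2 \<partial>M) \<le> (\<integral>\<omega>. ((eps 0 \<omega>)\<^sup>2 - sig2)\<^sup>2 \<partial>M)" for k
    unfolding one mult_1 by (rule eq_refl, rule expectation_eps_cong) measurable
  moreover have "(\<integral>\<omega>. (eps t \<omega>)\<^sup>2 - sig2 \<partial>M) = 0" for t
    using eps_integrable by (simp add: eps_second_moment prob_space)
  ultimately show "integrable M (\<lambda>\<omega>. (Q n \<omega>)\<^sup>2)"
    "(\<integral>\<omega>. (Q n \<omega>)\<^sup>2 \<partial>M) \<le> real n * (\<integral>\<omega>. ((eps 0 \<omega>)\<^sup>2 - sig2)\<^sup>2 \<partial>M)"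
    by (intro *; auto intro!: eps_F i borel_measurable_diff borel_measurable_power simp: prob_space simp del: one_power2 lebesgue_integral_const)+
qed

text \<open>Squaring the AR equation and summing expresses the sample second moment through martingales.\<close>
lemma AE_D_eq:
  "AE \<omega> in M. \<forall>n. (1 - \<beta>\<^sup>2) * D n \<omega> = (Y 1 \<omega>)\<^sup>2 - (Y (int n + 1) \<omega>)\<^sup>2 + 2 * \<beta> * S n \<omega> + Q n \<omega> + real n * sig2"
  using AE_Y_AR
proof eventually_elim
  case (elim \<omega>)
  show ?case
  proof
    fix n
    show "(1 - \<beta>\<^sup>2) * D n \<omega> = (Y 1 \<omega>)\<^sup>2 - (Y (int n + 1) \<omega>)\<^sup>2 + 2 * \<beta> * S n \<omega> + Q n \<omega> + real n * sig2"
    proof (induction n)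
      case (Suc n)
      have "Y (int n + 2) \<omega> = \<beta> * Y (int n + 1) \<omega> + eps (int n + 2) \<omega>"
        using elim[THEN spec, of "int n + 2"] by (simp add: algebra_simps)
      then have sq: "(Y (int n + 2) \<omega>)\<^sup>2 = \<beta>\<^sup>2 * (Y (int n + 1) \<omega>)\<^sup>2 +
          2 * \<beta> * (Y (int n + 1) \<omega> * eps (int n + 2) \<omega>) + (eps (int n + 2) \<omega>)\<^sup>2"
        by (simp add: power2_sum power_mult_distrib)
      have "D (Suc n) \<omega> = D n \<omega> + (Y (int n + 1) \<omega>)\<^sup>2"
        "S (Suc n) \<omega> = S n \<omega> + Y (int n + 1) \<omega> * eps (int n + 2) \<omega>"
        "Q (Suc n) \<omega> = Q n \<omega> + ((eps (int n + 2) \<omega>)\<^sup>2 - sig2)"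
        by (auto simp: D_def S_def Q_def)
      then have "(1 - \<beta>\<^sup>2) * D (Suc n) \<omega> = (1 - \<beta>\<^sup>2) * D n \<omega> + (Y (int n + 1) \<omega>)\<^sup>2 - \<beta>\<^sup>2 * (Y (int n + 1) \<omega>)\<^sup>2"
        "2 * \<beta> * S (Suc n) \<omega> = 2 * \<beta> * S n \<omega> + 2 * \<beta> * (Y (int n + 1) \<omega> * eps (int n + 2) \<omega>)"
        "Q (Suc n) \<omega> = Q n \<omega> + (eps (int n + 2) \<omega>)\<^sup>2 - sig2"
        "real (Suc n) * sig2 = real n * sig2 + sig2" "int (Suc n) + 1 = int n + 2"
        by (simp_all add: algebra_simps)
      then show ?case using Suc sq by (simp only:)
    qed (simp add: D_def S_def Q_def)
  qed
qed

text \<open>In the identity for \<open>D\<close> the boundary terms are bounded in L1 and the two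
  martingales have second moments of order \<open>T\<close>, hence L1 norms of order
  \<open>sqrt T\<close>; division by \<open>T\<close> leaves \<open>1 / sqrt T\<close>.\<close>

lemma D_L1_rate:
  obtains C where "\<And>T. T \<ge> 1 \<Longrightarrow> (\<integral>\<omega>. \<bar>D (T - 1) \<omega> / real T - \<gamma>\<bar> \<partial>M) \<le> C / sqrt (real T)"
proof -
  define C1 where "C1 = (1 + K4) * sig2"
  define C2 where "C2 = (\<integral>\<omega>. ((eps 0 \<omega>)\<^sup>2 - sig2)\<^sup>2 \<partial>M)"
  \<comment> \<open>Contributions of the two boundary squares, of \<open>S\<close>, of
    \<open>Q\<close>, and of one \<open>sig2\<close> left over because \<open>n = T - 1\<close>
    innovations are compared with \<open>T\<close>.\<close>
  define C where "C = 2 * (1 + K4) + 2 * \<bar>\<beta>\<bar> * sqrt C1 + sqrt C2 + sig2"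
  have C12: "0 \<le> C1" "0 \<le> C2" using moments_nonneg by (auto simp: C1_def C2_def)
  have [measurable]: "Q n \<in> borel_measurable M" for n unfolding Q_def[abs_def] by measurable
  have "(\<integral>\<omega>. \<bar>D (T - 1) \<omega> / real T - \<gamma>\<bar> \<partial>M) \<le> (C / (1 - \<beta>\<^sup>2)) / sqrt (real T)" if T: "T \<ge> 1" for T
  proof -
    define n where "n = T - 1"
    have Tn: "real T = real n + 1" using T by (simp add: n_def)
    let ?R = "\<lambda>\<omega>. (Y 1 \<omega>)\<^sup>2 + (Y (int n + 1) \<omega>)\<^sup>2 + 2 * \<bar>\<beta>\<bar> * \<bar>S n \<omega>\<bar> + \<bar>Q n \<omega>\<bar> + sig2"
    have S1: "integrable M (S n)" "(\<integral>\<omega>. \<bar>S n \<omega>\<bar> \<partial>M) \<le> sqrt C1 * sqrt (real T)"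
    proof -
      show "integrable M (S n)" by (rule expectation_abs_le_sqrt[OF _ S_square(1)]) measurable
      have "(\<integral>\<omega>. \<bar>S n \<omega>\<bar> \<partial>M) \<le> sqrt (\<integral>\<omega>. (S n \<omega>)\<^sup>2 \<partial>M)" by (rule expectation_abs_le_sqrt[OF _ S_square(1)]) measurable
      also have "\<dots> \<le> sqrt (C1 * real T)"
      proof (rule real_sqrt_le_mono)
        have "real n * C1 \<le> real T * C1" using C12 Tn by (intro mult_right_mono) auto
        then show "(\<integral>\<omega>. (S n \<omega>)\<^sup>2 \<partial>M) \<le> C1 * real T" using S_square(2)[of n] by (simp add: C1_def mult.commute)
      qed
      finally show "(\<integral>\<omega>. \<bar>S n \<omega>\<bar> \<partial>M) \<le> sqrt C1 * sqrt (real T)" by (simp add: real_sqrt_mult)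
    qed
    have Q1: "integrable M (Q n)" "(\<integral>\<omega>. \<bar>Q n \<omega>\<bar> \<partial>M) \<le> sqrt C2 * sqrt (real T)"
    proof -
      show "integrable M (Q n)" by (rule expectation_abs_le_sqrt[OF _ Q_square(1)]) measurable
      have "(\<integral>\<omega>. \<bar>Q n \<omega>\<bar> \<partial>M) \<le> sqrt (\<integral>\<omega>. (Q n \<omega>)\<^sup>2 \<partial>M)" by (rule expectation_abs_le_sqrt[OF _ Q_square(1)]) measurable
      also have "\<dots> \<le> sqrt (C2 * real T)"
      proof (rule real_sqrt_le_mono)
        have "real n * C2 \<le> real T * C2" using C12 Tn by (intro mult_right_mono) auto
        then show "(\<integral>\<omega>. (Q n \<omega>)\<^sup>2 \<partial>M) \<le> C2 * real T" using Q_square(2)[of n] by (simp add: C2_def mult.commute)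
      qed
      finally show "(\<integral>\<omega>. \<bar>Q n \<omega>\<bar> \<partial>M) \<le> sqrt C2 * sqrt (real T)" by (simp add: real_sqrt_mult)
    qed
    have "(\<integral>\<omega>. \<bar>D n \<omega> / real T - \<gamma>\<bar> \<partial>M) \<le> (\<integral>\<omega>. ?R \<omega> / ((1 - \<beta>\<^sup>2) * real T) \<partial>M)"
    proof (rule integral_mono_AE)
      show "AE \<omega> in M. \<bar>D n \<omega> / real T - \<gamma>\<bar> \<le> ?R \<omega> / ((1 - \<beta>\<^sup>2) * real T)"
        using AE_D_eq
      proof eventually_elim
        case (elim \<omega>)
        have "(1 - \<beta>\<^sup>2) * real T * (D n \<omega> / real T - \<gamma>) = (1 - \<beta>\<^sup>2) * D n \<omega> - real T * sig2"
          using beta_square T by (simp add: \<gamma>_def field_simps)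
        also have "\<dots> = (Y 1 \<omega>)\<^sup>2 - (Y (int n + 1) \<omega>)\<^sup>2 + 2 * \<beta> * S n \<omega> + Q n \<omega> - sig2"
          using elim[THEN spec, of n] by (simp add: Tn algebra_simps)
        finally have eq: "(1 - \<beta>\<^sup>2) * real T * (D n \<omega> / real T - \<gamma>) =
          (Y 1 \<omega>)\<^sup>2 - (Y (int n + 1) \<omega>)\<^sup>2 + 2 * \<beta> * S n \<omega> + Q n \<omega> - sig2" .
        have tri: "\<bar>y1 - y2 + z + q - v\<bar> \<le> y1 + y2 + \<bar>z\<bar> + \<bar>q\<bar> + v"
          if "0 \<le> y1" "0 \<le> y2" "0 \<le> v" for y1 y2 z q v :: real
          using that by linarith
        have "\<bar>(1 - \<beta>\<^sup>2) * real T * (D n \<omega> / real T - \<gamma>)\<bar> \<le>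
          (Y 1 \<omega>)\<^sup>2 + (Y (int n + 1) \<omega>)\<^sup>2 + \<bar>2 * \<beta> * S n \<omega>\<bar> + \<bar>Q n \<omega>\<bar> + sig2"
          unfolding eq by (rule tri) (use moments_nonneg in auto)
        then have "\<bar>(1 - \<beta>\<^sup>2) * real T * (D n \<omega> / real T - \<gamma>)\<bar> \<le> ?R \<omega>"
          by (simp only: abs_mult abs_numeral)
        moreover have "\<bar>(1 - \<beta>\<^sup>2) * real T * (D n \<omega> / real T - \<gamma>)\<bar> = ((1 - \<beta>\<^sup>2) * real T) * \<bar>D n \<omega> / real T - \<gamma>\<bar>"
          using beta_square T by (simp add: abs_mult)
        ultimately show ?case
          using beta_square T by (simp add: pos_le_divide_eq mult.commute)
      qed
    qed (use D_integrable Y_square S1 Q1 in auto)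
    also have "\<dots> = ((\<integral>\<omega>. (Y 1 \<omega>)\<^sup>2 \<partial>M) + (\<integral>\<omega>. (Y (int n + 1) \<omega>)\<^sup>2 \<partial>M) + 2 * \<bar>\<beta>\<bar> * (\<integral>\<omega>. \<bar>S n \<omega>\<bar> \<partial>M)
        + (\<integral>\<omega>. \<bar>Q n \<omega>\<bar> \<partial>M) + sig2) / ((1 - \<beta>\<^sup>2) * real T)"
      using Y_square(1) S1(1) Q1(1) by (simp add: prob_space)
    also have "\<dots> \<le> (C * sqrt (real T)) / ((1 - \<beta>\<^sup>2) * real T)"
    proof (rule divide_right_mono)
      have sT: "1 \<le> sqrt (real T)" using T by simp
      have "(\<integral>\<omega>. (Y 1 \<omega>)\<^sup>2 \<partial>M) + (\<integral>\<omega>. (Y (int n + 1) \<omega>)\<^sup>2 \<partial>M) + sig2 \<le> (2 * (1 + K4) + sig2) * 1"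
        using Y_square(2)[of 1] Y_square(2)[of "int n + 1"] by simp
      also have "\<dots> \<le> (2 * (1 + K4) + sig2) * sqrt (real T)"
        using sT moments_nonneg by (intro mult_left_mono) auto
      finally have 1: "(\<integral>\<omega>. (Y 1 \<omega>)\<^sup>2 \<partial>M) + (\<integral>\<omega>. (Y (int n + 1) \<omega>)\<^sup>2 \<partial>M) + sig2 \<le> (2 * (1 + K4) + sig2) * sqrt (real T)" .
      have 2: "2 * \<bar>\<beta>\<bar> * (\<integral>\<omega>. \<bar>S n \<omega>\<bar> \<partial>M) \<le> 2 * \<bar>\<beta>\<bar> * (sqrt C1 * sqrt (real T))"
        using S1(2) by (intro mult_left_mono) auto
      have "C * sqrt (real T) = (2 * (1 + K4) + sig2) * sqrt (real T) + 2 * \<bar>\<beta>\<bar> * (sqrt C1 * sqrt (real T)) + sqrt C2 * sqrt (real T)"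
        by (simp add: C_def algebra_simps)
      then show "(\<integral>\<omega>. (Y 1 \<omega>)\<^sup>2 \<partial>M) + (\<integral>\<omega>. (Y (int n + 1) \<omega>)\<^sup>2 \<partial>M) + 2 * \<bar>\<beta>\<bar> * (\<integral>\<omega>. \<bar>S n \<omega>\<bar> \<partial>M)
        + (\<integral>\<omega>. \<bar>Q n \<omega>\<bar> \<partial>M) + sig2 \<le> C * sqrt (real T)"
        using 1 2 Q1(2) by linarith
    qed (use beta_square in auto)
    also have "\<dots> = (C / (1 - \<beta>\<^sup>2)) / sqrt (real T)"
      using T beta_square by (simp add: field_simps)
    finally show ?thesis by (simp add: n_def)
  qed
  then show ?thesis using that by blast
qed

end

section \<open>Martingale central limit theorem\<close>

context AR1 begin

definition \<phi> :: "real \<Rightarrow> complex" where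
  "\<phi> t = (\<integral>\<omega>. iexp (t * eps 0 \<omega>) \<partial>M)"

lemma phi_eps: "(\<integral>\<omega>. iexp (t * eps s \<omega>) \<partial>M) = \<phi> t"
  unfolding \<phi>_def by (rule expectation_eps_cong[where g="\<lambda>x. iexp (t * x)"]) measurable

lemma phi_char: "\<phi> t = char (distr M borel (eps 0)) t"
  unfolding \<phi>_def char_def by (subst integral_distr) auto

lemma phi_measurable [measurable]: "\<phi> \<in> borel_measurable borel"
proof -
  interpret E: real_distribution "distr M borel (eps 0)" by (rule real_distribution_distr) measurable
  have "\<phi> = char (distr M borel (eps 0))" by (rule ext) (rule phi_char)
  then show ?thesis by simp
qed

lemma norm_phi_le_1: "cmod (\<phi> t) \<le> 1"
proof -
  interpret E: real_distribution "distr M borel (eps 0)" by (rule real_distribution_distr) measurable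
  show ?thesis unfolding phi_char by (rule E.cmod_char_le_1)
qed

lemma phi_approx: "cmod (\<phi> t - (1 - t\<^sup>2 * sig2 / 2)) \<le> \<bar>t\<bar> ^ 3 * m3 / 6"
proof -
  have "cmod (\<phi> t - (1 - t\<^sup>2 * sig2 / 2)) \<le> (t\<^sup>2 / 6) * (\<integral>\<omega>. min (6 * (eps 0 \<omega>)\<^sup>2) (\<bar>t\<bar> * \<bar>eps 0 \<omega>\<bar> ^ 3) \<partial>M)"
    unfolding phi_char
    by (rule char_approx3') (auto simp: eps_integrable eps_mean sig2_def)
  also have "\<dots> \<le> (t\<^sup>2 / 6) * (\<integral>\<omega>. \<bar>t\<bar> * \<bar>eps 0 \<omega>\<bar> ^ 3 \<partial>M)"
  proof (intro mult_left_mono integral_mono)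
    show i: "integrable M (\<lambda>\<omega>. \<bar>t\<bar> * \<bar>eps 0 \<omega>\<bar> ^ 3)" using eps_power_integrable[of 3 0] by simp
    show "integrable M (\<lambda>\<omega>. min (6 * (eps 0 \<omega>)\<^sup>2) (\<bar>t\<bar> * \<bar>eps 0 \<omega>\<bar> ^ 3))"
      by (rule Bochner_Integration.integrable_bound[OF i]) auto
  qed auto
  also have "\<dots> = \<bar>t\<bar> ^ 3 * m3 / 6"
    unfolding power2_abs[of t, symmetric] by (simp add: m3_def power2_eq_square power3_eq_cube del: abs_mult_self abs_mult_self_eq)
  finally show ?thesis .
qed

text \<open>One step of the martingale CLT: \<open>x\<close> is the predictable factor, \<open>V\<close> and
  \<open>V + sig2 * x\<^sup>2\<close> are consecutive conditional variances, \<open>C\<close> their limit.\<close>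
lemma clt_step_bound:
  fixes u x V C :: real
  defines "Wt v \<equiv> exp (- (u\<^sup>2 / 2) * max 0 (C - v))"
  shows "cmod (Wt (V + sig2 * x\<^sup>2) * \<phi> (u * x) - Wt V) \<le>
    \<bar>u\<bar> ^ 3 * m3 / 6 * \<bar>x\<bar> ^ 3 + u ^ 4 * sig2\<^sup>2 / 8 * x ^ 4
      + u\<^sup>2 / 2 * (max 0 (V + sig2 * x\<^sup>2 - C) - max 0 (V - C))"
proof -
  define v where "v = sig2 * x\<^sup>2"
  \<comment> \<open>The part of the variance increment \<open>v\<close> that lies below the level
    \<open>C\<close>; the weight changes only by the factor
    \<open>exp (- (u\<^sup>2 / 2) * d)\<close>. The rest, \<open>v - d\<close>, is the growth of the
    overshoot above \<open>C\<close>.\<close>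
  define d where "d = max 0 (C - V) - max 0 (C - (V + v))"
  have v: "0 \<le> v" unfolding v_def using moments_nonneg by simp
  have d: "0 \<le> d" "d \<le> v" "v - d = max 0 (V + v - C) - max 0 (V - C)"
    using v unfolding d_def by (auto simp: max_def)
  define p q where "p = u\<^sup>2 / 2 * v" and "q = u\<^sup>2 / 2 * d"
  have q: "0 \<le> q" "q \<le> p" using d v by (auto simp: p_def q_def intro: mult_left_mono)
  have W: "Wt V = Wt (V + v) * exp (- q)"
    unfolding Wt_def q_def d_def by (simp add: algebra_simps flip: exp_add)
  have W1: "Wt (V + v) \<le> 1" "0 \<le> Wt (V + v)" unfolding Wt_def by auto
  \<comment> \<open>Three errors: third order for the characteristic function, second order for
    \<open>exp (- p)\<close>, and the overshoot through \<open>p - q\<close>.\<close>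
  have "cmod (\<phi> (u * x) - exp (- q)) =
      cmod ((\<phi> (u * x) - (1 - (u * x)\<^sup>2 * sig2 / 2)) + complex_of_real (1 - p - exp (- p)) + complex_of_real (exp (- p) - exp (- q)))"
    by (rule arg_cong[where f=cmod]) (simp add: p_def v_def power_mult_distrib)
  also have "\<dots> \<le> cmod (\<phi> (u * x) - (1 - (u * x)\<^sup>2 * sig2 / 2)) + \<bar>1 - p - exp (- p)\<bar> + \<bar>exp (- p) - exp (- q)\<bar>"
    by (intro norm_triangle_le add_mono norm_triangle_ineq) (simp_all only: norm_of_real order_refl)
  also have "\<dots> \<le> \<bar>u * x\<bar> ^ 3 * m3 / 6 + p\<^sup>2 / 2 + (p - q)"
    using q by (intro add_mono phi_approx exp_minus_quadratic exp_minus_diff_le) auto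
  also have "\<dots> = \<bar>u\<bar> ^ 3 * m3 / 6 * \<bar>x\<bar> ^ 3 + u ^ 4 * sig2\<^sup>2 / 8 * x ^ 4 + u\<^sup>2 / 2 * (v - d)"
    by (simp add: p_def q_def v_def abs_mult power_mult_distrib field_simps power2_eq_square power4_eq_xxxx)
  finally have le: "cmod (\<phi> (u * x) - exp (- q)) \<le> \<bar>u\<bar> ^ 3 * m3 / 6 * \<bar>x\<bar> ^ 3 + u ^ 4 * sig2\<^sup>2 / 8 * x ^ 4 + u\<^sup>2 / 2 * (v - d)" .
  have "cmod (Wt (V + v) * \<phi> (u * x) - Wt V) = Wt (V + v) * cmod (\<phi> (u * x) - exp (- q))"
    unfolding W using W1 by (simp add: norm_mult flip: right_diff_distrib)
  also have "\<dots> \<le> 1 * cmod (\<phi> (u * x) - exp (- q))" using W1 by (intro mult_right_mono) auto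
  finally have "cmod (Wt (V + v) * \<phi> (u * x) - Wt V) \<le>
      \<bar>u\<bar> ^ 3 * m3 / 6 * \<bar>x\<bar> ^ 3 + u ^ 4 * sig2\<^sup>2 / 8 * x ^ 4 + u\<^sup>2 / 2 * (v - d)"
    using le by linarith
  then show ?thesis unfolding d(3) unfolding v_def .
qed

text \<open>The proof telescopes the expectation of \<open>exp (\<i> u S\<^sub>k)\<close> times
  \<open>exp (- (u\<^sup>2 / 2) * max 0 (C - V\<^sub>k))\<close>, where \<open>V\<^sub>k\<close> is the conditional variance.  Because the
  weight is at most \<open>1\<close>, no truncation of \<open>V\<^sub>k\<close> is needed.\<close>
lemma clt_bound:
  fixes u r C :: real
  assumes r: "0 \<le> r" and C: "0 \<le> C"
  shows "cmod ((\<integral>\<omega>. iexp (u * (r * S n \<omega>)) \<partial>M) - exp (- (u\<^sup>2 * C) / 2)) \<le>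
    real n * (\<bar>u\<bar> ^ 3 * m3 / 6 * r ^ 3 * (1 + K4) + u ^ 4 * sig2\<^sup>2 / 8 * r ^ 4 * (1 + K4))
      + u\<^sup>2 / 2 * (\<integral>\<omega>. \<bar>sig2 * r\<^sup>2 * D n \<omega> - C\<bar> \<partial>M)"
proof -
  define V where "V k \<omega> = sig2 * r\<^sup>2 * D k \<omega>" for k \<omega>
  define Wt where "Wt v = exp (- (u\<^sup>2 / 2) * max 0 (C - v))" for v
  define Z where "Z k \<omega> = iexp (u * (r * S k \<omega>))" for k \<omega>
  define G where "G k \<omega> = Z k \<omega> * Wt (V k \<omega>)" for k \<omega>
  define c where "c = \<bar>u\<bar> ^ 3 * m3 / 6 * r ^ 3 * (1 + K4) + u ^ 4 * sig2\<^sup>2 / 8 * r ^ 4 * (1 + K4)"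
  have [measurable]: "V k \<in> borel_measurable M" "Z k \<in> borel_measurable M" for k
    unfolding V_def[abs_def] Z_def[abs_def] by measurable
  have [measurable]: "Wt \<in> borel_measurable borel" unfolding Wt_def[abs_def] by measurable
  have [measurable]: "G k \<in> borel_measurable M" for k unfolding G_def[abs_def] by measurable
  have V_int: "integrable M (V k)" for k unfolding V_def[abs_def] using D_integrable by simp
  have Z1: "cmod (Z k \<omega>) = 1" for k \<omega> unfolding Z_def by (simp del: of_real_mult)
  have W1: "0 \<le> Wt v" "Wt v \<le> 1" for v unfolding Wt_def by auto
  have G_int: "integrable M (G k)" for k
    by (rule integrable_const_bound[where B=1]) (auto simp: G_def norm_mult Z1 W1)
  have Z_int: "integrable M (Z k)" for k
    by (rule integrable_const_bound[where B=1]) (auto simp: Z1)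
  have step: "cmod ((\<integral>\<omega>. G (Suc k) \<omega> \<partial>M) - (\<integral>\<omega>. G k \<omega> \<partial>M)) \<le>
      c + u\<^sup>2 / 2 * ((\<integral>\<omega>. max 0 (V (Suc k) \<omega> - C) \<partial>M) - (\<integral>\<omega>. max 0 (V k \<omega> - C) \<partial>M))" for k
  proof -
    define x where "x \<omega> = r * Y (int k + 1) \<omega>" for \<omega>
    have [measurable]: "x \<in> borel_measurable M" unfolding x_def[abs_def] by measurable
    have V_Suc: "V (Suc k) \<omega> = V k \<omega> + sig2 * (x \<omega>)\<^sup>2" for \<omega>
      by (simp add: V_def D_def x_def algebra_simps)
    have Z_Suc: "Z (Suc k) \<omega> = Z k \<omega> * iexp (u * (x \<omega> * eps (int k + 2) \<omega>))" for \<omega>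
      by (simp add: Z_def S_def x_def algebra_simps flip: exp_add)
    \<comment> \<open>All of \<open>S k\<close>, \<open>V (Suc k)\<close> and \<open>x\<close> are
      known before \<open>eps (k + 2)\<close>, since the next conditional variance is predictable.
      Hence only that innovation is averaged, producing \<open>\<phi>\<close>.\<close>
    let ?U = "\<lambda>\<omega>. ((S k \<omega>, V (Suc k) \<omega>), x \<omega>)"
    let ?g = "\<lambda>z :: ((real \<times> real) \<times> real) \<times> real.
      iexp (u * (r * fst (fst (fst z)))) * Wt (snd (fst (fst z))) * iexp (u * (snd (fst z) * snd z))"
    have U: "?U \<in> measurable (F {..<int k + 2}) ((borel \<Otimes>\<^sub>M borel) \<Otimes>\<^sub>M borel)"
    proof (intro measurable_Pair)
      show "V (Suc k) \<in> borel_measurable (F {..<int k + 2})"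
        unfolding V_def[abs_def] by (intro borel_measurable_times borel_measurable_const D_F) auto
      show "x \<in> borel_measurable (F {..<int k + 2})"
        unfolding x_def[abs_def] by (intro borel_measurable_times borel_measurable_const Y_F) auto
    qed (auto intro!: S_F)
    have disj: "{..<int k + 2} \<inter> {int k + 2} = {}" by auto
    have "(\<integral>\<omega>. ?g (?U \<omega>, eps (int k + 2) \<omega>) \<partial>M) = (\<integral>\<omega>. (\<integral>\<omega>'. ?g (?U \<omega>, eps (int k + 2) \<omega>') \<partial>M) \<partial>M)"
    proof (rule gen_sigma_integral_kernel[OF eps_indep disj U eps_F])
      show "cmod (?g z) \<le> 1" for z using W1 by (simp add: norm_mult del: of_real_mult)
    qed auto
    also have "\<dots> = (\<integral>\<omega>. Z k \<omega> * Wt (V (Suc k) \<omega>) * \<phi> (u * x \<omega>) \<partial>M)"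
      unfolding phi_eps[of _ "int k + 2", symmetric] Z_def
      by (simp add: mult.assoc)
    also have "(\<lambda>\<omega>. ?g (?U \<omega>, eps (int k + 2) \<omega>)) = G (Suc k)"
      unfolding G_def[abs_def] Z_Suc unfolding Z_def fst_conv snd_conv by (simp only: mult_ac)
    finally have G_Suc: "(\<integral>\<omega>. G (Suc k) \<omega> \<partial>M) = (\<integral>\<omega>. Z k \<omega> * Wt (V (Suc k) \<omega>) * \<phi> (u * x \<omega>) \<partial>M)" .
    have i1: "integrable M (\<lambda>\<omega>. Z k \<omega> * Wt (V (Suc k) \<omega>) * \<phi> (u * x \<omega>))"
      by (rule integrable_const_bound[where B=1])
        (auto simp: norm_mult Z1 W1 intro!: mult_le_one norm_phi_le_1)
    let ?R = "\<lambda>\<omega>. \<bar>u\<bar> ^ 3 * m3 / 6 * r ^ 3 * \<bar>Y (int k + 1) \<omega>\<bar> ^ 3 + u ^ 4 * sig2\<^sup>2 / 8 * r ^ 4 * (Y (int k + 1) \<omega>) ^ 4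
       + u\<^sup>2 / 2 * (max 0 (V (Suc k) \<omega> - C) - max 0 (V k \<omega> - C))"
    have mi: "integrable M (\<lambda>\<omega>. max 0 (V k \<omega> - C))" for k
      using V_int[of k] by (intro integrable_max) auto
    have Ri: "integrable M ?R"
      using Y_power(1)[of 3] Y_power4(1) mi
      by (intro Bochner_Integration.integrable_add Bochner_Integration.integrable_diff integrable_mult_right) auto
    have "cmod ((\<integral>\<omega>. G (Suc k) \<omega> \<partial>M) - (\<integral>\<omega>. G k \<omega> \<partial>M)) =
        cmod (\<integral>\<omega>. Z k \<omega> * Wt (V (Suc k) \<omega>) * \<phi> (u * x \<omega>) - G k \<omega> \<partial>M)"
      unfolding G_Suc using i1 G_int by simp
    also have "\<dots> \<le> (\<integral>\<omega>. ?R \<omega> \<partial>M)"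
    proof (rule norm_integral_le)
      fix \<omega>
      have "Z k \<omega> * Wt (V (Suc k) \<omega>) * \<phi> (u * x \<omega>) - G k \<omega> =
          Z k \<omega> * (Wt (V k \<omega> + sig2 * (x \<omega>)\<^sup>2) * \<phi> (u * x \<omega>) - Wt (V k \<omega>))"
        by (simp add: G_def V_Suc algebra_simps)
      then have "cmod (Z k \<omega> * Wt (V (Suc k) \<omega>) * \<phi> (u * x \<omega>) - G k \<omega>) =
          cmod (Wt (V k \<omega> + sig2 * (x \<omega>)\<^sup>2) * \<phi> (u * x \<omega>) - Wt (V k \<omega>))"
        by (simp add: norm_mult Z1)
      also have "\<dots> \<le> \<bar>u\<bar> ^ 3 * m3 / 6 * \<bar>x \<omega>\<bar> ^ 3 + u ^ 4 * sig2\<^sup>2 / 8 * (x \<omega>) ^ 4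
          + u\<^sup>2 / 2 * (max 0 (V k \<omega> + sig2 * (x \<omega>)\<^sup>2 - C) - max 0 (V k \<omega> - C))"
        unfolding Wt_def by (rule clt_step_bound)
      also have "\<dots> = ?R \<omega>"
        using r by (simp add: V_Suc x_def abs_mult power_mult_distrib mult.assoc)
      finally show "cmod (Z k \<omega> * Wt (V (Suc k) \<omega>) * \<phi> (u * x \<omega>) - G k \<omega>) \<le> ?R \<omega>" .
    qed (use i1 G_int Ri in auto)
    also have "\<dots> = \<bar>u\<bar> ^ 3 * m3 / 6 * r ^ 3 * (\<integral>\<omega>. \<bar>Y (int k + 1) \<omega>\<bar> ^ 3 \<partial>M)
       + u ^ 4 * sig2\<^sup>2 / 8 * r ^ 4 * (\<integral>\<omega>. (Y (int k + 1) \<omega>) ^ 4 \<partial>M)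
       + u\<^sup>2 / 2 * ((\<integral>\<omega>. max 0 (V (Suc k) \<omega> - C) \<partial>M) - (\<integral>\<omega>. max 0 (V k \<omega> - C) \<partial>M))"
      using Y_power(1)[of 3 "int k + 1"] Y_power4(1)[of "int k + 1"] mi by simp
    also have "\<dots> \<le> c + u\<^sup>2 / 2 * ((\<integral>\<omega>. max 0 (V (Suc k) \<omega> - C) \<partial>M) - (\<integral>\<omega>. max 0 (V k \<omega> - C) \<partial>M))"
      unfolding c_def using r moments_nonneg Y_power(2)[of 3 "int k + 1"] Y_power4(2)[of "int k + 1"]
      by (intro add_mono mult_left_mono order_refl) (auto intro!: mult_nonneg_nonneg)
    finally show ?thesis .
  qed
  have V0: "V 0 \<omega> = 0" for \<omega> by (simp add: V_def D_def)
  \<comment> \<open>At \<open>k = 0\<close> the weight already equals the Gaussian characteristic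
    function, which is how the limit enters.\<close>
  have G0: "(\<integral>\<omega>. G 0 \<omega> \<partial>M) = exp (- (u\<^sup>2 * C) / 2)"
    using C by (simp add: G_def Z_def V0 S_def Wt_def prob_space)
  \<comment> \<open>The overshoots telescope, so their total is the final
    \<open>max 0 (V n - C)\<close>.\<close>
  have tel: "cmod ((\<integral>\<omega>. G n \<omega> \<partial>M) - exp (- (u\<^sup>2 * C) / 2)) \<le> real n * c + u\<^sup>2 / 2 * (\<integral>\<omega>. max 0 (V n \<omega> - C) \<partial>M)" for n
  proof (induction n)
    case 0
    then show ?case using C by (simp add: G0 V0 prob_space max_def)
  next
    case (Suc k)
    have "cmod ((\<integral>\<omega>. G (Suc k) \<omega> \<partial>M) - exp (- (u\<^sup>2 * C) / 2)) \<le>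
      cmod ((\<integral>\<omega>. G (Suc k) \<omega> \<partial>M) - (\<integral>\<omega>. G k \<omega> \<partial>M)) + cmod ((\<integral>\<omega>. G k \<omega> \<partial>M) - exp (- (u\<^sup>2 * C) / 2))"
      using norm_triangle_ineq[of "(\<integral>\<omega>. G (Suc k) \<omega> \<partial>M) - (\<integral>\<omega>. G k \<omega> \<partial>M)"
        "(\<integral>\<omega>. G k \<omega> \<partial>M) - exp (- (u\<^sup>2 * C) / 2)"] by (simp only: diff_add_cancel diff_add_eq add_diff_eq)
    also have "\<dots> \<le> real (Suc k) * c + u\<^sup>2 / 2 * (\<integral>\<omega>. max 0 (V (Suc k) \<omega> - C) \<partial>M)"
      using step[of k] Suc.IH by (simp add: algebra_simps)
    finally show ?case .
  qed
  have mi: "integrable M (\<lambda>\<omega>. max 0 (V n \<omega> - C))" "integrable M (\<lambda>\<omega>. max 0 (C - V n \<omega>))"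
    using V_int[of n] by (auto intro!: integrable_max)
  \<comment> \<open>Removing the final weight costs the shortfall \<open>max 0 (C - V n)\<close>;
    together with the overshoot left by the telescoping it adds up to
    \<open>\<bar>V n - C\<bar>\<close>.\<close>
  have "cmod ((\<integral>\<omega>. Z n \<omega> \<partial>M) - (\<integral>\<omega>. G n \<omega> \<partial>M)) = cmod (\<integral>\<omega>. Z n \<omega> - G n \<omega> \<partial>M)"
    using Z_int G_int by simp
  also have "\<dots> \<le> (\<integral>\<omega>. u\<^sup>2 / 2 * max 0 (C - V n \<omega>) \<partial>M)"
  proof (rule norm_integral_le)
    fix \<omega>
    have "Z n \<omega> - G n \<omega> = Z n \<omega> * complex_of_real (1 - Wt (V n \<omega>))" by (simp add: G_def algebra_simps)
    then have "cmod (Z n \<omega> - G n \<omega>) = 1 - Wt (V n \<omega>)" using W1[of "V n \<omega>"] by (simp only: norm_mult Z1 norm_of_real) simp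
    also have "\<dots> \<le> u\<^sup>2 / 2 * max 0 (C - V n \<omega>)"
      using exp_ge_add_one_self[of "- (u\<^sup>2 / 2) * max 0 (C - V n \<omega>)"] by (simp add: Wt_def)
    finally show "cmod (Z n \<omega> - G n \<omega>) \<le> u\<^sup>2 / 2 * max 0 (C - V n \<omega>)" .
  qed (use Z_int G_int mi in auto)
  also have "\<dots> = u\<^sup>2 / 2 * (\<integral>\<omega>. max 0 (C - V n \<omega>) \<partial>M)" by simp
  finally have last: "cmod ((\<integral>\<omega>. Z n \<omega> \<partial>M) - (\<integral>\<omega>. G n \<omega> \<partial>M)) \<le> u\<^sup>2 / 2 * (\<integral>\<omega>. max 0 (C - V n \<omega>) \<partial>M)" .
  have "(\<integral>\<omega>. \<bar>V n \<omega> - C\<bar> \<partial>M) = (\<integral>\<omega>. max 0 (V n \<omega> - C) + max 0 (C - V n \<omega>) \<partial>M)"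
    by (intro Bochner_Integration.integral_cong) auto
  also have "\<dots> = (\<integral>\<omega>. max 0 (V n \<omega> - C) \<partial>M) + (\<integral>\<omega>. max 0 (C - V n \<omega>) \<partial>M)" using mi by simp
  finally have abs: "u\<^sup>2 / 2 * (\<integral>\<omega>. \<bar>V n \<omega> - C\<bar> \<partial>M) =
      u\<^sup>2 / 2 * (\<integral>\<omega>. max 0 (V n \<omega> - C) \<partial>M) + u\<^sup>2 / 2 * (\<integral>\<omega>. max 0 (C - V n \<omega>) \<partial>M)"
    by (simp add: distrib_left)
  have "cmod ((\<integral>\<omega>. Z n \<omega> \<partial>M) - exp (- (u\<^sup>2 * C) / 2)) \<le>
      cmod ((\<integral>\<omega>. Z n \<omega> \<partial>M) - (\<integral>\<omega>. G n \<omega> \<partial>M)) + cmod ((\<integral>\<omega>. G n \<omega> \<partial>M) - exp (- (u\<^sup>2 * C) / 2))"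
    using norm_triangle_ineq[of "(\<integral>\<omega>. Z n \<omega> \<partial>M) - (\<integral>\<omega>. G n \<omega> \<partial>M)" "(\<integral>\<omega>. G n \<omega> \<partial>M) - exp (- (u\<^sup>2 * C) / 2)"] by simp
  then have "cmod ((\<integral>\<omega>. Z n \<omega> \<partial>M) - exp (- (u\<^sup>2 * C) / 2)) \<le> real n * c + u\<^sup>2 / 2 * (\<integral>\<omega>. \<bar>V n \<omega> - C\<bar> \<partial>M)"
    using last tel[of n] abs by linarith
  then show ?thesis unfolding Z_def V_def c_def .
qed

text \<open>This is \<open>clt_bound\<close> with \<open>r = 1 / sqrt T\<close> and level
  \<open>sig2 * \<gamma>\<close>: the third-moment errors sum to order \<open>1 / sqrt T\<close>,
  the fourth-moment errors to order \<open>1 / T\<close>, and the law of large numbers adds another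
  \<open>1 / sqrt T\<close>.\<close>

lemma S_char_tendsto:
  "(\<lambda>T. \<integral>\<omega>. iexp (u * (S (T - 1) \<omega> / sqrt (real T))) \<partial>M) \<longlonglongrightarrow> exp (- (u\<^sup>2 * (sig2 * \<gamma>)) / 2)"
proof -
  obtain C where C: "\<And>T. T \<ge> 1 \<Longrightarrow> (\<integral>\<omega>. \<bar>D (T - 1) \<omega> / real T - \<gamma>\<bar> \<partial>M) \<le> C / sqrt (real T)"
    using D_L1_rate by blast
  have g: "0 \<le> \<gamma>" unfolding \<gamma>_def using moments_nonneg beta_square by simp
  define a b where "a = \<bar>u\<bar> ^ 3 * m3 / 6 * (1 + K4)" and "b = u ^ 4 * sig2\<^sup>2 / 8 * (1 + K4)"
  have ab: "0 \<le> a" "0 \<le> b" using moments_nonneg by (auto simp: a_def b_def)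
  have bnd: "cmod ((\<integral>\<omega>. iexp (u * (S (T - 1) \<omega> / sqrt (real T))) \<partial>M) - exp (- (u\<^sup>2 * (sig2 * \<gamma>)) / 2)) \<le>
      a / sqrt (real T) + b / real T + u\<^sup>2 / 2 * (sig2 * (C / sqrt (real T)))" if T: "T \<ge> 1" for T
  proof -
    define r where "r = 1 / sqrt (real T)"
    have r: "0 \<le> r" "r\<^sup>2 = 1 / real T" using T by (auto simp: r_def power_divide)
    have "cmod ((\<integral>\<omega>. iexp (u * (r * S (T - 1) \<omega>)) \<partial>M) - exp (- (u\<^sup>2 * (sig2 * \<gamma>)) / 2)) \<le>
      real (T - 1) * (\<bar>u\<bar> ^ 3 * m3 / 6 * r ^ 3 * (1 + K4) + u ^ 4 * sig2\<^sup>2 / 8 * r ^ 4 * (1 + K4))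
      + u\<^sup>2 / 2 * (\<integral>\<omega>. \<bar>sig2 * r\<^sup>2 * D (T - 1) \<omega> - sig2 * \<gamma>\<bar> \<partial>M)"
      using g r moments_nonneg by (intro clt_bound) auto
    also have "\<dots> \<le> (a / sqrt (real T) + b / real T) + u\<^sup>2 / 2 * (sig2 * (C / sqrt (real T)))"
    proof (rule add_mono)
      have "real (T - 1) * (\<bar>u\<bar> ^ 3 * m3 / 6 * r ^ 3 * (1 + K4) + u ^ 4 * sig2\<^sup>2 / 8 * r ^ 4 * (1 + K4)) \<le>
        real T * (a * r ^ 3 + b * r ^ 4)"
        using r ab by (intro mult_mono) (auto simp: a_def b_def mult_ac intro!: add_nonneg_nonneg mult_nonneg_nonneg moments_nonneg)
      also have "\<dots> = (a * r + b * r\<^sup>2) * (real T * r\<^sup>2)" by (simp add: power3_eq_cube power4_eq_xxxx power2_eq_square algebra_simps)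
      also have "\<dots> = a / sqrt (real T) + b / real T" using T by (simp add: r(2)) (simp add: r_def)
      finally show "real (T - 1) * (\<bar>u\<bar> ^ 3 * m3 / 6 * r ^ 3 * (1 + K4) + u ^ 4 * sig2\<^sup>2 / 8 * r ^ 4 * (1 + K4)) \<le>
        a / sqrt (real T) + b / real T" .
      have "sig2 * r\<^sup>2 * D (T - 1) \<omega> - sig2 * \<gamma> = sig2 * (D (T - 1) \<omega> / real T - \<gamma>)" for \<omega>
        by (simp add: r(2) right_diff_distrib)
      then have "(\<integral>\<omega>. \<bar>sig2 * r\<^sup>2 * D (T - 1) \<omega> - sig2 * \<gamma>\<bar> \<partial>M) = (\<integral>\<omega>. sig2 * \<bar>D (T - 1) \<omega> / real T - \<gamma>\<bar> \<partial>M)"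
        using moments_nonneg by (simp only: abs_mult abs_of_nonneg)
      also have "\<dots> \<le> sig2 * (C / sqrt (real T))" unfolding integral_mult_right_zero using C[OF T] moments_nonneg by (intro mult_left_mono)
      finally show "u\<^sup>2 / 2 * (\<integral>\<omega>. \<bar>sig2 * r\<^sup>2 * D (T - 1) \<omega> - sig2 * \<gamma>\<bar> \<partial>M) \<le> u\<^sup>2 / 2 * (sig2 * (C / sqrt (real T)))"
        by (intro mult_left_mono) auto
    qed
    finally show ?thesis by (simp add: r_def)
  qed
  have lims: "(\<lambda>T. 1 / sqrt (real T)) \<longlonglongrightarrow> 0" "(\<lambda>T. 1 / real T) \<longlonglongrightarrow> 0" by real_asymp+
  have "(\<lambda>T. a * (1 / sqrt (real T)) + b * (1 / real T) + u\<^sup>2 / 2 * (sig2 * (C * (1 / sqrt (real T))))) \<longlonglongrightarrow>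
      a * 0 + b * 0 + u\<^sup>2 / 2 * (sig2 * (C * 0))"
    by (intro tendsto_add tendsto_mult tendsto_const lims)
  then have lim: "(\<lambda>T. a / sqrt (real T) + b / real T + u\<^sup>2 / 2 * (sig2 * (C / sqrt (real T)))) \<longlonglongrightarrow> 0"
    by simp
  have ev: "\<forall>\<^sub>F T in sequentially. cmod ((\<integral>\<omega>. iexp (u * (S (T - 1) \<omega> / sqrt (real T))) \<partial>M) - exp (- (u\<^sup>2 * (sig2 * \<gamma>)) / 2)) \<le>
      a / sqrt (real T) + b / real T + u\<^sup>2 / 2 * (sig2 * (C / sqrt (real T)))"
    using eventually_ge_at_top[of 1] by eventually_elim (rule bnd)
  have "(\<lambda>T. (\<integral>\<omega>. iexp (u * (S (T - 1) \<omega> / sqrt (real T))) \<partial>M) - exp (- (u\<^sup>2 * (sig2 * \<gamma>)) / 2)) \<longlonglongrightarrow> 0"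
    by (rule Lim_null_comparison[OF ev lim])
  then show ?thesis by (simp only: LIM_zero_iff)
qed

end

section \<open>Weak dependence\<close>

text \<open>Sets of this form contain the generators and are closed under complements and countable
  unions. An event of a block thus becomes a condition on the vector of its variables, which is what
  the shift argument acts on.\<close>

lemma gen_sigma_preimage:
  assumes "A \<in> sets (gen_sigma M X I)"
  shows "\<exists>B\<in>sets (Pi\<^sub>M I (\<lambda>_. borel)). A = (\<lambda>\<omega>. \<lambda>t\<in>I. X t \<omega>) -` B \<inter> space M"
proof -
  define g where "g = (\<lambda>\<omega>. \<lambda>t\<in>I. X t \<omega>)"
  have g: "g \<omega> \<in> space (Pi\<^sub>M I (\<lambda>_. borel))" "t \<in> I \<Longrightarrow> g \<omega> t = X t \<omega>" for \<omega> t
    by (auto simp: g_def space_PiM)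
  show ?thesis
    using assms unfolding sets_gen_sigma g_def[symmetric]
  proof (induction rule: sigma_sets.induct)
    case (Basic a)
    then obtain t C where t: "t \<in> I" "C \<in> sets borel" and a: "a = X t -` C \<inter> space M" by blast
    have "(\<lambda>x. x t) -` C \<inter> space (Pi\<^sub>M I (\<lambda>_. borel :: real measure)) \<in> sets (Pi\<^sub>M I (\<lambda>_. borel))"
      using t by (intro measurable_sets[OF measurable_component_singleton]) auto
    then show ?case
      by (rule bexI[rotated]) (use t g in \<open>auto simp: a\<close>)
  next
    case Empty
    then show ?case by (intro bexI[of _ "{}"]) auto
  next
    case (Compl a)
    then obtain B where "B \<in> sets (Pi\<^sub>M I (\<lambda>_. borel))" "a = g -` B \<inter> space M" by blast
    then show ?case
      using g(1) by (intro bexI[of _ "space (Pi\<^sub>M I (\<lambda>_. borel)) - B"] sets.compl_sets) auto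
  next
    case (Union a)
    then obtain B where "\<And>i. B i \<in> sets (Pi\<^sub>M I (\<lambda>_. borel))" "\<And>i. a i = g -` B i \<inter> space M" by metis
    then show ?case by (intro bexI[of _ "\<Union>i. B i"]) auto
  qed
qed

definition L1_modulus :: "(real \<Rightarrow> real) \<Rightarrow> real \<Rightarrow> real" where
  "L1_modulus f t = (\<integral>y. \<bar>f (t + y) - f y\<bar> \<partial>lborel)"

lemma L1_modulus_measurable:
  assumes [measurable]: "f \<in> borel_measurable borel"
  shows "L1_modulus f \<in> borel_measurable borel"
  unfolding L1_modulus_def[abs_def] by measurable

lemma L1_modulus_nonneg: "0 \<le> L1_modulus f t"
  unfolding L1_modulus_def by simp

lemma L1_modulus_le:
  assumes f: "integrable lborel f"
  shows "L1_modulus f t \<le> 2 * (\<integral>y. \<bar>f y\<bar> \<partial>lborel)"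
proof -
  have tr: "integrable lborel (\<lambda>y. f (t + y))"
    using lborel_integrable_real_affine[OF f, of 1 t] by simp
  have "L1_modulus f t \<le> (\<integral>y. \<bar>f (t + y)\<bar> + \<bar>f y\<bar> \<partial>lborel)"
    unfolding L1_modulus_def using tr f by (intro integral_mono) auto
  also have "\<dots> = (\<integral>y. \<bar>f (t + y)\<bar> \<partial>lborel) + (\<integral>y. \<bar>f y\<bar> \<partial>lborel)" using tr f by simp
  also have "(\<integral>y. \<bar>f (t + y)\<bar> \<partial>lborel) = (\<integral>y. \<bar>f y\<bar> \<partial>lborel)"
    using lborel_integral_real_affine[of 1 "\<lambda>y. \<bar>f y\<bar>" t] by simp
  finally show ?thesis by simp
qed

lemma L1_modulus_isCont_0:
  assumes f: "integrable lborel f"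
  shows "isCont (L1_modulus f) 0"
  unfolding continuous_at_sequentially
proof (intro allI impI)
  fix x :: "nat \<Rightarrow> real" assume "x \<longlonglongrightarrow> 0"
  from L1_translation_continuous[OF f this] show "(L1_modulus f \<circ> x) \<longlonglongrightarrow> L1_modulus f 0"
    by (simp add: L1_modulus_def o_def)
qed

text \<open>Bounded convergence in probability; continuity at 0 is exactly what is established for
  the L1 modulus.\<close>

lemma (in prob_space) expectation_tendsto_zero_of_prob:
  fixes g :: "real \<Rightarrow> real"
  assumes W[measurable]: "\<And>T. W T \<in> borel_measurable M" and W0: "tendsto_in_prob M W 0"
    and g[measurable]: "g \<in> borel_measurable borel" and g0: "isCont g 0" "g 0 = 0"
    and gb: "\<And>x. 0 \<le> g x" "\<And>x. g x \<le> B"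
  shows "(\<lambda>T. \<integral>\<omega>. g (W T \<omega>) \<partial>M) \<longlonglongrightarrow> 0"
proof (rule tendstoI)
  fix r :: real assume r: "r > 0"
  have B: "0 \<le> B" using gb order_trans by blast
  obtain d where d: "d > 0" "\<And>x. \<bar>x\<bar> < d \<Longrightarrow> g x < r / 2"
  proof -
    obtain d where "d > 0" "\<And>x. dist x 0 < d \<Longrightarrow> dist (g x) (g 0) < r / 2"
      using g0(1) r unfolding continuous_at_eps_delta by (meson half_gt_zero)
    then show ?thesis using that[of d] g0(2) by (force simp: dist_real_def)
  qed
  let ?A = "\<lambda>T. {\<omega> \<in> space M. \<bar>W T \<omega> - 0\<bar> > d / 2}"
  have le: "(\<integral>\<omega>. g (W T \<omega>) \<partial>M) \<le> r / 2 + B * prob (?A T)" for T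
  proof -
    have "(\<integral>\<omega>. g (W T \<omega>) \<partial>M) \<le> (\<integral>\<omega>. r / 2 + B * indicator (?A T) \<omega> \<partial>M)"
    proof (rule integral_mono)
      show "integrable M (\<lambda>\<omega>. g (W T \<omega>))"
        by (rule integrable_const_bound[where B=B]) (use gb in auto)
      show "g (W T \<omega>) \<le> r / 2 + B * indicator (?A T) \<omega>" if "\<omega> \<in> space M" for \<omega>
      proof (cases "\<omega> \<in> ?A T")
        case True
        have "g (W T \<omega>) \<le> r / 2 + B" using gb(2)[of "W T \<omega>"] r by linarith
        with True show ?thesis by simp
      next
        case False
        then have "\<bar>W T \<omega>\<bar> < d" using d(1) that by auto
        from d(2)[OF this] False show ?thesis by simp
      qed
    qed (auto simp: integrable_real_indicator emeasure_eq_measure)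
    also have "\<dots> = r / 2 + B * prob (?A T)"
      by (subst Bochner_Integration.integral_add) (auto simp: emeasure_eq_measure prob_space)
    finally show ?thesis .
  qed
  have "\<forall>\<^sub>F T in sequentially. prob (?A T) < r / (2 * (B + 1))"
    using W0[unfolded tendsto_in_prob_iff[OF W], rule_format, of "d / 2"] d(1) r B
    by (intro order_tendstoD(2)[where y=0]) simp_all
  then show "\<forall>\<^sub>F T in sequentially. dist (\<integral>\<omega>. g (W T \<omega>) \<partial>M) 0 < r"
  proof eventually_elim
    case (elim T)
    have "B * prob (?A T) \<le> B * (r / (2 * (B + 1)))" using elim B by (intro mult_left_mono) auto
    also have "\<dots> < r / 2" using B r by (simp add: field_simps)
    finally have "(\<integral>\<omega>. g (W T \<omega>) \<partial>M) < r" using le[of T] by linarith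
    moreover have "0 \<le> (\<integral>\<omega>. g (W T \<omega>) \<partial>M)" using gb by simp
    ultimately show ?case by (simp only: dist_real_def diff_0_right abs_of_nonneg)
  qed
qed

section \<open>Decoupling the past from a future block\<close>

context AR1 begin

text \<open>The recursion started from 0 at time \<open>e\<close>, that is, the sum of
  \<open>\<beta> ^ (n - i) * eps (e + i)\<close> over \<open>1 \<le> i \<le> n\<close>: the part of
  \<open>Y (e + n)\<close> due to the innovations after \<open>e\<close>.\<close>

primrec R :: "int \<Rightarrow> nat \<Rightarrow> 'a \<Rightarrow> real" where
  "R e 0 = (\<lambda>\<omega>. 0)"
| "R e (Suc n) = (\<lambda>\<omega>. \<beta> * R e n \<omega> + eps (e + int n + 1) \<omega>)"

lemma R_F: "{e+1..e + int n} \<subseteq> I \<Longrightarrow> R e n \<in> borel_measurable (F I)"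
proof (induction n)
  case (Suc n)
  then have "R e n \<in> borel_measurable (F I)" "eps (e + int n + 1) \<in> borel_measurable (F I)"
    by (auto intro!: eps_F Suc.IH)
  then show ?case unfolding R.simps
    by (intro borel_measurable_add borel_measurable_times borel_measurable_const)
qed auto

lemma AE_Y_unroll: "AE \<omega> in M. \<forall>e n. Y (e + int n) \<omega> = \<beta> ^ n * Y e \<omega> + R e n \<omega>"
  using AE_Y_AR
proof eventually_elim
  case (elim \<omega>)
  have "Y (e + int n) \<omega> = \<beta> ^ n * Y e \<omega> + R e n \<omega>" for e n
  proof (induction n)
    case (Suc n)
    have "Y (e + int (Suc n)) \<omega> = \<beta> * Y (e + int n) \<omega> + eps (e + int n + 1) \<omega>"
      using elim[THEN spec, of "e + int n + 1"] by (simp add: ac_simps)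
    then show ?case using Suc by (simp add: algebra_simps)
  qed simp
  then show ?case by blast
qed

text \<open>The innovation at time \<open>p\<close> smooths: given it, the dependence of the block
  \<open>X\<^sub>p, \<dots>, X\<^sub>q\<close> on the past up to \<open>e\<close> is a shift of \<open>f\<close> by \<open>\<beta> ^ (p - e) * Y e\<close>.\<close>
lemma past_future_covariance_le:
  assumes f: "integrable lborel f" "\<And>x. 0 \<le> f x" and dens: "distributed M lborel (eps p) (\<lambda>x. ennreal (f x))"
    and n: "p = e + int n" "n \<ge> 1"
    and W: "W \<in> borel_measurable (F {..e})" "\<And>\<omega>. \<bar>W \<omega>\<bar> \<le> B" "(\<integral>\<omega>. W \<omega> \<partial>M) = 0"
    and A: "A \<in> sets (gen_sigma M X {p..q})"
  shows "\<bar>\<integral>\<omega>. W \<omega> * indicator A \<omega> \<partial>M\<bar> \<le> B * (\<integral>\<omega>. L1_modulus f (- (\<beta> ^ n * Y e \<omega>)) \<partial>M)"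
proof -
  let ?I = "{p..q}"
  let ?P = "Pi\<^sub>M ?I (\<lambda>_. borel :: real measure)"
  have B: "0 \<le> B" using W(2) abs_ge_zero order_trans by blast
  have [measurable]: "f \<in> borel_measurable borel" using f(1) by auto
  have Am[measurable]: "A \<in> sets M"
    using A subalgebra_gen_sigma[of X M ?I] X_meas by (auto simp: subalgebra_def)
  obtain C where C[measurable]: "C \<in> sets ?P" and AC: "A = (\<lambda>\<omega>. \<lambda>t\<in>?I. X t \<omega>) -` C \<inter> space M"
    using gen_sigma_preimage[OF A] by blast
  \<comment> \<open>Almost surely
    \<open>Y p = \<beta> ^ n * Y e + \<beta> * R e (n - 1) + eps p\<close>. Along the block,
    \<open>Q\<close> collects what comes from the innovations at \<open>e+1..p-1\<close> and
    \<open>p+1..q\<close>, so that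
    \<open>X t = \<beta> ^ (t - p) * (x + eps p) + Q t\<close>.\<close>
  define Q where "Q \<omega> = (\<lambda>t\<in>?I. \<beta> ^ (nat (t - p) + 1) * R e (n - 1) \<omega> + R p (nat (t - p)) \<omega>)" for \<omega>
  define K where "K x z = (indicator C (\<lambda>t\<in>?I. \<beta> ^ nat (t - p) * x + z t) :: real)" for x z
  define x where "x \<omega> = \<beta> ^ n * Y e \<omega>" for \<omega>
  \<comment> \<open>The indicator of the event averaged over \<open>eps p\<close>; the remaining
    dependence on the past sits in the shift \<open>v\<close>.\<close>
  define \<kappa> where "\<kappa> v z = (\<integral>y. K (v + y) z * f y \<partial>lborel)" for v z
  have K01: "\<bar>K v z\<bar> \<le> 1" for v z unfolding K_def by (simp split: split_indicator)
  have Km[measurable]: "(\<lambda>(v, z). K v z) \<in> borel_measurable (borel \<Otimes>\<^sub>M ?P)"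
  proof -
    have "(\<lambda>(v, z). \<lambda>t\<in>?I. \<beta> ^ nat (t - p) * v + z t) \<in> measurable (borel \<Otimes>\<^sub>M ?P) ?P"
      unfolding case_prod_beta by (intro measurable_restrict) measurable
    then show ?thesis unfolding K_def[abs_def] case_prod_beta by measurable
  qed
  have W_M[measurable]: "W \<in> borel_measurable M" by (rule F_meas[OF W(1)])
  \<comment> \<open>The first splitting separates \<open>W\<close> from \<open>Q\<close>, the second
    isolates \<open>eps p\<close>.\<close>
  have J: "{..e} \<inter> ({e+1..p-1} \<union> {p+1..q}) = {}" "(UNIV - {p}) \<inter> {p} = {}" using n by auto
  have QF: "Q \<in> measurable (F ({e+1..p-1} \<union> {p+1..q})) ?P"
    unfolding Q_def[abs_def]
  proof (intro measurable_restrict borel_measurable_add borel_measurable_times borel_measurable_const R_F)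
    show "{e + 1..e + int (n - 1)} \<subseteq> {e + 1..p - 1} \<union> {p + 1..q}" using n by auto
    show "{p + 1..p + int (nat (t - p))} \<subseteq> {e + 1..p - 1} \<union> {p + 1..q}" if "t \<in> ?I" for t using that by auto
  qed
  have Qm[measurable]: "Q \<in> measurable M ?P" by (rule F_meas[OF QF])
  have [measurable]: "x \<in> borel_measurable M" unfolding x_def[abs_def] by measurable
  have kap: "(\<integral>\<omega>'. K (v + eps p \<omega>') z \<partial>M) = \<kappa> v z" if z: "z \<in> space ?P" for v z
  proof -
    have "(\<lambda>y. K (v + y) z) \<in> borel_measurable lborel"
      using z by measurable
    from distributed_integral[OF dens this f(2)] show ?thesis
      by (simp add: \<kappa>_def mult.commute)
  qed
  have kapm[measurable]: "(\<lambda>(v, z). \<kappa> v z) \<in> borel_measurable (borel \<Otimes>\<^sub>M ?P)"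
    unfolding \<kappa>_def[abs_def] by measurable
  have f1: "(\<integral>y. f y \<partial>lborel) = 1"
    using distributed_integral[OF dens, of "\<lambda>_. 1"] f(2) by (simp add: prob_space)
  have kap1: "\<bar>\<kappa> v z\<bar> \<le> 1" if z: "z \<in> space ?P" for v z
  proof -
    have "\<bar>\<kappa> v z\<bar> = \<bar>\<integral>\<omega>'. K (v + eps p \<omega>') z \<partial>M\<bar>" using kap[OF z] by simp
    also have "\<dots> \<le> (\<integral>\<omega>'. \<bar>K (v + eps p \<omega>') z\<bar> \<partial>M)" by (rule integral_abs_bound)
    also have "\<dots> \<le> 1"
    proof (rule integral_le_const)
      show "integrable M (\<lambda>\<omega>'. \<bar>K (v + eps p \<omega>') z\<bar>)"
        by (rule integrable_const_bound[where B=1]) (use K01 z in auto)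
    qed (use K01 in auto)
    finally show ?thesis .
  qed
  have "AE \<omega> in M. W \<omega> * indicator A \<omega> = W \<omega> * K (x \<omega> + eps p \<omega>) (Q \<omega>)"
    using AE_X_eq_Y AE_Y_unroll AE_space
  proof eventually_elim
    case (elim \<omega>)
    obtain m where m: "n = Suc m" using n(2) by (cases n) auto
    have "X t \<omega> = \<beta> ^ nat (t - p) * (x \<omega> + eps p \<omega>) + Q \<omega> t" if t: "t \<in> ?I" for t
    proof -
      have "X t \<omega> = Y (p + int (nat (t - p))) \<omega>" using elim t by simp
      also have "\<dots> = \<beta> ^ nat (t - p) * Y (e + int n) \<omega> + R p (nat (t - p)) \<omega>" using elim n by blast
      also have "Y (e + int n) \<omega> = x \<omega> + (\<beta> * R e m \<omega> + eps p \<omega>)"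
      proof -
        have "Y (e + int n) \<omega> = \<beta> ^ n * Y e \<omega> + R e (Suc m) \<omega>" using elim m by blast
        moreover have "p = e + int m + 1" using n m by simp
        ultimately show ?thesis by (simp add: x_def)
      qed
      finally show ?thesis using t by (simp add: Q_def m algebra_simps)
    qed
    then have "(\<lambda>t\<in>?I. X t \<omega>) = (\<lambda>t\<in>?I. \<beta> ^ nat (t - p) * (x \<omega> + eps p \<omega>) + Q \<omega> t)" by (intro restrict_ext) simp
    then show ?case using elim by (simp add: K_def AC indicator_def)
  qed
  then have "(\<integral>\<omega>. W \<omega> * indicator A \<omega> \<partial>M) = (\<integral>\<omega>. W \<omega> * K (x \<omega> + eps p \<omega>) (Q \<omega>) \<partial>M)"
    by (intro integral_cong_AE) auto
  also have "\<dots> = (\<integral>\<omega>. W \<omega> * \<kappa> (x \<omega>) (Q \<omega>) \<partial>M)"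
  proof -
    let ?U = "\<lambda>\<omega>. ((W \<omega>, x \<omega>), Q \<omega>)"
    \<comment> \<open>The kernel lemma asks for a bound at every point of the product space, so the
      coordinate holding \<open>W\<close> is clamped to \<open>[-B, B]\<close>, which leaves
      \<open>W\<close> itself unchanged.\<close>
    let ?g = "\<lambda>z. max (- B) (min B (fst (fst (fst z)))) * K (snd (fst (fst z)) + snd z) (snd (fst z))"
    have clamp: "max (- B) (min B (W \<omega>)) = W \<omega>" for \<omega> using W(2)[of \<omega>] by auto
    have U: "?U \<in> measurable (F (UNIV - {p})) ((borel \<Otimes>\<^sub>M borel) \<Otimes>\<^sub>M ?P)"
    proof (intro measurable_Pair)
      show "W \<in> borel_measurable (F (UNIV - {p}))" by (rule measurable_gen_sigma_mono[OF W(1)]) (use n in auto)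
      show "x \<in> borel_measurable (F (UNIV - {p}))"
        unfolding x_def[abs_def] by (intro borel_measurable_times borel_measurable_const Y_F) (use n in auto)
      show "Q \<in> measurable (F (UNIV - {p})) ?P" by (rule measurable_gen_sigma_mono[OF QF]) (use n in auto)
    qed
    have "(\<integral>\<omega>. ?g (?U \<omega>, eps p \<omega>) \<partial>M) = (\<integral>\<omega>. (\<integral>\<omega>'. ?g (?U \<omega>, eps p \<omega>') \<partial>M) \<partial>M)"
    proof (rule gen_sigma_integral_kernel[OF eps_indep J(2) U eps_F, where B=B])
      show "norm (?g z) \<le> B" for z
      proof -
        have "\<bar>max (- B) (min B (fst (fst (fst z))))\<bar> \<le> B" using B by auto
        then have "\<bar>max (- B) (min B (fst (fst (fst z))))\<bar> * \<bar>K (snd (fst (fst z)) + snd z) (snd (fst z))\<bar> \<le> B * 1"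
          by (intro mult_mono K01 B) auto
        then show ?thesis by (simp add: abs_mult)
      qed
      show "?g \<in> borel_measurable (((borel \<Otimes>\<^sub>M borel) \<Otimes>\<^sub>M ?P) \<Otimes>\<^sub>M borel)"
        using measurable_compose[OF _ Km, of "\<lambda>z. (snd (fst (fst z)) + snd z, snd (fst z))" "((borel \<Otimes>\<^sub>M borel) \<Otimes>\<^sub>M ?P) \<Otimes>\<^sub>M borel"]
        by (simp add: case_prod_beta)
    qed auto
    also have "\<dots> = (\<integral>\<omega>. W \<omega> * \<kappa> (x \<omega>) (Q \<omega>) \<partial>M)"
      using kap measurable_space[OF Qm] by (intro Bochner_Integration.integral_cong refl) (simp add: clamp)
    finally show ?thesis by (simp add: clamp)
  qed
  finally have 1: "(\<integral>\<omega>. W \<omega> * indicator A \<omega> \<partial>M) = (\<integral>\<omega>. W \<omega> * \<kappa> (x \<omega>) (Q \<omega>) \<partial>M)" .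
  have k0F: "(\<lambda>\<omega>. \<kappa> 0 (Q \<omega>)) \<in> borel_measurable (F ({e+1..p-1} \<union> {p+1..q}))"
    using measurable_compose[OF QF, of "\<lambda>z. \<kappa> 0 z" borel] by simp
  have kint: "integrable M (\<lambda>\<omega>. \<kappa> (v \<omega>) (Q \<omega>))" if [measurable]: "v \<in> borel_measurable M" for v
    by (rule integrable_const_bound[where B=1])
      (use kap1 measurable_space[OF Qm] in \<open>auto intro!: AE_I2\<close>)
  have Wi: "integrable M W" by (rule integrable_const_bound[where B=B]) (use W(2) in auto)
  \<comment> \<open>Without the shift, the averaged indicator depends on \<open>Q\<close> alone and
    is independent of the centred \<open>W\<close>; the covariance is therefore due to the shift
    only.\<close>
  have 2: "(\<integral>\<omega>. W \<omega> * \<kappa> 0 (Q \<omega>) \<partial>M) = 0" "integrable M (\<lambda>\<omega>. W \<omega> * \<kappa> 0 (Q \<omega>))"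
    using gen_sigma_integral_mult[OF eps_indep J(1) W(1) Wi k0F kint] W(3) by auto
  have Wk: "integrable M (\<lambda>\<omega>. W \<omega> * \<kappa> (x \<omega>) (Q \<omega>))"
  proof (rule integrable_const_bound[where B=B])
    show "AE \<omega> in M. norm (W \<omega> * \<kappa> (x \<omega>) (Q \<omega>)) \<le> B"
    proof (rule AE_I2)
      fix \<omega> assume "\<omega> \<in> space M"
      then have "\<bar>W \<omega>\<bar> * \<bar>\<kappa> (x \<omega>) (Q \<omega>)\<bar> \<le> B * 1"
        using kap1[OF measurable_space[OF Qm]] W(2) B by (intro mult_mono) auto
      then show "norm (W \<omega> * \<kappa> (x \<omega>) (Q \<omega>)) \<le> B" by (simp add: abs_mult)
    qed
  qed measurable
  note [measurable] = L1_modulus_measurable[of f]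
  have Li: "integrable M (\<lambda>\<omega>. L1_modulus f (- x \<omega>))"
    by (rule integrable_const_bound[where B="2 * (\<integral>y. \<bar>f y\<bar> \<partial>lborel)"])
      (use L1_modulus_le[OF f(1)] L1_modulus_nonneg in auto)
  have "\<bar>\<integral>\<omega>. W \<omega> * indicator A \<omega> \<partial>M\<bar> = norm (\<integral>\<omega>. W \<omega> * \<kappa> (x \<omega>) (Q \<omega>) - W \<omega> * \<kappa> 0 (Q \<omega>) \<partial>M)"
    using 1 2 Wk by simp
  also have "\<dots> \<le> (\<integral>\<omega>. B * L1_modulus f (- x \<omega>) \<partial>M)"
  proof (rule norm_integral_le)
    fix \<omega> assume w: "\<omega> \<in> space M"
    have "(\<lambda>y. K y (Q \<omega>)) \<in> borel_measurable borel" using measurable_space[OF Qm w] by measurable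
    from translated_density_integral_le[OF f(1) this K01, of "x \<omega>"]
    have "\<bar>\<kappa> (x \<omega>) (Q \<omega>) - \<kappa> 0 (Q \<omega>)\<bar> \<le> L1_modulus f (- x \<omega>)"
      by (simp add: \<kappa>_def L1_modulus_def)
    then have "\<bar>W \<omega>\<bar> * \<bar>\<kappa> (x \<omega>) (Q \<omega>) - \<kappa> 0 (Q \<omega>)\<bar> \<le> B * L1_modulus f (- x \<omega>)"
      using W(2) B by (intro mult_mono) auto
    then show "norm (W \<omega> * \<kappa> (x \<omega>) (Q \<omega>) - W \<omega> * \<kappa> 0 (Q \<omega>)) \<le> B * L1_modulus f (- x \<omega>)"
      by (simp add: abs_mult flip: right_diff_distrib)
  qed (use Wk 2 Li in auto)
  also have "\<dots> = B * (\<integral>\<omega>. L1_modulus f (- (\<beta> ^ n * Y e \<omega>)) \<partial>M)" by (simp add: x_def)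
  finally show ?thesis .
qed

end

text \<open>The events where the centred conditional expectation is nonnegative and where it is
  negative both belong to \<open>G\<close>; testing on them recovers its L1 norm as a sum of two
  terms of size at most \<open>d\<close>.\<close>

lemma (in prob_space) real_cond_exp_L1_le:
  assumes sub: "subalgebra M G" and g: "integrable M g"
    and le: "\<And>A. A \<in> sets G \<Longrightarrow> \<bar>\<integral>\<omega>. (g \<omega> - c) * indicator A \<omega> \<partial>M\<bar> \<le> d"
  shows "integrable M (\<lambda>\<omega>. real_cond_exp M G g \<omega> - c)"
    and "(\<integral>\<omega>. \<bar>real_cond_exp M G g \<omega> - c\<bar> \<partial>M) \<le> 2 * d"
proof -
  interpret finite_measure_subalgebra M G by unfold_locales (rule sub)
  define C where "C \<omega> = real_cond_exp M G g \<omega> - c" for \<omega>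
  have Ci: "integrable M C" unfolding C_def[abs_def] using g by (auto intro: real_cond_exp_int)
  then show "integrable M (\<lambda>\<omega>. real_cond_exp M G g \<omega> - c)" unfolding C_def[abs_def] .
  have CG: "C \<in> borel_measurable G" unfolding C_def[abs_def] by measurable
  have spG: "space G = space M" using sub by (simp add: subalgebra_def)
  have eq: "(\<integral>\<omega>. C \<omega> * indicator A \<omega> \<partial>M) = (\<integral>\<omega>. (g \<omega> - c) * indicator A \<omega> \<partial>M)"
    and int: "integrable M (\<lambda>\<omega>. C \<omega> * indicator A \<omega>)" if A: "A \<in> sets G" for A
  proof -
    have [measurable]: "A \<in> sets M" using A sub by (auto simp: subalgebra_def)
    have i: "integrable M (\<lambda>\<omega>. real_cond_exp M G g \<omega> * indicator A \<omega>)" "integrable M (\<lambda>\<omega>. g \<omega> * indicator A \<omega>)"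
      "integrable M (\<lambda>\<omega>. c * indicator A \<omega>)"
      using g real_cond_exp_int(1)[OF g]
      by (auto intro!: integrable_real_mult_indicator simp: integrable_real_indicator emeasure_eq_measure)
    have "(\<integral>\<omega>. C \<omega> * indicator A \<omega> \<partial>M) = (\<integral>\<omega>. real_cond_exp M G g \<omega> * indicator A \<omega> \<partial>M) - (\<integral>\<omega>. c * indicator A \<omega> \<partial>M)"
      unfolding C_def left_diff_distrib by (rule Bochner_Integration.integral_diff[OF i(1,3)])
    also have "(\<integral>\<omega>. real_cond_exp M G g \<omega> * indicator A \<omega> \<partial>M) = (\<integral>\<omega>. g \<omega> * indicator A \<omega> \<partial>M)"
      using real_cond_exp_intA[OF g A] by (simp add: set_lebesgue_integral_def mult.commute)
    also have "\<dots> - (\<integral>\<omega>. c * indicator A \<omega> \<partial>M) = (\<integral>\<omega>. (g \<omega> - c) * indicator A \<omega> \<partial>M)"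
      unfolding left_diff_distrib by (rule Bochner_Integration.integral_diff[OF i(2,3), symmetric])
    finally show "(\<integral>\<omega>. C \<omega> * indicator A \<omega> \<partial>M) = (\<integral>\<omega>. (g \<omega> - c) * indicator A \<omega> \<partial>M)" .
    show "integrable M (\<lambda>\<omega>. C \<omega> * indicator A \<omega>)"
      using Ci by (auto intro!: integrable_real_mult_indicator)
  qed
  let ?P = "{\<omega> \<in> space G. 0 \<le> C \<omega>}" and ?N = "{\<omega> \<in> space G. C \<omega> < 0}"
  have PN: "?P \<in> sets G" "?N \<in> sets G" using CG by measurable
  have "(\<integral>\<omega>. \<bar>C \<omega>\<bar> \<partial>M) = (\<integral>\<omega>. C \<omega> * indicator ?P \<omega> - C \<omega> * indicator ?N \<omega> \<partial>M)"
    by (intro Bochner_Integration.integral_cong) (auto simp: spG indicator_def)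
  also have "\<dots> = (\<integral>\<omega>. C \<omega> * indicator ?P \<omega> \<partial>M) - (\<integral>\<omega>. C \<omega> * indicator ?N \<omega> \<partial>M)"
    using int[OF PN(1)] int[OF PN(2)] by simp
  also have "\<dots> \<le> 2 * d" using le[OF PN(1)] le[OF PN(2)] eq[OF PN(1)] eq[OF PN(2)] by linarith
  finally show "(\<integral>\<omega>. \<bar>real_cond_exp M G g \<omega> - c\<bar> \<partial>M) \<le> 2 * d" by (simp add: C_def)
qed

lemma (in prob_space) indep_vars_reindex_UNIV:
  assumes ind: "indep_vars (\<lambda>_. N) X UNIV" and f: "inj f"
  shows "indep_vars (\<lambda>_. N) (\<lambda>s. X (f s)) UNIV"
  unfolding indep_vars_def2
proof (intro conjI ballI indep_setsI)
  show "random_variable N (X (f i))" for i using ind unfolding indep_vars_def2 by auto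
  then show "{X (f i) -` A \<inter> space M | A. A \<in> sets N} \<subseteq> events" for i by (auto intro: measurable_sets)
  fix A J assume J: "J \<noteq> {}" "finite J" and A: "\<forall>j\<in>J. A j \<in> {X (f j) -` A \<inter> space M | A. A \<in> sets N}"
  have inv: "inv f (f j) = j" for j using f by simp
  have "prob (\<Inter>i\<in>f ` J. A (inv f i)) = (\<Prod>i\<in>f ` J. prob (A (inv f i)))"
    using ind[unfolded indep_vars_def2, THEN conjunct2] by (rule indep_setsD) (use J A inv in auto)
  then show "prob (\<Inter>j\<in>J. A j) = (\<Prod>j\<in>J. prob (A j))"
    using f by (simp add: inv prod.reindex inj_on_def)
qed

context AR1 begin

text \<open>The covariance bound has the same right side for every event of the block, hence it
  bounds the L1 distance of the conditional from the unconditional mean. The shift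
  \<open>\<beta> ^ (p - e) * Y e\<close> tends to 0 in L1, so its expected L1 modulus vanishes.
  \<open>Z'\<close> is a version of \<open>Z\<close> that is exactly measurable for the innovations
  up to \<open>e\<close>.\<close>

lemma weak_dependence:
  fixes Z Z' :: "nat \<Rightarrow> 'a \<Rightarrow> real" and e p :: "nat \<Rightarrow> nat"
  assumes f: "integrable lborel f" "\<And>x. 0 \<le> f x" and dens: "\<And>t. distributed M lborel (eps t) (\<lambda>x. ennreal (f x))"
    and Z[measurable]: "\<And>T. Z T \<in> borel_measurable M" and Z': "\<And>T. Z' T \<in> borel_measurable (F {..int (e T)})"
    and ZZ': "\<And>T. AE \<omega> in M. Z T \<omega> = Z' T \<omega>"
    and ep: "\<And>T. e T < p T" "filterlim (\<lambda>T. p T - e T) at_top sequentially"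
    and h[measurable]: "h \<in> borel_measurable borel" and hB: "\<And>x. \<bar>h x\<bar> \<le> B"
  shows "tendsto_in_prob M (\<lambda>T \<omega>. real_cond_exp M (gen_sigma M X {int (p T)..int T}) (\<lambda>\<omega>'. h (Z T \<omega>')) \<omega>
            - (\<integral>\<omega>'. h (Z T \<omega>') \<partial>M)) 0"
proof -
  define V where "V T \<omega> = - (\<beta> ^ (p T - e T) * Y (int (e T)) \<omega>)" for T \<omega>
  have [measurable]: "Z' T \<in> borel_measurable M" for T by (rule F_meas[OF Z'])
  have V_int: "integrable M (V T)" for T
    unfolding V_def[abs_def] using Y_power(1)[of 1] by (auto intro: integrable_abs_cancel)
  have "tendsto_in_prob M V 0"
  proof (rule tendsto_in_prob_L1[OF V_int])
    have le: "(\<integral>\<omega>. \<bar>V T \<omega> - 0\<bar> \<partial>M) \<le> \<bar>\<beta>\<bar> ^ (p T - e T) * (1 + K4)" for T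
    proof -
      have "(\<integral>\<omega>. \<bar>V T \<omega> - 0\<bar> \<partial>M) = \<bar>\<beta>\<bar> ^ (p T - e T) * (\<integral>\<omega>. \<bar>Y (int (e T)) \<omega>\<bar> ^ 1 \<partial>M)"
        by (simp add: V_def abs_mult power_abs)
      also have "\<dots> \<le> \<bar>\<beta>\<bar> ^ (p T - e T) * (1 + K4)" by (intro mult_left_mono Y_power) auto
      finally show ?thesis .
    qed
    have "(\<lambda>n. \<bar>\<beta>\<bar> ^ n) \<longlonglongrightarrow> 0" using \<beta> by (intro LIMSEQ_power_zero) simp
    then have "(\<lambda>T. \<bar>\<beta>\<bar> ^ (p T - e T)) \<longlonglongrightarrow> 0" by (rule filterlim_compose[OF _ ep(2)])
    then have "(\<lambda>T. \<bar>\<beta>\<bar> ^ (p T - e T) * (1 + K4)) \<longlonglongrightarrow> 0" by (rule tendsto_mult_left_zero)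
    then show "(\<lambda>T. \<integral>\<omega>. \<bar>V T \<omega> - 0\<bar> \<partial>M) \<longlonglongrightarrow> 0"
      by (intro tendsto_zero_squeeze[OF _ le]) simp_all
  qed
  then have lim: "(\<lambda>T. \<integral>\<omega>. L1_modulus f (V T \<omega>) \<partial>M) \<longlonglongrightarrow> 0"
  proof (rule expectation_tendsto_zero_of_prob[rotated])
    show "L1_modulus f \<in> borel_measurable borel" using f by (intro L1_modulus_measurable) auto
    show "L1_modulus f 0 = 0" by (simp add: L1_modulus_def)
  qed (use V_int L1_modulus_isCont_0[OF f(1)] L1_modulus_nonneg L1_modulus_le[OF f(1)] in auto)
  let ?G = "\<lambda>T. gen_sigma M X {int (p T)..int T}"
  let ?c = "\<lambda>T. \<integral>\<omega>'. h (Z T \<omega>') \<partial>M"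
  have hi: "integrable M (\<lambda>\<omega>. h (W \<omega>))" if [measurable]: "W \<in> borel_measurable M" for W
    by (rule integrable_const_bound[where B=B]) (use hB in auto)
  have cB: "\<bar>?c T\<bar> \<le> B" for T
  proof -
    have "\<bar>?c T\<bar> \<le> (\<integral>\<omega>. \<bar>h (Z T \<omega>)\<bar> \<partial>M)" by (rule integral_abs_bound)
    also have "\<dots> \<le> B" by (rule integral_le_const) (use hi[OF Z] hB in auto)
    finally show ?thesis .
  qed
  have le: "\<bar>\<integral>\<omega>. (h (Z T \<omega>) - ?c T) * indicator A \<omega> \<partial>M\<bar> \<le> 2 * B * (\<integral>\<omega>. L1_modulus f (V T \<omega>) \<partial>M)"
    if A: "A \<in> sets (?G T)" for T A
  proof -
    let ?W = "\<lambda>\<omega>. h (Z' T \<omega>) - ?c T"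
    have [measurable]: "A \<in> sets M"
      using A subalgebra_gen_sigma[of X M] X_meas by (auto simp: subalgebra_def)
    have ZZ: "AE \<omega> in M. h (Z T \<omega>) = h (Z' T \<omega>)" using ZZ'[of T] by eventually_elim simp
    have "(\<integral>\<omega>. (h (Z T \<omega>) - ?c T) * indicator A \<omega> \<partial>M) = (\<integral>\<omega>. ?W \<omega> * indicator A \<omega> \<partial>M)"
      by (rule integral_cong_AE) (use ZZ in \<open>auto elim!: eventually_mono\<close>)
    also have "\<bar>\<dots>\<bar> \<le> 2 * B * (\<integral>\<omega>. L1_modulus f (- (\<beta> ^ (p T - e T) * Y (int (e T)) \<omega>)) \<partial>M)"
    proof (rule past_future_covariance_le[OF f dens _ _ _ _ _ A])
      show "int (p T) = int (e T) + int (p T - e T)" "1 \<le> p T - e T" using ep(1)[of T] by auto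
      show "?W \<in> borel_measurable (F {..int (e T)})"
        using measurable_compose[OF Z'[of T] h] by simp
      show "\<bar>?W \<omega>\<bar> \<le> 2 * B" for \<omega> using hB[of "Z' T \<omega>"] cB[of T] by linarith
      have "(\<integral>\<omega>. h (Z' T \<omega>) \<partial>M) = ?c T"
        by (rule integral_cong_AE) (use ZZ in \<open>auto elim!: eventually_mono\<close>)
      then show "(\<integral>\<omega>. ?W \<omega> \<partial>M) = 0" using hi[of "Z' T"] by (simp add: prob_space)
    qed
    finally show ?thesis by (simp add: V_def)
  qed
  note L1 = real_cond_exp_L1_le[OF subalgebra_gen_sigma[OF X_meas] hi[OF Z] le]
  show ?thesis
  proof (rule tendsto_in_prob_L1)
    have "(\<lambda>T. 2 * (2 * B * (\<integral>\<omega>. L1_modulus f (V T \<omega>) \<partial>M))) \<longlonglongrightarrow> 2 * (2 * B * 0)"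
      by (intro tendsto_mult tendsto_const lim)
    then have lim0: "(\<lambda>T. 2 * (2 * B * (\<integral>\<omega>. L1_modulus f (V T \<omega>) \<partial>M))) \<longlonglongrightarrow> 0" by simp
    have "(\<lambda>T. \<integral>\<omega>. \<bar>real_cond_exp M (?G T) (\<lambda>\<omega>'. h (Z T \<omega>')) \<omega> - ?c T\<bar> \<partial>M) \<longlonglongrightarrow> 0"
      by (rule tendsto_zero_squeeze[OF _ L1(2) lim0]) simp_all
    then show "(\<lambda>T. \<integral>\<omega>. \<bar>real_cond_exp M (?G T) (\<lambda>\<omega>'. h (Z T \<omega>')) \<omega> - ?c T - 0\<bar> \<partial>M) \<longlonglongrightarrow> 0"
      by simp
  qed (rule L1(1))
qed

text \<open>The vector of the \<open>X (t + k)\<close> is almost surely one fixed measurable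
  function of the innovations shifted by \<open>k\<close>, and the shifted innovations have the same
  product law for every \<open>k\<close>.\<close>

lemma X_strictly_stationary: "strictly_stationary M X"
  unfolding strictly_stationary_def
proof (intro conjI allI impI)
  show "X t \<in> borel_measurable M" for t by (rule X_meas)
  fix J :: "int set" and h :: int
  let ?B = "Pi\<^sub>M UNIV (\<lambda>_::int. borel :: real measure)"
  define g where "g x = (\<lambda>t\<in>J. \<Sum>j. w j * x (t - int j))" for x :: "int \<Rightarrow> real"
  have g[measurable]: "g \<in> measurable ?B (Pi\<^sub>M J (\<lambda>_. borel))"
    unfolding g_def[abs_def] by (intro measurable_restrict) measurable
  define E where "E k \<omega> = (\<lambda>s\<in>UNIV. eps (s + k) \<omega>)" for k \<omega>
  have E[measurable]: "E k \<in> measurable M ?B" for k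
    unfolding E_def[abs_def] by (intro measurable_restrict) measurable
  have dE: "distr M ?B (E k) = Pi\<^sub>M UNIV (\<lambda>_. distr M borel (eps 0))" for k
  proof -
    have "indep_vars (\<lambda>_. borel) (\<lambda>s. eps (s + k)) UNIV"
      by (rule indep_vars_reindex_UNIV[OF eps_indep]) (simp add: inj_on_def)
    then have "distr M ?B (\<lambda>\<omega>. \<lambda>s\<in>UNIV. eps (s + k) \<omega>) = (\<Pi>\<^sub>M s\<in>UNIV. distr M borel (eps (s + k)))"
      by (subst (asm) indep_vars_iff_distr_eq_PiM') auto
    also have "(\<lambda>s. distr M borel (eps (s + k))) = (\<lambda>_. distr M borel (eps 0))"
      using eps_iid unfolding iid_def by blast
    finally show ?thesis unfolding E_def[abs_def] .
  qed
  have "distr M (Pi\<^sub>M J (\<lambda>_. borel)) (\<lambda>\<omega>. \<lambda>t\<in>J. X (t + k) \<omega>) = distr (Pi\<^sub>M UNIV (\<lambda>_. distr M borel (eps 0))) (Pi\<^sub>M J (\<lambda>_. borel)) g" for k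
  proof -
    have "AE \<omega> in M. (\<lambda>t\<in>J. X (t + k) \<omega>) = g (E k \<omega>)"
      using AE_X_eq_Y by eventually_elim (auto simp: g_def E_def Y_def algebra_simps)
    then have "distr M (Pi\<^sub>M J (\<lambda>_. borel)) (\<lambda>\<omega>. \<lambda>t\<in>J. X (t + k) \<omega>) = distr M (Pi\<^sub>M J (\<lambda>_. borel)) (\<lambda>\<omega>. g (E k \<omega>))"
      by (intro distr_cong_AE) (auto intro!: measurable_restrict)
    also have "\<dots> = distr (distr M ?B (E k)) (Pi\<^sub>M J (\<lambda>_. borel)) g"
      by (subst distr_distr) (auto simp: o_def)
    finally show ?thesis by (simp add: dE)
  qed
  from this[of h] this[of 0]
  show "distr M (Pi\<^sub>M J (\<lambda>_. borel)) (\<lambda>\<omega>. \<lambda>t\<in>J. X (t + h) \<omega>) = distr M (Pi\<^sub>M J (\<lambda>_. borel)) (\<lambda>\<omega>. \<lambda>t\<in>J. X t \<omega>)"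
    by simp
qed

section \<open>The estimator expressed through the sums \<open>D\<close> and
  \<open>S\<close>\<close>

lemma AE_ols:
  "AE \<omega> in M. \<forall>T. ols_denom T X \<omega> = D (T - 1) \<omega> \<and>
     beta_hat T X \<omega> = (\<beta> * D (T - 1) \<omega> + S (T - 1) \<omega>) / D (T - 1) \<omega>"
  using AE_X_eq_Y AE_Y_AR
proof eventually_elim
  case (elim \<omega>)
  show ?case
  proof
    fix T
    have d: "ols_denom T X \<omega> = D (T - 1) \<omega>"
      using elim(1) by (simp add: ols_denom_def sum_int_atLeast2 D_def algebra_simps)
    have "(\<Sum>t = 2..int T. X t \<omega> * X (t - 1) \<omega>) = (\<Sum>k<T - 1. Y (int k + 2) \<omega> * Y (int k + 1) \<omega>)"
      using elim(1) by (simp add: sum_int_atLeast2 algebra_simps)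
    also have "\<dots> = (\<Sum>k<T - 1. \<beta> * (Y (int k + 1) \<omega>)\<^sup>2 + Y (int k + 1) \<omega> * eps (int k + 2) \<omega>)"
    proof (rule sum.cong[OF refl])
      fix k
      have "Y (int k + 2) \<omega> = \<beta> * Y (int k + 1) \<omega> + eps (int k + 2) \<omega>"
        using elim(2)[THEN spec, of "int k + 2"] by (simp add: algebra_simps)
      then show "Y (int k + 2) \<omega> * Y (int k + 1) \<omega> = \<beta> * (Y (int k + 1) \<omega>)\<^sup>2 + Y (int k + 1) \<omega> * eps (int k + 2) \<omega>"
        by (simp add: power2_eq_square algebra_simps)
    qed
    also have "\<dots> = \<beta> * D (T - 1) \<omega> + S (T - 1) \<omega>"
      by (simp add: D_def S_def sum.distrib sum_distrib_left)
    finally show "ols_denom T X \<omega> = D (T - 1) \<omega> \<and>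
      beta_hat T X \<omega> = (\<beta> * D (T - 1) \<omega> + S (T - 1) \<omega>) / D (T - 1) \<omega>"
      by (simp add: beta_hat_def d)
  qed
qed

lemma ols_meas [measurable]: "ols_denom T X \<in> borel_measurable M" "beta_hat T X \<in> borel_measurable M"
  "Upsilon_hat T X \<in> borel_measurable M"
  unfolding ols_denom_def[abs_def] beta_hat_def[abs_def] Upsilon_hat_def[abs_def] by measurable

end

section \<open>Asymptotics of the OLS estimator\<close>

context AR1 begin

text \<open>A vanishing variance would put all mass of \<open>eps 0\<close> at the point 0, a
  Lebesgue null set. Positivity makes \<open>\<gamma>\<close> a legitimate denominator.\<close>

lemma sig2_pos:
  assumes dens: "distributed M lborel (eps 0) (\<lambda>x. ennreal (f x))"
  shows "0 < sig2"
proof (rule ccontr)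
  assume "\<not> 0 < sig2"
  then have "sig2 = 0" using moments_nonneg(1) by simp
  then have "AE \<omega> in M. (eps 0 \<omega>)\<^sup>2 = 0"
    unfolding sig2_def using eps_integrable(2) by (subst (asm) integral_nonneg_eq_0_iff_AE) auto
  then have "AE \<omega> in M. \<omega> \<in> eps 0 -` {0} \<inter> space M"
    using AE_space by eventually_elim auto
  then have "prob (eps 0 -` {0} \<inter> space M) = 1"
    by (intro prob_eq_1[THEN iffD2]) auto
  moreover have "emeasure M (eps 0 -` {0} \<inter> space M) = 0"
  proof -
    have "emeasure M (eps 0 -` {0} \<inter> space M) = (\<integral>\<^sup>+x. ennreal (f x) * indicator {0} x \<partial>lborel)"
      by (rule distributed_emeasure[OF dens]) simp
    also have "\<dots> = (\<integral>\<^sup>+(x::real). 0 \<partial>lborel)"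
    proof (rule nn_integral_cong_AE)
      show "AE x in lborel. ennreal (f x) * indicator {0} x = 0"
        using AE_lborel_singleton[of "0::real"] by eventually_elim auto
    qed
    finally show ?thesis by simp
  qed
  ultimately show False by (simp add: measure_def)
qed

lemma S_pred_F: "{..int T} \<subseteq> I \<Longrightarrow> S (T - 1) \<in> borel_measurable (F I)"
proof (cases T)
  \<comment> \<open>For \<open>T = 0\<close> the truncated difference gives \<open>S 0\<close>,
    which is zero, while \<open>S_F\<close> would ask for innovations up to time 1.\<close>
  case 0
  then show ?thesis by (simp add: S_def[abs_def])
next
  case (Suc n)
  moreover assume "{..int T} \<subseteq> I"
  ultimately show ?thesis by (intro S_F) auto
qed

lemma D_mean_tendsto: "tendsto_in_prob M (\<lambda>T \<omega>. D (T - 1) \<omega> / real T) \<gamma>"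
proof (rule tendsto_in_prob_L1)
  obtain C where C: "\<And>T. T \<ge> 1 \<Longrightarrow> (\<integral>\<omega>. \<bar>D (T - 1) \<omega> / real T - \<gamma>\<bar> \<partial>M) \<le> C / sqrt (real T)"
    using D_L1_rate by blast
  have lim: "(\<lambda>T. C / sqrt (real T)) \<longlonglongrightarrow> 0" by real_asymp
  have "\<forall>\<^sub>F T in sequentially. norm (\<integral>\<omega>. \<bar>D (T - 1) \<omega> / real T - \<gamma>\<bar> \<partial>M) \<le> C / sqrt (real T)"
    using eventually_ge_at_top[of 1]
  proof eventually_elim
    case (elim T)
    have "0 \<le> (\<integral>\<omega>. \<bar>D (T - 1) \<omega> / real T - \<gamma>\<bar> \<partial>M)" by simp
    then show ?case using C[OF elim] by (simp only: real_norm_def abs_of_nonneg)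
  qed
  then show "(\<lambda>T. \<integral>\<omega>. \<bar>D (T - 1) \<omega> / real T - \<gamma>\<bar> \<partial>M) \<longlonglongrightarrow> 0"
    by (rule Lim_null_comparison[OF _ lim])
qed (use D_integrable in auto)

lemma S_scaled_square:
  "integrable M (\<lambda>\<omega>. (S (T - 1) \<omega> / sqrt (real T))\<^sup>2)"
  "(\<integral>\<omega>. (S (T - 1) \<omega> / sqrt (real T))\<^sup>2 \<partial>M) \<le> (1 + K4) * sig2"
proof -
  show "integrable M (\<lambda>\<omega>. (S (T - 1) \<omega> / sqrt (real T))\<^sup>2)"
    using S_square(1)[of "T - 1"] by (simp add: power_divide)
  have c: "0 \<le> (1 + K4) * sig2" using moments_nonneg by simp
  show "(\<integral>\<omega>. (S (T - 1) \<omega> / sqrt (real T))\<^sup>2 \<partial>M) \<le> (1 + K4) * sig2"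
  proof (cases "T = 0")
    case False
    have "(\<integral>\<omega>. (S (T - 1) \<omega>)\<^sup>2 \<partial>M) \<le> real T * ((1 + K4) * sig2)"
      using S_square(2)[of "T - 1"] mult_right_mono[OF _ c, of "real (T - 1)" "real T"] by linarith
    then show ?thesis using False by (simp add: power_divide pos_divide_le_eq mult.commute)
  qed (use c in simp)
qed

lemma S_mean_tendsto: "tendsto_in_prob M (\<lambda>T \<omega>. S (T - 1) \<omega> / real T) 0"
proof -
  have V: "tendsto_in_prob M (\<lambda>T \<omega>. 1 / sqrt (real T)) 0"
  proof (rule tendsto_in_prob_L1)
    have "(\<lambda>T. \<bar>1 / sqrt (real T) - 0\<bar>) \<longlonglongrightarrow> 0" by real_asymp
    then show "(\<lambda>T. \<integral>\<omega>. \<bar>1 / sqrt (real T) - 0\<bar> \<partial>M) \<longlonglongrightarrow> 0" by (simp add: prob_space)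
  qed simp
  have "tendsto_in_prob M (\<lambda>T \<omega>. S (T - 1) \<omega> / sqrt (real T) * (1 / sqrt (real T))) 0"
    by (rule tendsto_in_prob_bounded_times_small[OF _ S_scaled_square _ V]) auto
  then show ?thesis by simp
qed

lemma AE_beta_hat_mean:
  "AE \<omega> in M. beta_hat T X \<omega> = (\<beta> * (D (T - 1) \<omega> / real T) + S (T - 1) \<omega> / real T) / (D (T - 1) \<omega> / real T)"
  using AE_ols
proof eventually_elim
  case (elim \<omega>)
  \<comment> \<open>At \<open>T = 0\<close> both sides are 0 under \<open>x / 0 = 0\<close>; for
    \<open>T > 0\<close> the common factor \<open>1 / T\<close> cancels, even where \<open>D\<close>
    vanishes.\<close>
  then show ?case by (cases "T = 0") (auto simp: D_def S_def add_divide_distrib[symmetric])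
qed

lemma Upsilon_hat_tendsto:
  assumes "0 < sig2"
  shows "tendsto_in_prob M (\<lambda>T \<omega>. Upsilon_hat T X \<omega>) (1 - \<beta>\<^sup>2)"
proof -
  have \<gamma>: "0 < \<gamma>" using assms beta_square by (simp add: \<gamma>_def)
  let ?g = "\<lambda>z :: real \<times> real. 1 - ((\<beta> * snd z + fst z) / snd z)\<^sup>2"
  have "tendsto_in_prob M (\<lambda>T \<omega>. Upsilon_hat T X \<omega>) (?g (0, \<gamma>))"
  proof (rule tendsto_in_prob_isCont2[OF _ _ S_mean_tendsto _ D_mean_tendsto])
    show "isCont ?g (0, \<gamma>)" using \<gamma> by (intro continuous_intros) auto
    show "AE \<omega> in M. Upsilon_hat T X \<omega> = ?g (S (T - 1) \<omega> / real T, D (T - 1) \<omega> / real T)" for T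
      using AE_beta_hat_mean[of T] by eventually_elim (simp add: Upsilon_hat_def)
  qed auto
  then show ?thesis using \<gamma> by simp
qed

text \<open>Where the denominator is positive, the scaled error is \<open>U / d\<close> with
  \<open>U = S / sqrt T\<close> and \<open>d = D / T\<close>. Replacing \<open>d\<close> by its
  limit \<open>\<gamma>\<close> costs a bounded times a vanishing factor, and
  \<open>U / \<gamma>\<close> has the limiting variance
  \<open>sig2 / \<gamma> = 1 - \<beta>\<^sup>2\<close>.\<close>

lemma beta_hat_clt:
  assumes "0 < sig2"
  shows "tendsto_in_distr M (\<lambda>T \<omega>. sqrt (real T) * (beta_hat T X \<omega> - \<beta>)) (normal_law 0 (1 - \<beta>\<^sup>2))"
proof -
  have \<gamma>: "0 < \<gamma>" using assms beta_square by (simp add: \<gamma>_def)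
  define U where "U T \<omega> = S (T - 1) \<omega> / sqrt (real T)" for T \<omega>
  define d where "d T \<omega> = D (T - 1) \<omega> / real T" for T \<omega>
  define Z where "Z T \<omega> = sqrt (real T) * (beta_hat T X \<omega> - \<beta>)" for T \<omega>
  have [measurable]: "U T \<in> borel_measurable M" "d T \<in> borel_measurable M" "Z T \<in> borel_measurable M" for T
    unfolding U_def[abs_def] d_def[abs_def] Z_def[abs_def] by measurable
  have dlim: "tendsto_in_prob M d \<gamma>" unfolding d_def[abs_def] by (rule D_mean_tendsto)
  \<comment> \<open>The mapping lemma takes pairs, so \<open>d\<close> is supplied twice and the
    second coordinate ignored. The limit is left unevaluated to match that lemma; its value is
    0.\<close>
  have V: "tendsto_in_prob M (\<lambda>T \<omega>. 1 / d T \<omega> - 1 / \<gamma>) ((\<lambda>z. 1 / fst z - 1 / \<gamma>) (\<gamma>, \<gamma>))"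
    by (rule tendsto_in_prob_isCont2[OF _ _ dlim _ dlim]) (use \<gamma> in \<open>auto intro!: continuous_intros\<close>)
  have UV: "tendsto_in_prob M (\<lambda>T \<omega>. U T \<omega> * (1 / d T \<omega> - 1 / \<gamma>)) 0"
    by (rule tendsto_in_prob_bounded_times_small[OF _ S_scaled_square[folded U_def]]) (use V in auto)
  have diff: "tendsto_in_prob M (\<lambda>T \<omega>. Z T \<omega> - U T \<omega> / \<gamma>) 0"
  proof (rule tendsto_in_prob_squeeze[OF _ _ UV _ dlim])
    fix r :: real assume r: "r > 0"
    \<comment> \<open>The bound \<open>\<gamma> / 2\<close> forces \<open>d > 0\<close>, which also
      excludes \<open>T = 0\<close>, so that the quotient identity for \<open>Z\<close>
      holds.\<close>
    let ?m = "min r (\<gamma> / 2)"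
    have "AE \<omega> in M. \<bar>U T \<omega> * (1 / d T \<omega> - 1 / \<gamma>) - 0\<bar> \<le> ?m \<longrightarrow> \<bar>d T \<omega> - \<gamma>\<bar> \<le> ?m \<longrightarrow> \<bar>Z T \<omega> - U T \<omega> / \<gamma> - 0\<bar> \<le> r" for T
      using AE_beta_hat_mean[of T]
    proof (eventually_elim, intro impI)
      fix \<omega> assume b: "beta_hat T X \<omega> = (\<beta> * (D (T - 1) \<omega> / real T) + S (T - 1) \<omega> / real T) / (D (T - 1) \<omega> / real T)"
        and 1: "\<bar>U T \<omega> * (1 / d T \<omega> - 1 / \<gamma>) - 0\<bar> \<le> ?m" and 2: "\<bar>d T \<omega> - \<gamma>\<bar> \<le> ?m"
      have d0: "d T \<omega> > 0" using 2 \<gamma> by linarith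
      then have T: "real T > 0" unfolding d_def by (cases "T = 0") auto
      have s1: "sqrt (real T) * (S (T - 1) \<omega> / real T) = U T \<omega>"
        using T by (simp add: U_def field_simps)
      have s2: "beta_hat T X \<omega> - \<beta> = (S (T - 1) \<omega> / real T) / d T \<omega>"
      proof -
        have "beta_hat T X \<omega> = (\<beta> * d T \<omega> + S (T - 1) \<omega> / real T) / d T \<omega>" using b unfolding d_def .
        also have "\<dots> = \<beta> + (S (T - 1) \<omega> / real T) / d T \<omega>" using d0 by (simp add: add_divide_distrib)
        finally show ?thesis by simp
      qed
      have "Z T \<omega> = U T \<omega> / d T \<omega>" unfolding Z_def s2 s1[symmetric] by (rule times_divide_eq_right)
      then have "Z T \<omega> - U T \<omega> / \<gamma> = U T \<omega> * (1 / d T \<omega> - 1 / \<gamma>)" by (simp add: right_diff_distrib)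
      then show "\<bar>Z T \<omega> - U T \<omega> / \<gamma> - 0\<bar> \<le> r" using 1 by simp
    qed
    then show "\<exists>m>0. \<forall>T. AE \<omega> in M. \<bar>U T \<omega> * (1 / d T \<omega> - 1 / \<gamma>) - 0\<bar> \<le> m \<longrightarrow> \<bar>d T \<omega> - \<gamma>\<bar> \<le> m \<longrightarrow> \<bar>Z T \<omega> - U T \<omega> / \<gamma> - 0\<bar> \<le> r"
      using r \<gamma> by (intro exI[of _ ?m]) auto
  qed auto
  have "weak_conv_m (\<lambda>T. distr M borel (Z T)) (normal_law 0 (1 - \<beta>\<^sup>2))"
  proof (rule levy_continuity)
    show "real_distribution (distr M borel (Z T))" for T by (rule real_distribution_distr) measurable
    show "real_distribution (normal_law 0 (1 - \<beta>\<^sup>2))" using beta_square by (intro real_distribution_normal_law) simp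
    fix u :: real
    have var: "(u / \<gamma>)\<^sup>2 * (sig2 * \<gamma>) = u\<^sup>2 * (1 - \<beta>\<^sup>2)"
    proof -
      have "sig2 = (1 - \<beta>\<^sup>2) * \<gamma>" using beta_square by (simp add: \<gamma>_def)
      then show ?thesis using \<gamma> by (simp add: power2_eq_square)
    qed
    have "(\<lambda>T. \<integral>\<omega>. iexp (u * (U T \<omega> / \<gamma>)) \<partial>M) \<longlonglongrightarrow> exp (- (u\<^sup>2 * (1 - \<beta>\<^sup>2)) / 2)"
    proof -
      have "u * (x / \<gamma>) = u / \<gamma> * x" for x by simp
      then show ?thesis using S_char_tendsto[of "u / \<gamma>"] unfolding var U_def by (simp only:)
    qed
    then have "(\<lambda>T. \<integral>\<omega>. iexp (u * Z T \<omega>) \<partial>M) \<longlonglongrightarrow> exp (- (u\<^sup>2 * (1 - \<beta>\<^sup>2)) / 2)"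
      by (rule char_tendsto_perturb[OF _ _ diff, rotated 2]) measurable
    moreover have "char (distr M borel (Z T)) u = (\<integral>\<omega>. iexp (u * Z T \<omega>) \<partial>M)" for T
      unfolding char_def by (subst integral_distr) auto
    ultimately show "(\<lambda>T. char (distr M borel (Z T)) u) \<longlonglongrightarrow> char (normal_law 0 (1 - \<beta>\<^sup>2)) u"
      using beta_square by (simp add: char_normal_law)
  qed
  then show ?thesis unfolding tendsto_in_distr_def Z_def[abs_def] by simp
qed

text \<open>The Gaussian mean of \<open>h\<close> is a continuous function of the variance, so
  consistency of \<open>Upsilon_hat\<close> carries over once the fallback \<open>G\<close> is out
  of play.\<close>

lemma G_hat_tendsto:
  assumes "0 < sig2" and h: "bounded_lipschitz h"
  shows "tendsto_in_prob M (\<lambda>T \<omega>. stieltjes_integral (G_hat G T X \<omega>) h)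
    (stieltjes_integral (cdf (normal_law 0 (1 - \<beta>\<^sup>2))) h)"
proof -
  have \<gamma>: "0 < \<gamma>" using assms beta_square by (simp add: \<gamma>_def)
  obtain B where hB: "\<And>x. \<bar>h x\<bar> \<le> B" and hc: "continuous_on UNIV h" and [measurable]: "h \<in> borel_measurable borel"
    using bounded_lipschitzE[OF h] by blast
  define H where "H v = (\<integral>z. h (sqrt v * z) \<partial>std_normal_distribution)" for v
  have Hc: "continuous_on UNIV H" unfolding H_def[abs_def] by (rule continuous_gaussian_mean[OF hc hB])
  then have [measurable]: "H \<in> borel_measurable borel" by (rule borel_measurable_continuous_onI)
  have H: "stieltjes_integral (cdf (normal_law 0 v)) h = H v" if "0 \<le> v" for v
    using that by (simp add: stieltjes_integral_cdf real_distribution_normal_law integral_normal_law H_def)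
  have eq: "stieltjes_integral (G_hat G T X \<omega>) h =
      (if ols_denom T X \<omega> = 0 \<or> Upsilon_hat T X \<omega> < 0 then stieltjes_integral G h else H (Upsilon_hat T X \<omega>))" for T \<omega>
    by (simp add: G_hat_def H)
  have "tendsto_in_prob M (\<lambda>T \<omega>. stieltjes_integral (G_hat G T X \<omega>) h) (H (1 - \<beta>\<^sup>2))"
  proof (rule tendsto_in_prob_squeeze[OF _ _ Upsilon_hat_tendsto[OF assms(1)] _ D_mean_tendsto])
    fix r :: real assume r: "r > 0"
    have "isCont H (1 - \<beta>\<^sup>2)" using Hc by (simp add: continuous_on_eq_continuous_at)
    then obtain m where m: "m > 0" "\<And>v. dist v (1 - \<beta>\<^sup>2) < m \<Longrightarrow> dist (H v) (H (1 - \<beta>\<^sup>2)) < r"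
      using r unfolding continuous_at_eps_delta by meson
    \<comment> \<open>\<open>m / 2\<close> reaches the continuity range of \<open>H\<close>;
      \<open>\<gamma> / 2\<close> keeps the OLS denominator positive and
      \<open>1 - \<beta>\<^sup>2\<close> keeps \<open>Upsilon_hat\<close> nonnegative, which
      together switch off the fallback.\<close>
    let ?m = "min (m / 2) (min (\<gamma> / 2) (1 - \<beta>\<^sup>2))"
    have "AE \<omega> in M. \<bar>Upsilon_hat T X \<omega> - (1 - \<beta>\<^sup>2)\<bar> \<le> ?m \<longrightarrow> \<bar>D (T - 1) \<omega> / real T - \<gamma>\<bar> \<le> ?m \<longrightarrow>
        \<bar>stieltjes_integral (G_hat G T X \<omega>) h - H (1 - \<beta>\<^sup>2)\<bar> \<le> r" for T
      using AE_ols
    proof (eventually_elim, intro impI)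
      fix \<omega> assume o: "\<forall>T. ols_denom T X \<omega> = D (T - 1) \<omega> \<and> beta_hat T X \<omega> = (\<beta> * D (T - 1) \<omega> + S (T - 1) \<omega>) / D (T - 1) \<omega>"
        and 1: "\<bar>Upsilon_hat T X \<omega> - (1 - \<beta>\<^sup>2)\<bar> \<le> ?m" and 2: "\<bar>D (T - 1) \<omega> / real T - \<gamma>\<bar> \<le> ?m"
      have "D (T - 1) \<omega> / real T > 0" using 2 \<gamma> by linarith
      then have "ols_denom T X \<omega> \<noteq> 0" using o by auto
      moreover have "\<not> Upsilon_hat T X \<omega> < 0" using 1 by linarith
      moreover have "dist (Upsilon_hat T X \<omega>) (1 - \<beta>\<^sup>2) < m" using 1 m(1) unfolding dist_real_def by linarith
      ultimately show "\<bar>stieltjes_integral (G_hat G T X \<omega>) h - H (1 - \<beta>\<^sup>2)\<bar> \<le> r"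
        using m(2)[of "Upsilon_hat T X \<omega>"] by (simp add: eq dist_real_def)
    qed
    then show "\<exists>m>0. \<forall>T. AE \<omega> in M. \<bar>Upsilon_hat T X \<omega> - (1 - \<beta>\<^sup>2)\<bar> \<le> m \<longrightarrow> \<bar>D (T - 1) \<omega> / real T - \<gamma>\<bar> \<le> m \<longrightarrow>
        \<bar>stieltjes_integral (G_hat G T X \<omega>) h - H (1 - \<beta>\<^sup>2)\<bar> \<le> r"
      using m(1) \<gamma> beta_square by (intro exI[of _ ?m]) auto
  qed (simp_all add: eq)
  then show ?thesis using beta_square by (simp add: H)
qed

lemma ols_weak_dependence:
  fixes T\<^sub>E T\<^sub>P :: "nat \<Rightarrow> nat"
  assumes f: "integrable lborel f" "\<And>x. 0 \<le> f x" and dens: "\<And>t. distributed M lborel (eps t) (\<lambda>x. ennreal (f x))"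
    and EP: "\<And>T. T\<^sub>E T < T\<^sub>P T" "filterlim (\<lambda>T. T\<^sub>P T - T\<^sub>E T) at_top sequentially"
    and h: "bounded_lipschitz h"
  shows "tendsto_in_prob M
      (\<lambda>T \<omega>. real_cond_exp M (gen_sigma M X {int (T\<^sub>P T)..int T})
          (\<lambda>\<omega>'. h (sqrt (real (T\<^sub>E T)) * (beta_hat (T\<^sub>E T) X \<omega>' - \<beta>))) \<omega>
        - (\<integral>\<omega>'. h (sqrt (real (T\<^sub>E T)) * (beta_hat (T\<^sub>E T) X \<omega>' - \<beta>)) \<partial>M)) 0"
proof -
  obtain B where hB: "\<And>x. \<bar>h x\<bar> \<le> B" and [measurable]: "h \<in> borel_measurable borel"
    using bounded_lipschitzE[OF h] by blast
  \<comment> \<open>The estimation error rewritten through \<open>Y\<close> and the innovations,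
    hence exactly measurable for the times up to \<open>T\<^sub>E\<close>.\<close>
  define Z' where "Z' T \<omega> = sqrt (real (T\<^sub>E T)) * ((\<beta> * D (T\<^sub>E T - 1) \<omega> + S (T\<^sub>E T - 1) \<omega>) / D (T\<^sub>E T - 1) \<omega> - \<beta>)" for T \<omega>
  show ?thesis
  proof (rule weak_dependence[OF f dens _ _ _ EP, where B=B and h=h and Z'=Z'
        and Z="\<lambda>T \<omega>. sqrt (real (T\<^sub>E T)) * (beta_hat (T\<^sub>E T) X \<omega> - \<beta>)"])
    show "Z' T \<in> borel_measurable (F {..int (T\<^sub>E T)})" for T
      unfolding Z'_def[abs_def]
      by (intro borel_measurable_times borel_measurable_const borel_measurable_diff borel_measurable_divide
          borel_measurable_add D_F S_pred_F) auto
    show "AE \<omega> in M. sqrt (real (T\<^sub>E T)) * (beta_hat (T\<^sub>E T) X \<omega> - \<beta>) = Z' T \<omega>" for T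
      using AE_ols by eventually_elim (simp add: Z'_def)
  qed (use hB in auto)
qed

section \<open>Tightness and the derivatives of the prediction function\<close>

lemma X_tight:
  assumes "K > 0"
  shows "prob {\<omega> \<in> space M. \<bar>X t \<omega>\<bar> > K} \<le> (1 + K4) / K\<^sup>2"
proof -
  have "prob {\<omega> \<in> space M. \<bar>X t \<omega>\<bar> > K} = prob {\<omega> \<in> space M. \<bar>Y t \<omega>\<bar> > K}"
    using AE_X_eq_Y by (intro measure_eq_AE) (auto elim!: eventually_mono)
  then show ?thesis using second_moment_tail[OF Y_meas Y_square assms] by simp
qed

end

text \<open>Linearity in the parameter makes the first derivative constant, so that second
  derivatives vanish identically.\<close>

lemma deriv_psi_full: "deriv (psi_full X T \<omega>) = (\<lambda>_. X (int T) \<omega>)"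
  by (rule ext, rule DERIV_imp_deriv)
    (auto simp: psi_full_def[abs_def] psi_def past_def intro!: derivative_eq_intros)

lemma deriv_psi_trunc:
  "deriv (psi_trunc s c t\<^sub>1 X T \<omega>) = (\<lambda>_. truncate_path s c t\<^sub>1 (\<lambda>t. X t \<omega>) (int T))"
  by (rule ext, rule DERIV_imp_deriv)
    (auto simp: psi_trunc_def[abs_def] psi_def past_def intro!: derivative_eq_intros)

theorem mainTheorem1:
  fixes M :: "'a measure"
    and \<Theta> :: "real set"
    and \<beta>\<^sub>0 :: real
    and eps X :: "int \<Rightarrow> 'a \<Rightarrow> real"
    and f :: "real \<Rightarrow> real"
    and s c :: "int \<Rightarrow> real"
    and a b :: real
    and T\<^sub>E T\<^sub>P :: "nat \<Rightarrow> nat"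
    and G\<^sub>0 :: "real \<Rightarrow> real"
  assumes prob: "prob_space M"
    and Theta_compact: "compact \<Theta>"
    and Theta_stable: "\<forall>\<beta>\<in>\<Theta>. \<bar>\<beta>\<bar> < 1"
    and beta0: "\<beta>\<^sub>0 \<in> interior \<Theta>"
    and eps_iid: "iid M eps"
    and eps_density: "\<forall>t. distributed M lborel (eps t) (\<lambda>x. ennreal (f x))"
    and density_pos: "\<forall>x. f x > 0"
    and eps_mean: "\<forall>t. (\<integral>\<omega>. eps t \<omega> \<partial>M) = 0"
    and eps_moment: "\<forall>t. integrable M (\<lambda>\<omega>. (eps t \<omega>) ^ 4)"
    and X_AR1: "causal_stationary_AR1 M \<beta>\<^sub>0 eps X"
    and ab: "0 < a" "a < b" "b < 1"
    and TE_less_TP: "\<forall>T. T\<^sub>E T < T\<^sub>P T"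
    and TE: "\<forall>\<^sub>F T in sequentially. int (T\<^sub>E T) = int T - \<lfloor>real T powr b\<rfloor>"
    and TP: "\<forall>\<^sub>F T in sequentially. int (T\<^sub>P T) = int T - \<lfloor>real T powr a\<rfloor>"
    and G0: "is_cdf G\<^sub>0"
  shows
    "tendsto_in_distr M (\<lambda>T \<omega>. sqrt (real T) * (beta_hat T X \<omega> - \<beta>\<^sub>0))
        (normal_law 0 (1 - \<beta>\<^sub>0\<^sup>2))
     \<and> (\<forall>T. \<forall>\<omega>\<in>space M. continuous_on \<Theta> (psi_full X T \<omega>) \<and>
          (\<forall>\<theta>\<in>interior \<Theta>. psi_full X T \<omega> differentiable (at \<theta>) \<and>
             deriv (psi_full X T \<omega>) differentiable (at \<theta>)))
     \<and> Op_one M (\<lambda>T \<omega>. ennreal (norm (deriv (psi_full X T \<omega>) \<beta>\<^sub>0)))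
     \<and> (\<exists>V. open V \<and> \<beta>\<^sub>0 \<in> V \<and> V \<subseteq> interior \<Theta> \<and>
          Op_one M (\<lambda>T \<omega>. SUP \<theta>\<in>V. ennreal (norm (deriv (deriv (psi_full X T \<omega>)) \<theta>))) \<and>
          (\<forall>t\<^sub>1 :: nat \<Rightarrow> int.
             (\<forall>T\<ge>1. 1 \<le> t\<^sub>1 T \<and> t\<^sub>1 T \<le> int T) \<and>
             filterlim (\<lambda>T. (real T - real_of_int (t\<^sub>1 T)) / ln (real T)) at_top sequentially \<longrightarrow>
             op_one M (\<lambda>T \<omega>. ennreal (norm
               (sqrt (real T) * (psi_trunc s c (t\<^sub>1 T) X T \<omega> \<beta>\<^sub>0 - psi_full X T \<omega> \<beta>\<^sub>0)))) \<and>
             op_one M (\<lambda>T \<omega>. ennreal (norm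
               (deriv (psi_trunc s c (t\<^sub>1 T) X T \<omega>) \<beta>\<^sub>0 - deriv (psi_full X T \<omega>) \<beta>\<^sub>0))) \<and>
             op_one M (\<lambda>T \<omega>. SUP \<theta>\<in>V. ennreal (norm
               (deriv (deriv (psi_trunc s c (t\<^sub>1 T) X T \<omega>)) \<theta> - deriv (deriv (psi_full X T \<omega>)) \<theta>)))))
     \<and> filterlim (\<lambda>T. (real T - real (T\<^sub>P T)) / ln (real T)) at_top sequentially
     \<and> (\<lambda>T. sqrt (real (T\<^sub>E T)) / sqrt (real T)) \<longlonglongrightarrow> 1
     \<and> strictly_stationary M X
     \<and> (\<forall>h. bounded_lipschitz h \<longrightarrow>
          (let Z = (\<lambda>T \<omega>. sqrt (real (T\<^sub>E T)) * (beta_hat (T\<^sub>E T) X \<omega> - \<beta>\<^sub>0)) in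
           tendsto_in_prob M
             (\<lambda>T \<omega>. real_cond_exp M (gen_sigma M X {int (T\<^sub>P T)..int T}) (\<lambda>\<omega>'. h (Z T \<omega>')) \<omega>
                     - (\<integral>\<omega>'. h (Z T \<omega>') \<partial>M)) 0))
     \<and> tendsto_in_prob M (\<lambda>T \<omega>. Upsilon_hat T X \<omega>) (1 - \<beta>\<^sub>0\<^sup>2)
     \<and> (\<forall>h. bounded_lipschitz h \<longrightarrow>
          tendsto_in_prob M (\<lambda>T \<omega>. stieltjes_integral (G_hat G\<^sub>0 T X \<omega>) h)
            (stieltjes_integral (cdf (normal_law 0 (1 - \<beta>\<^sub>0\<^sup>2))) h))"
proof -
  interpret prob_space M by (rule prob)
  obtain w where w: "summable (\<lambda>j. \<bar>w j\<bar>)" "\<And>t. AE \<omega> in M. (\<lambda>j. w j * eps (t - int j) \<omega>) sums X t \<omega>"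
    using X_AR1 unfolding causal_stationary_AR1_def causal_in_def by blast
  have "\<beta>\<^sub>0 \<in> \<Theta>" using beta0 interior_subset by blast
  then have b1: "\<bar>\<beta>\<^sub>0\<bar> < 1" using Theta_stable by blast
  interpret AR1 M eps X w \<beta>\<^sub>0
    by unfold_locales
      (use eps_iid eps_mean eps_moment w b1 X_AR1 in \<open>auto simp: causal_stationary_AR1_def weakly_stationary_def\<close>)
  \<comment> \<open>The density hypothesis makes \<open>ennreal (f x)\<close> measurable as a
    function of \<open>x\<close>; positivity lets \<open>enn2real\<close> recover
    \<open>f\<close>.\<close>
  have fm: "f \<in> borel_measurable borel"
  proof -
    have "(\<lambda>x. ennreal (f x)) \<in> borel_measurable lborel" by (rule distributed_borel_measurable[OF eps_density[rule_format]])
    then have "(\<lambda>x. enn2real (ennreal (f x))) \<in> borel_measurable borel" by measurable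
    then show ?thesis using density_pos by (simp add: less_imp_le)
  qed
  have fi: "integrable lborel f"
  proof (rule integrableI_bounded)
    have "(\<integral>\<^sup>+x. ennreal (f x) * 1 \<partial>lborel) = (\<integral>\<^sup>+\<omega>. 1 \<partial>M)"
      by (rule distributed_nn_integral[OF eps_density[rule_format]]) auto
    then show "(\<integral>\<^sup>+x. ennreal (norm (f x)) \<partial>lborel) < \<infinity>"
      using density_pos by (simp add: less_imp_le emeasure_space_1)
  qed (use fm in auto)
  have sig: "0 < sig2" by (rule sig2_pos[OF eps_density[rule_format]])
  have X_Op: "Op_one M (\<lambda>T \<omega>. ennreal \<bar>X (int T) \<omega>\<bar>)"
    unfolding Op_one_def
  proof (intro conjI allI impI)
    fix e :: real assume e: "e > 0"
    \<comment> \<open>Makes the Chebyshev bound \<open>(1 + K4) / K\<^sup>2\<close> equal to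
      \<open>e / 2\<close>.\<close>
    define K where "K = sqrt (2 * (1 + K4) / e)"
    have K: "K > 0" "K\<^sup>2 = 2 * (1 + K4) / e" using e moments_nonneg by (auto simp: K_def)
    have "measure M {\<omega> \<in> space M. ennreal \<bar>X (int T) \<omega>\<bar> > ennreal K} < e" for T
    proof -
      have "measure M {\<omega> \<in> space M. ennreal \<bar>X (int T) \<omega>\<bar> > ennreal K} \<le> (1 + K4) / K\<^sup>2"
        using X_tight[OF K(1)] K(1) by (simp add: ennreal_less_iff)
      also have "\<dots> = e / 2"
      proof -
        have "x / (2 * x / e) = e / 2" if "x > 0" for x :: real using that e by simp
        then show ?thesis unfolding K(2) using moments_nonneg by (meson add_pos_nonneg zero_less_one)
      qed
      finally show ?thesis using e by simp
    qed
    then show "\<exists>K. \<forall>\<^sub>F T in sequentially. measure M {\<omega> \<in> space M. ennreal \<bar>X (int T) \<omega>\<bar> > ennreal K} < e"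
      by (intro exI[of _ K] always_eventually allI)
  qed measurable
  have zero_Op: "Op_one M (\<lambda>T \<omega>. 0)" unfolding Op_one_def by (auto intro!: exI[of _ 0])
  have eventually_zero_op: "op_one M Y'"
    if "\<And>T. Y' T \<in> borel_measurable M" "\<And>T \<omega>. T \<ge> 1 \<Longrightarrow> Y' T \<omega> = 0" for Y'
    unfolding op_one_def
  proof (intro conjI allI impI that(1))
    fix e :: real assume "e > 0"
    have "\<forall>\<^sub>F T in sequentially. measure M {\<omega> \<in> space M. Y' T \<omega> > ennreal e} = 0"
      using eventually_ge_at_top[of 1] by eventually_elim (simp add: that(2))
    then show "(\<lambda>T. measure M {\<omega> \<in> space M. Y' T \<omega> > ennreal e}) \<longlonglongrightarrow> 0"
      by (rule tendsto_eventually)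
  qed
  have trunc_meas: "(\<lambda>\<omega>. truncate_path s c t\<^sub>1 (\<lambda>t. X t \<omega>) t) \<in> borel_measurable M" for t\<^sub>1 t
    unfolding truncate_path_def by measurable
  \<comment> \<open>The prediction function reads only the value at time \<open>T\<close>, which
    truncation keeps because \<open>1 \<le> t\<^sub>1 T \<le> T\<close>. At \<open>T = 0\<close> the
    presample value \<open>s 0\<close> stands there, hence \<open>T \<ge> 1\<close>.\<close>
  have trunc_eq: "truncate_path s c (t\<^sub>1 T) (\<lambda>t. X t \<omega>) (int T) = X (int T) \<omega>"
    if "\<forall>T\<ge>1. 1 \<le> t\<^sub>1 T \<and> t\<^sub>1 T \<le> int T" "T \<ge> 1" for t\<^sub>1 T \<omega>
    using that by (auto simp: truncate_path_def dest!: spec[of _ T])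
  have V: "\<exists>V. open V \<and> \<beta>\<^sub>0 \<in> V \<and> V \<subseteq> interior \<Theta> \<and>
          Op_one M (\<lambda>T \<omega>. SUP \<theta>\<in>V. ennreal (norm (deriv (deriv (psi_full X T \<omega>)) \<theta>))) \<and>
          (\<forall>t\<^sub>1 :: nat \<Rightarrow> int.
             (\<forall>T\<ge>1. 1 \<le> t\<^sub>1 T \<and> t\<^sub>1 T \<le> int T) \<and>
             filterlim (\<lambda>T. (real T - real_of_int (t\<^sub>1 T)) / ln (real T)) at_top sequentially \<longrightarrow>
             op_one M (\<lambda>T \<omega>. ennreal (norm
               (sqrt (real T) * (psi_trunc s c (t\<^sub>1 T) X T \<omega> \<beta>\<^sub>0 - psi_full X T \<omega> \<beta>\<^sub>0)))) \<and>
             op_one M (\<lambda>T \<omega>. ennreal (norm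
               (deriv (psi_trunc s c (t\<^sub>1 T) X T \<omega>) \<beta>\<^sub>0 - deriv (psi_full X T \<omega>) \<beta>\<^sub>0))) \<and>
             op_one M (\<lambda>T \<omega>. SUP \<theta>\<in>V. ennreal (norm
               (deriv (deriv (psi_trunc s c (t\<^sub>1 T) X T \<omega>)) \<theta> - deriv (deriv (psi_full X T \<omega>)) \<theta>))))"
  \<comment> \<open>Since the second derivatives vanish, the largest admissible neighbourhood can be
    taken.\<close>
  proof (rule exI[of _ "interior \<Theta>"], intro conjI allI impI open_interior beta0 order_refl)
    have ne: "interior \<Theta> \<noteq> {}" using beta0 by blast
    show "Op_one M (\<lambda>T \<omega>. SUP \<theta>\<in>interior \<Theta>. ennreal (norm (deriv (deriv (psi_full X T \<omega>)) \<theta>)))"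
      using zero_Op ne by (simp add: deriv_psi_full)
    fix t\<^sub>1 :: "nat \<Rightarrow> int"
    assume "(\<forall>T\<ge>1. 1 \<le> t\<^sub>1 T \<and> t\<^sub>1 T \<le> int T) \<and>
        filterlim (\<lambda>T. (real T - real_of_int (t\<^sub>1 T)) / ln (real T)) at_top sequentially"
    then have t1: "\<forall>T\<ge>1. 1 \<le> t\<^sub>1 T \<and> t\<^sub>1 T \<le> int T" by blast
    note eq = trunc_eq[OF t1] and m[measurable] = trunc_meas
    show "op_one M (\<lambda>T \<omega>. ennreal (norm (sqrt (real T) * (psi_trunc s c (t\<^sub>1 T) X T \<omega> \<beta>\<^sub>0 - psi_full X T \<omega> \<beta>\<^sub>0))))"
      by (rule eventually_zero_op) (simp_all add: psi_trunc_def psi_full_def psi_def past_def eq)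
    show "op_one M (\<lambda>T \<omega>. ennreal (norm (deriv (psi_trunc s c (t\<^sub>1 T) X T \<omega>) \<beta>\<^sub>0 - deriv (psi_full X T \<omega>) \<beta>\<^sub>0)))"
      by (rule eventually_zero_op) (simp_all add: deriv_psi_full deriv_psi_trunc eq)
    show "op_one M (\<lambda>T \<omega>. SUP \<theta>\<in>interior \<Theta>. ennreal (norm
        (deriv (deriv (psi_trunc s c (t\<^sub>1 T) X T \<omega>)) \<theta> - deriv (deriv (psi_full X T \<omega>)) \<theta>)))"
      by (rule eventually_zero_op) (simp_all add: deriv_psi_full deriv_psi_trunc ne)
  qed
  note rates = powr_floor_rates[OF ab TE TP]
  show ?thesis
  proof (intro conjI)
    show "\<forall>T. \<forall>\<omega>\<in>space M. continuous_on \<Theta> (psi_full X T \<omega>) \<and>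
          (\<forall>\<theta>\<in>interior \<Theta>. psi_full X T \<omega> differentiable (at \<theta>) \<and>
             deriv (psi_full X T \<omega>) differentiable (at \<theta>))"
      unfolding deriv_psi_full by (auto simp: psi_full_def[abs_def] psi_def intro!: continuous_intros)
    show "Op_one M (\<lambda>T \<omega>. ennreal (norm (deriv (psi_full X T \<omega>) \<beta>\<^sub>0)))"
      using X_Op by (simp add: deriv_psi_full)
    show "\<forall>h. bounded_lipschitz h \<longrightarrow>
          (let Z = (\<lambda>T \<omega>. sqrt (real (T\<^sub>E T)) * (beta_hat (T\<^sub>E T) X \<omega> - \<beta>\<^sub>0)) in
           tendsto_in_prob M
             (\<lambda>T \<omega>. real_cond_exp M (gen_sigma M X {int (T\<^sub>P T)..int T}) (\<lambda>\<omega>'. h (Z T \<omega>')) \<omega>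
                     - (\<integral>\<omega>'. h (Z T \<omega>') \<partial>M)) 0)"
      unfolding Let_def
      using ols_weak_dependence[OF fi less_imp_le[OF density_pos[rule_format]] eps_density[rule_format] TE_less_TP[rule_format] rates(3)]
      by blast
  qed (use beta_hat_clt[OF sig] V rates X_strictly_stationary Upsilon_hat_tendsto[OF sig] G_hat_tendsto[OF sig] in blast)+
qed

end
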